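(* Let $K\ge 1$ and let $f\in\mathcal{S}_H$ be a $K$-quasiconformal harmonic mapping. Then, for any fixed $\theta\in[0,2\pi]$, there is a constant $C_2>0$ such that $$\ell_f(\theta,r)\le C_2\,\max_{\rho\in[0,r]}|f(\rho e^{i\theta})|\,\psi(r)\qquad\text{for } r\in(0.5,1),$$ where $\psi(r)=\left(\log\frac{1}{1-r}\right)^{1/2}$. If, further, $f(re^{i\theta})=O(1)$ as $r\to1^-$, then $$\ell_f(\theta,r)=O(\psi(r))\qquad\text{as } r\to1^-,$$ and the exponent $1/2$ in $\psi(r)$ cannot be replaced by a smaller number (i.e. for no $\tau<1/2$ is it true that $\ell_f(\theta,r)=O\big((\log\frac1{1-r})^{\tau}\big)$ as $r\to1^-$ for all $K$-quasiconformal $f\in\mathcal{S}_H$ and all $\theta$ with $f(re^{i\theta})=O(1)$).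
   Context: $\mathbb{D}=\{z\in\mathbb{C}:|z|<1\}$. $\mathcal{S}_H$ is the family of sense-preserving harmonic univalent mappings $f=h+\overline{g}$ in $\mathbb{D}$, with $h,g$ analytic in $\mathbb{D}$ and $h(0)=g(0)=0$, $h'(0)=1$ (sense-preserving: Jacobian $J_f=|h'|^2-|g'|^2>0$). Write $\|D_f\|=|f_z|+|f_{\overline z}|$ and $\det D_f=J_f=|f_z|^2-|f_{\overline z}|^2$. A sense-preserving homeomorphism $f$ of class $W^{1,2}_{loc}$ from a domain onto a domain is $K$-quasiconformal ($K\ge1$) if $\|D_f(z)\|^2\le K|\det D_f(z)|$, i.e. $\|D_f(z)\|\le K\,l(D_f(z))$ with $l(D_f)=\big||f_z|-|f_{\overline z}|\big|$. For $\theta\in[0,2\pi]$ and $r\in[0,1)$, $\ell_f(\theta,r)$ is the length (counting multiplicity) of the $f$-image of the radial segment $[0,re^{i\theta}]$: $$\ell_f(\theta,r)=\int_0^r\left|f_z(\rho e^{i\theta})+e^{-2i\theta}f_{\overline z}(\rho e^{i\theta})\right|\,d\rho .$$ *)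

theory Defs
  imports "HOL-Complex_Analysis.Complex_Analysis" "HOL-Library.Landau_Symbols"
begin

definition partial_x :: "(complex \<Rightarrow> 'a::real_normed_vector) \<Rightarrow> complex \<Rightarrow> 'a" where
  "partial_x u z = frechet_derivative u (at z) 1"

definition partial_y :: "(complex \<Rightarrow> 'a::real_normed_vector) \<Rightarrow> complex \<Rightarrow> 'a" where
  "partial_y u z = frechet_derivative u (at z) \<i>"

text \<open>The two Wirtinger derivatives, computed from the values \<open>p\<close>, \<open>q\<close> of the two
  real partial derivatives, which may be classical or weak ones.\<close>

definition wirtinger :: "complex \<Rightarrow> complex \<Rightarrow> complex" where
  "wirtinger p q = (p - \<i> * q) / 2"

definition wirtinger_bar :: "complex \<Rightarrow> complex \<Rightarrow> complex" where
  "wirtinger_bar p q = (p + \<i> * q) / 2"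

definition norm_D :: "complex \<Rightarrow> complex \<Rightarrow> real" where
  "norm_D p q = cmod (wirtinger p q) + cmod (wirtinger_bar p q)"

definition det_D :: "complex \<Rightarrow> complex \<Rightarrow> real" where
  "det_D p q = (cmod (wirtinger p q))\<^sup>2 - (cmod (wirtinger_bar p q))\<^sup>2"

text \<open>Weak derivatives are tested against real \<open>C\<^sup>1\<close> functions with compact support in \<open>U\<close>.\<close>

definition test_function :: "complex set \<Rightarrow> (complex \<Rightarrow> real) \<Rightarrow> bool" where
  "test_function U \<phi> \<longleftrightarrow>
     (\<forall>z. \<phi> differentiable (at z)) \<and>
     continuous_on UNIV (partial_x \<phi>) \<and> continuous_on UNIV (partial_y \<phi>) \<and>
     (\<exists>C. compact C \<and> C \<subseteq> U \<and> (\<forall>z. z \<notin> C \<longrightarrow> \<phi> z = 0))"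

definition L2_loc :: "complex set \<Rightarrow> (complex \<Rightarrow> complex) \<Rightarrow> bool" where
  "L2_loc U u \<longleftrightarrow>
     u \<in> borel_measurable (lebesgue_on U) \<and>
     (\<forall>C. compact C \<and> C \<subseteq> U \<longrightarrow> integrable (lebesgue_on C) (\<lambda>z. (cmod (u z))\<^sup>2))"

definition weak_partials ::
  "complex set \<Rightarrow> (complex \<Rightarrow> complex) \<Rightarrow> (complex \<Rightarrow> complex) \<Rightarrow> (complex \<Rightarrow> complex) \<Rightarrow> bool" where
  "weak_partials U u p q \<longleftrightarrow>
     (\<forall>\<phi>. test_function U \<phi> \<longrightarrow>
        (LINT z|lebesgue_on U. partial_x \<phi> z *\<^sub>R u z) = - (LINT z|lebesgue_on U. \<phi> z *\<^sub>R p z) \<and>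
        (LINT z|lebesgue_on U. partial_y \<phi> z *\<^sub>R u z) = - (LINT z|lebesgue_on U. \<phi> z *\<^sub>R q z))"

text \<open>\<open>u\<close> is of class \<open>W^{1,2}\<close> locally on \<open>U\<close>, with weak partial derivatives \<open>p\<close> and \<open>q\<close>
  (which are unique up to null sets).\<close>

definition W12_loc ::
  "complex set \<Rightarrow> (complex \<Rightarrow> complex) \<Rightarrow> (complex \<Rightarrow> complex) \<Rightarrow> (complex \<Rightarrow> complex) \<Rightarrow> bool" where
  "W12_loc U u p q \<longleftrightarrow> L2_loc U u \<and> L2_loc U p \<and> L2_loc U q \<and> weak_partials U u p q"

text \<open>Sense-preserving \<open>K\<close>-quasiconformal homeomorphisms of the domain \<open>U\<close> onto the domain
  \<open>f ` U\<close>. The derivative of a Sobolev map exists only almost everywhere, so positivity of the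
  Jacobian (preservation of sense) and the dilatation bound are almost-everywhere conditions.\<close>

definition quasiconformal_on :: "real \<Rightarrow> complex set \<Rightarrow> (complex \<Rightarrow> complex) \<Rightarrow> bool" where
  "quasiconformal_on K U f \<longleftrightarrow>
     open U \<and> connected U \<and> U \<noteq> {} \<and> open (f ` U) \<and>
     (\<exists>f'. homeomorphism U (f ` U) f f') \<and>
     (\<exists>p q. W12_loc U f p q \<and>
        (AE z in lebesgue_on U. det_D (p z) (q z) > 0 \<and>
           (norm_D (p z) (q z))\<^sup>2 \<le> K * \<bar>det_D (p z) (q z)\<bar>))"

text \<open>Membership depends only on the values of the function on the unit disc.\<close>

definition S_H :: "(complex \<Rightarrow> complex) set" where
  "S_H = {f. inj_on f (ball 0 1) \<and>
     (\<exists>h g. h holomorphic_on ball 0 1 \<and> g holomorphic_on ball 0 1 \<and>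
        h 0 = 0 \<and> g 0 = 0 \<and> deriv h 0 = 1 \<and>
        (\<forall>z\<in>ball 0 1. f z = h z + cnj (g z)) \<and>
        (\<forall>z\<in>ball 0 1. (cmod (deriv h z))\<^sup>2 - (cmod (deriv g z))\<^sup>2 > 0))}"

definition radial_length :: "(complex \<Rightarrow> complex) \<Rightarrow> real \<Rightarrow> real \<Rightarrow> real" where
  "radial_length f \<theta> r =
     integral {0..r} (\<lambda>\<rho>. let z = of_real \<rho> * cis \<theta> in
       cmod (wirtinger (partial_x f z) (partial_y f z)
             + cis (- 2 * \<theta>) * wirtinger_bar (partial_x f z) (partial_y f z)))"

definition psi :: "real \<Rightarrow> real" where
  "psi r = ln (1 / (1 - r)) powr (1 / 2)"

end

(*
  Upper bound.  On a dyadic interval of the radius at distance about 2^(-j) from the circle, the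
  sub-mean value property of |h'|^2 and the dilatation bound give
  2^(-j) |h'| <= C sqrt (area of f(D_j)), where D_j is a disc of radius comparable to 2^(-j); so the
  piece of the radius has image of length at most C sqrt (area of f(D_j)).  A Harnack inequality
  puts f(D_j) in a disc of radius C M, where M is the maximum of |f| on the radius, and by univalence
  the areas sum up to at most C M^2.  There are about log (1/(1-r)) intervals, and the
  Cauchy-Schwarz inequality yields the square root.  The Harnack inequality holds for a univalent
  nonvanishing F on the disc with |F(0)| = 1: the function arsinh (log |F|) has Dirichlet integral
  bounded in terms of K, because |dw|^2 / (|w|^2 (1 + log^2 |w|)) has finite total area; so it is
  bounded on some circle (length-area method), and the maximum principle does the rest.

  Sharpness.  With q = L - log (1 - z) the function exp (i q^b + c q^(2b-1)) is univalent for
  b < 1/2: it spirals inwards to the unit circle, and for large c neighbouring turns stay apart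
  because both their distance and the width of the channel are of order q^(b-1).  On the radius it
  is bounded, and the length over [0,r] is of order (log (1/(1-r)))^b.
*)

theory Submission
  imports Defs
begin

subsection \<open>Weak and classical partial derivatives\<close>

text \<open>\<open>quasiconformal_on\<close> bounds the dilatation only almost everywhere and for
  unspecified weak derivatives, but the estimates need it at every point for \<open>deriv h\<close>
  and \<open>deriv g\<close>; uniqueness of weak derivatives and continuity bridge this gap. The
  function arsinh enters because |dw|^2 / |w|^2, the area element of the logarithm, has infinite
  mass both at 0 and at infinity. Damping by 1 / (1 + log^2 |w|) makes the mass finite, while arsinh
  (log |w|) still tends to infinity with |w|. The resulting Harnack constant depends only on K and a
  ratio of radii, so it is the same on every dyadic disc. The example is conformal and so serves
  every K at once. Its exponents are forced: for x = Re q the angle x^b gives a channel of width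
  about x^(b-1), and one turn takes an increment of x of order x^(1-b). The logarithm of the modulus
  has to drop by about x^(b-1) per turn, so its derivative is of order x^(2b-2) and it is itself of
  order x^(2b-1). This stays bounded together with its decrease exactly as long as b < 1/2.\<close>

lemma derivative_zero_outside_support:
  fixes G :: "complex \<Rightarrow> 'b::real_normed_vector"
  assumes der: "\<And>z. (G has_derivative G' z) (at z)"
    and C: "compact C" and supp: "\<And>z. z \<notin> C \<Longrightarrow> G z = 0"
  shows "z \<notin> C \<Longrightarrow> G' z e = 0"
proof -
  assume z: "z \<notin> C"
  have "open (-C)" using C compact_imp_closed by blast
  have "(G has_derivative (\<lambda>_. 0)) (at z)"
    by (rule has_derivative_transform_within_open[OF _ \<open>open (-C)\<close>, of "\<lambda>_. 0"]) (use z supp in auto)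
  then have "G' z = (\<lambda>_. 0)" using has_derivative_unique[OF der] by blast
  then show ?thesis by simp
qed

lemma integral_derivative_compact_support:
  fixes G :: "complex \<Rightarrow> complex"
  assumes der: "\<And>z. (G has_derivative G' z) (at z)"
    and cont: "continuous_on UNIV (\<lambda>z. G' z e)"
    and C: "compact C" and supp: "\<And>z. z \<notin> C \<Longrightarrow> G z = 0"
  shows "(LINT z|lborel. G' z e) = 0"
proof -
  have G'0: "G' z e = 0" if "z \<notin> C" for z
    using derivative_zero_outside_support[OF der C supp that] .
  have contG: "continuous_on UNIV G"
    by (meson der has_derivative_continuous continuous_at_imp_continuous_on)
  have intG: "integrable lborel G"
  proof -
    have "integrable lborel (\<lambda>x. indicator C x *\<^sub>R G x)"
      by (rule borel_integrable_compact[OF C]) (meson contG continuous_on_subset subset_UNIV)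
    moreover have "(\<lambda>x. indicator C x *\<^sub>R G x) = G"
      using supp by (auto simp: indicator_def fun_eq_iff)
    ultimately show ?thesis by simp
  qed
  obtain B where B: "\<And>z. cmod (G' z e) \<le> B" "B \<ge> 0"
  proof -
    have "compact ((\<lambda>z. G' z e) ` C)"
      using C cont compact_continuous_image continuous_on_subset by blast
    then obtain b where b: "\<And>z. z \<in> C \<Longrightarrow> cmod (G' z e) \<le> b"
      by (meson bounded_iff compact_imp_bounded imageI)
    show thesis
    proof (rule that[of "max b 0"])
      show "cmod (G' z e) \<le> max b 0" for z
        using b[of z] G'0[of z] by (cases "z \<in> C") auto
    qed simp
  qed
  obtain R where R: "C \<subseteq> cball 0 R"
    using compact_imp_bounded[OF C] unfolding bounded_iff by (auto simp: subset_iff)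
  \<comment> \<open>The difference quotients integrate to 0 by translation invariance.\<close>
  define s where "s n z = real (Suc n) *\<^sub>R (G (z + (1 / real (Suc n)) *\<^sub>R e) - G z)" for n z
  have s_le: "cmod (s n z) \<le> B" for n z
  proof -
    define t where "t = 1 / real (Suc n)"
    have t: "t > 0" by (simp add: t_def)
    have d: "((\<lambda>x. G (z + x *\<^sub>R e)) has_derivative (\<lambda>h. h *\<^sub>R G' (z + x *\<^sub>R e) e)) (at x within {0..t})" for x
    proof -
      have "((\<lambda>x. z + x *\<^sub>R e) has_vector_derivative e) (at x within {0..t})"
        by (auto intro!: derivative_eq_intros)
      from vector_derivative_diff_chain_within[OF this has_derivative_at_withinI[OF der]]
      show ?thesis by (simp add: o_def has_vector_derivative_def)
    qed
    have "norm (G (z + t *\<^sub>R e) - G (z + 0 *\<^sub>R e)) \<le> B * norm (t - 0)"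
      by (rule differentiable_bound[where S = "{0..t}", OF _ d])
        (use B t in \<open>auto simp: mult.commute[of B] intro!: onorm_bound mult_left_mono\<close>)
    then have "cmod (G (z + t *\<^sub>R e) - G z) \<le> B * t" using t by simp
    then have "real (Suc n) * cmod (G (z + t *\<^sub>R e) - G z) \<le> B"
      by (simp add: t_def field_simps)
    then show ?thesis by (simp add: s_def t_def del: of_nat_Suc)
  qed
  \<comment> \<open>No shift is longer than \<open>norm e\<close>, so one ball contains the supports
    of all difference quotients, and B on that ball is an integrable majorant.\<close>
  have s_supp: "s n z = 0" if "z \<notin> cball 0 (R + norm e)" for n z
  proof -
    have "z \<notin> cball 0 R" using that norm_ge_zero[of e] unfolding mem_cball_0 by linarith
    then have "z \<notin> C" using R by blast
    moreover have "z + (1 / real (Suc n)) *\<^sub>R e \<notin> C"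
    proof
      assume "z + (1 / real (Suc n)) *\<^sub>R e \<in> C"
      then have "norm (z + (1 / real (Suc n)) *\<^sub>R e) \<le> R" using R by auto
      moreover have "norm ((1 / real (Suc n)) *\<^sub>R e) \<le> norm e"
        by (simp add: divide_le_eq mult_le_cancel_left1)
      moreover have "norm z \<le> norm (z + (1 / real (Suc n)) *\<^sub>R e) + norm ((1 / real (Suc n)) *\<^sub>R e)"
        using norm_triangle_ineq4[of "z + (1 / real (Suc n)) *\<^sub>R e" "(1 / real (Suc n)) *\<^sub>R e"]
        by (simp del: of_nat_Suc)
      ultimately have "norm z \<le> R + norm e" by linarith
      then show False using that by simp
    qed
    ultimately show ?thesis by (simp add: s_def supp)
  qed
  have int_shift: "integrable lborel (\<lambda>z. G (z + a))" "(LINT z|lborel. G (z + a)) = (LINT z|lborel. G z)" for a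
  proof -
    have *: "distr lborel borel ((+) a) = (lborel :: complex measure)" by (rule lborel_distr_plus)
    have [measurable]: "G \<in> borel_measurable borel" using intG by simp
    have "integrable (distr lborel borel ((+) a)) G" using intG * by simp
    then show "integrable lborel (\<lambda>z. G (z + a))"
      by (subst (asm) integrable_distr_eq) (auto simp: add.commute)
    have "(LINT z|lborel. G z) = (LINT z|distr lborel borel ((+) a). G z)" using * by simp
    also have "\<dots> = (LINT z|lborel. G (a + z))" by (subst integral_distr) auto
    finally show "(LINT z|lborel. G (z + a)) = (LINT z|lborel. G z)" by (simp add: add.commute)
  qed
  have s_int: "(LINT z|lborel. s n z) = 0" for n
  proof -
    have "(LINT z|lborel. s n z) = real (Suc n) *\<^sub>R
      ((LINT z|lborel. G (z + (1 / real (Suc n)) *\<^sub>R e)) - (LINT z|lborel. G z))"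
      unfolding s_def by (subst integral_scaleR_right, subst Bochner_Integration.integral_diff)
        (use int_shift intG in auto)
    then show ?thesis using int_shift(2) by simp
  qed
  have "(\<lambda>n. LINT z|lborel. s n z) \<longlonglongrightarrow> (LINT z|lborel. G' z e)"
  proof (rule integral_dominated_convergence[where w = "\<lambda>z. B * indicator (cball 0 (R + norm e)) z"])
    show "(\<lambda>z. G' z e) \<in> borel_measurable lborel"
      using cont borel_measurable_continuous_onI by auto
    show "s n \<in> borel_measurable lborel" for n
    proof -
      have "continuous_on UNIV (s n)" unfolding s_def
        by (intro continuous_intros contG continuous_on_compose2[OF contG]) auto
      then show ?thesis using borel_measurable_continuous_onI by simp
    qed
    show "integrable lborel (\<lambda>z. B * indicator (cball 0 (R + norm e)) z :: real)"
      by (intro integrable_mult_right integrable_real_indicator emeasure_lborel_cball_finite) auto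
    show "AE z in lborel. norm (s n z) \<le> B * indicator (cball 0 (R + norm e)) z" for n
      using s_le[of n] s_supp[of _ n] by (auto simp: indicator_def)
    show "AE z in lborel. (\<lambda>n. s n z) \<longlonglongrightarrow> G' z e"
    proof (rule AE_I2)
      fix z
      have "((\<lambda>x. z + x *\<^sub>R e) has_vector_derivative e) (at 0)"
        by (auto intro!: derivative_eq_intros)
      from vector_derivative_diff_chain_within[OF this, of G "G' z"]
      have "((\<lambda>x. G (z + x *\<^sub>R e)) has_vector_derivative G' z e) (at 0)"
        using der[of z] by (simp add: o_def has_derivative_at_withinI)
      then have "((\<lambda>h. norm (G (z + h *\<^sub>R e) - G z - h *\<^sub>R G' z e) / norm h) \<longlongrightarrow> 0) (at 0)"
        by (simp add: has_vector_derivative_def has_derivative_at)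
      then have "((\<lambda>h. norm ((G (z + h *\<^sub>R e) - G z) /\<^sub>R h - G' z e)) \<longlongrightarrow> 0) (at 0)"
      proof (rule Lim_transform_eventually)
        show "\<forall>\<^sub>F h in at 0. norm (G (z + h *\<^sub>R e) - G z - h *\<^sub>R G' z e) / norm h
            = norm ((G (z + h *\<^sub>R e) - G z) /\<^sub>R h - G' z e)"
        proof (rule eventually_at_topological[THEN iffD2], intro exI[of _ UNIV] conjI ballI impI)
          fix h :: real assume "h \<noteq> 0"
          then have "(G (z + h *\<^sub>R e) - G z) /\<^sub>R h - G' z e = (G (z + h *\<^sub>R e) - G z - h *\<^sub>R G' z e) /\<^sub>R h"
            by (simp add: scaleR_diff_right)
          then show "norm (G (z + h *\<^sub>R e) - G z - h *\<^sub>R G' z e) / norm h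
            = norm ((G (z + h *\<^sub>R e) - G z) /\<^sub>R h - G' z e)"
            by (simp add: divide_inverse mult.commute)
        qed auto
      qed
      then have l: "((\<lambda>h. (G (z + h *\<^sub>R e) - G z) /\<^sub>R h) \<longlongrightarrow> G' z e) (at 0)"
        by (rule LIM_zero_cancel[OF tendsto_norm_zero_cancel])
      have "filterlim (\<lambda>n. 1 / real (Suc n)) (at 0) sequentially"
        using LIMSEQ_inverse_real_of_nat
        by (auto simp: filterlim_at inverse_eq_divide)
      from filterlim_compose[OF l this]
      show "(\<lambda>n. s n z) \<longlonglongrightarrow> G' z e" by (simp add: s_def field_simps)
    qed
  qed
  then show ?thesis using s_int by (simp add: LIMSEQ_const_iff)
qed

lemma integral_lebesgue_on_compact_support:
  fixes k :: "complex \<Rightarrow> 'b::{banach, second_countable_topology}"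
  assumes U: "open U" and k: "continuous_on U k" and C: "compact C" "C \<subseteq> U"
    and supp: "\<And>z. z \<in> U - C \<Longrightarrow> k z = 0"
  shows "integrable lborel (\<lambda>z. if z \<in> U then k z else 0)"
    and "(LINT z|lebesgue_on U. k z) = (LINT z|lborel. (if z \<in> U then k z else 0))"
proof -
  have eq: "(\<lambda>z. if z \<in> U then k z else 0) = (\<lambda>z. indicator C z *\<^sub>R k z)"
    using C supp by (auto simp: indicator_def fun_eq_iff)
  show int: "integrable lborel (\<lambda>z. if z \<in> U then k z else 0)"
    unfolding eq by (rule borel_integrable_compact[OF C(1)]) (meson k C continuous_on_subset)
  have U': "U \<in> sets lebesgue" using U by simp
  have "(LINT z|lebesgue_on U. k z) = (LINT z|lebesgue. indicator U z *\<^sub>R k z)"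
    by (rule integral_restrict_space) (use U' in auto)
  also have "\<dots> = (LINT z|lebesgue. (if z \<in> U then k z else 0))"
    by (intro Bochner_Integration.integral_cong) (auto simp: indicator_def)
  also have "\<dots> = (LINT z|lborel. (if z \<in> U then k z else 0))"
    by (rule integral_completion) (use int in auto)
  finally show "(LINT z|lebesgue_on U. k z) = (LINT z|lborel. (if z \<in> U then k z else 0))" .
qed

lemma test_function_has_derivative:
  assumes "test_function U \<phi>"
  obtains \<phi>' C where "\<And>z. (\<phi> has_derivative \<phi>' z) (at z)"
    "partial_x \<phi> = (\<lambda>z. \<phi>' z 1)" "partial_y \<phi> = (\<lambda>z. \<phi>' z \<i>)"
    "continuous_on UNIV (\<lambda>z. \<phi>' z 1)" "continuous_on UNIV (\<lambda>z. \<phi>' z \<i>)"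
    "compact C" "C \<subseteq> U" "\<And>z. z \<notin> C \<Longrightarrow> \<phi> z = 0"
proof -
  obtain C where C: "compact C" "C \<subseteq> U" "\<And>z. z \<notin> C \<Longrightarrow> \<phi> z = 0"
    using assms unfolding test_function_def by blast
  define \<phi>' where "\<phi>' z = frechet_derivative \<phi> (at z)" for z
  have "(\<phi> has_derivative \<phi>' z) (at z)" for z
    using assms unfolding test_function_def \<phi>'_def by (simp add: frechet_derivative_works)
  moreover have "partial_x \<phi> = (\<lambda>z. \<phi>' z 1)" "partial_y \<phi> = (\<lambda>z. \<phi>' z \<i>)"
    by (auto simp: partial_x_def partial_y_def \<phi>'_def)
  ultimately show thesis
    using that[of \<phi>' C] C assms unfolding test_function_def by simp
qed

text \<open>The product of \<phi> and f, extended by zero, is continuously differentiable on the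
  whole plane, because U and the complement of C are open and cover it. Hence its derivative
  integrates to 0, and the product rule splits that integral.\<close>

lemma integration_by_parts_test_function:
  fixes f :: "complex \<Rightarrow> complex"
  assumes U: "open U" and f: "\<And>z. z \<in> U \<Longrightarrow> (f has_derivative D z) (at z)"
    and D: "continuous_on U (\<lambda>z. D z e)"
    and \<phi>: "\<And>z. (\<phi> has_derivative \<phi>' z) (at z)" "continuous_on UNIV (\<lambda>z. \<phi>' z e)"
    and C: "compact C" "C \<subseteq> U" "\<And>z. z \<notin> C \<Longrightarrow> (\<phi> z :: real) = 0"
  shows "(LINT z|lebesgue_on U. \<phi>' z e *\<^sub>R f z) = - (LINT z|lebesgue_on U. \<phi> z *\<^sub>R D z e)"
proof -
  have f_cont: "continuous_on U f"
    by (meson f has_derivative_continuous continuous_at_imp_continuous_on)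
  have \<phi>_cont: "continuous_on UNIV \<phi>"
    by (meson \<phi>(1) has_derivative_continuous continuous_at_imp_continuous_on)
  have cl: "open (-C)" using C compact_imp_closed by blast
  have \<phi>'0: "\<phi>' z e = 0" if "z \<notin> C" for z
    using derivative_zero_outside_support[OF \<phi>(1) C(1,3) that] .
  define G where "G z = (if z \<in> U then \<phi> z *\<^sub>R f z else 0)" for z
  define G' where "G' z h = (if z \<in> U then \<phi> z *\<^sub>R D z h + \<phi>' z h *\<^sub>R f z else 0)" for z h
  have G0: "G z = 0" if "z \<notin> C" for z using that C by (auto simp: G_def)
  have "(G has_derivative G' z) (at z)" for z
  proof (cases "z \<in> U")
    case True
    have "((\<lambda>z. \<phi> z *\<^sub>R f z) has_derivative G' z) (at z)"
      using True has_derivative_scaleR[OF \<phi>(1) f[OF True]] by (simp add: G'_def[abs_def])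
    then show ?thesis
      by (rule has_derivative_transform_within_open[OF _ U True]) (auto simp: G_def)
  next
    case False
    then have z: "z \<in> -C" using C by auto
    have "G' z = (\<lambda>_. 0)" using False by (auto simp: G'_def)
    moreover have "(G has_derivative (\<lambda>_. 0)) (at z)"
      by (rule has_derivative_transform_within_open[OF _ cl z, of "\<lambda>_. 0"]) (use G0 in auto)
    ultimately show ?thesis by simp
  qed
  moreover have "continuous_on UNIV (\<lambda>z. G' z e)"
  proof -
    have "continuous_on U (\<lambda>z. G' z e)"
      by (rule continuous_on_eq[of _ "\<lambda>z. \<phi> z *\<^sub>R D z e + \<phi>' z e *\<^sub>R f z"])
        (use D f_cont in \<open>auto simp: G'_def intro!: continuous_intros continuous_on_subset[OF \<phi>(2)] continuous_on_subset[OF \<phi>_cont]\<close>)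
    moreover have "continuous_on (-C) (\<lambda>z. G' z e)"
      by (rule continuous_on_eq[of _ "\<lambda>z. 0"]) (use C \<phi>'0 in \<open>auto simp: G'_def\<close>)
    moreover have "UNIV = U \<union> -C" using C by auto
    ultimately show ?thesis
      using continuous_on_open_Un[OF U cl] by simp
  qed
  ultimately have G'0: "(LINT z|lborel. G' z e) = 0"
    using integral_derivative_compact_support[of G G' e C] G0 C by blast
  have 1: "continuous_on U (\<lambda>z. \<phi> z *\<^sub>R D z e)"
    using D by (auto intro!: continuous_intros continuous_on_subset[OF \<phi>_cont])
  have 2: "continuous_on U (\<lambda>z. \<phi>' z e *\<^sub>R f z)"
    using f_cont by (auto intro!: continuous_intros continuous_on_subset[OF \<phi>(2)])
  note k1 = integral_lebesgue_on_compact_support[OF U 1 C(1,2)]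
  note k2 = integral_lebesgue_on_compact_support[OF U 2 C(1,2)]
  have "(\<lambda>z. G' z e) = (\<lambda>z. (if z \<in> U then \<phi> z *\<^sub>R D z e else 0) + (if z \<in> U then \<phi>' z e *\<^sub>R f z else 0))"
    by (auto simp: G'_def)
  then have "(LINT z|lborel. (if z \<in> U then \<phi> z *\<^sub>R D z e else 0)) + (LINT z|lborel. (if z \<in> U then \<phi>' z e *\<^sub>R f z else 0)) = 0"
    using Bochner_Integration.integral_add[OF k1(1) k2(1)] C(3) \<phi>'0 G'0 by simp
  then show ?thesis
    using k1(2) k2(2) C(3) \<phi>'0 by (simp add: add_eq_0_iff)
qed

lemma weak_partials_C1:
  fixes f :: "complex \<Rightarrow> complex"
  assumes U: "open U" and f: "\<And>z. z \<in> U \<Longrightarrow> (f has_derivative D z) (at z)"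
    and D: "continuous_on U (\<lambda>z. D z 1)" "continuous_on U (\<lambda>z. D z \<i>)"
  shows "weak_partials U f (\<lambda>z. D z 1) (\<lambda>z. D z \<i>)"
  unfolding weak_partials_def
proof (intro allI impI)
  fix \<phi> assume "test_function U \<phi>"
  then obtain \<phi>' C where *: "\<And>z. (\<phi> has_derivative \<phi>' z) (at z)"
    and p: "partial_x \<phi> = (\<lambda>z. \<phi>' z 1)" "partial_y \<phi> = (\<lambda>z. \<phi>' z \<i>)"
    and c: "continuous_on UNIV (\<lambda>z. \<phi>' z 1)" "continuous_on UNIV (\<lambda>z. \<phi>' z \<i>)"
    and C: "compact C" "C \<subseteq> U" "\<And>z. z \<notin> C \<Longrightarrow> \<phi> z = 0"
    by (rule test_function_has_derivative) blast
  show "(LINT z|lebesgue_on U. partial_x \<phi> z *\<^sub>R f z) = - (LINT z|lebesgue_on U. \<phi> z *\<^sub>R D z 1) \<and>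
        (LINT z|lebesgue_on U. partial_y \<phi> z *\<^sub>R f z) = - (LINT z|lebesgue_on U. \<phi> z *\<^sub>R D z \<i>)"
    unfolding p using integration_by_parts_test_function[OF U f D(1) * c(1) C]
      integration_by_parts_test_function[OF U f D(2) * c(2) C] by blast
qed

lemma L2_loc_continuous:
  assumes U: "open U" and u: "continuous_on U u"
  shows "L2_loc U u"
  unfolding L2_loc_def
proof (intro conjI allI impI)
  show "u \<in> borel_measurable (lebesgue_on U)"
    using U u by (intro continuous_imp_measurable_on_sets_lebesgue) auto
  fix C assume C: "compact C \<and> C \<subseteq> U"
  have "continuous_on C (\<lambda>z. (cmod (u z))\<^sup>2)"
    using C u by (auto intro!: continuous_intros continuous_on_subset[OF u])
  then have "integrable lborel (\<lambda>z. indicator C z *\<^sub>R (cmod (u z))\<^sup>2)"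
    using C borel_integrable_compact by blast
  then have "integrable lebesgue (\<lambda>z. indicator C z *\<^sub>R (cmod (u z))\<^sup>2)"
    by (simp add: integrable_completion)
  then show "integrable (lebesgue_on C) (\<lambda>z. (cmod (u z))\<^sup>2)"
    using C lmeasurable_compact by (subst integrable_restrict_space) (auto intro: fmeasurableD)
qed

section \<open>Integrals against test functions determine a function almost everywhere\<close>

lemma sigma_finite_lebesgue: "sigma_finite_measure (lebesgue :: 'a::euclidean_space measure)"
proof -
  obtain A :: "'a set set" where "countable A" "A \<subseteq> sets lborel" "\<Union>A = space lborel"
    "\<forall>a\<in>A. emeasure lborel a \<noteq> \<infinity>"
    using sigma_finite_measure.sigma_finite_countable[OF sigma_finite_lborel] by metis
  then show ?thesis
    by unfold_locales (auto intro!: exI[of _ A])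
qed

text \<open>Boxes form an intersection-stable generator of the Borel sets, so an induction over the
  generated \<sigma>-algebra applies. Its complement step needs the integral over the whole plane,
  which vanishes as a limit over growing boxes. Lebesgue sets differ from Borel sets by null sets
  only.\<close>

lemma AE_zero_if_box_integrals_zero:
  fixes w :: "complex \<Rightarrow> complex"
  assumes w: "integrable lebesgue w"
    and box0: "\<And>a b. (LINT z|lebesgue. indicator (box a b) z *\<^sub>R w z) = 0"
  shows "AE z in lebesgue. w z = 0"
proof -
  have iw: "set_integrable lebesgue A w" if "A \<in> sets lebesgue" for A
    using that w unfolding set_integrable_def by (rule integrable_mult_indicator)
  have whole: "(LINT z|lebesgue. w z) = 0"
  proof -
    let ?A = "\<lambda>n::nat. box (- (real n *\<^sub>R One)) (real n *\<^sub>R One) :: complex set"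
    have "(\<lambda>n. LINT z:?A n|lebesgue. w z) \<longlonglongrightarrow> (LINT z:(\<Union>n. ?A n)|lebesgue. w z)"
      by (rule set_integral_cont_up) (use iw in \<open>auto simp: incseq_def box_def intro: order_less_trans\<close>)
    then show ?thesis
      using box0 by (simp add: set_lebesgue_integral_def LIMSEQ_const_iff UN_box_eq_UNIV)
  qed
  have borel0: "(LINT z:A|lebesgue. w z) = 0" if "A \<in> sets borel" for A
  proof -
    have "A \<in> sigma_sets UNIV (range (\<lambda>(a, b). box a b::complex set))"
      using that by (simp add: borel_eq_box)
    then show ?thesis
    proof (rule sigma_sets_induct_disjoint[rotated 2])
      show "Int_stable (range (\<lambda>(a, b). box a b::complex set))"
        by (auto simp: Int_stable_def box_Int_box)
    next
      fix A assume "A \<in> range (\<lambda>(a, b). box a b::complex set)"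
      then show "(LINT z:A|lebesgue. w z) = 0" using box0 by (auto simp: set_lebesgue_integral_def)
    next
      fix A assume A: "A \<in> sigma_sets UNIV (range (\<lambda>(a, b). box a b::complex set))" and 0: "(LINT z:A|lebesgue. w z) = 0"
      have "A \<in> sets borel" using A unfolding borel_eq_box by simp
      then have A': "A \<in> sets lebesgue" "UNIV - A \<in> sets lebesgue" by auto
      have "(LINT z:(UNIV - A) \<union> A|lebesgue. w z) = (LINT z:UNIV - A|lebesgue. w z) + (LINT z:A|lebesgue. w z)"
        by (rule set_integral_Un) (use A' iw in auto)
      then show "(LINT z:UNIV - A|lebesgue. w z) = 0"
        using 0 whole by (simp add: set_lebesgue_integral_def)
    next
      fix A :: "nat \<Rightarrow> complex set"
      assume d: "disjoint_family A" and A: "range A \<subseteq> sigma_sets UNIV (range (\<lambda>(a, b). box a b::complex set))"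
        and 0: "\<And>i. (LINT z:A i|lebesgue. w z) = 0"
      have "A i \<in> sets borel" for i using A unfolding borel_eq_box by auto
      then have A': "A i \<in> sets lebesgue" for i by simp
      have "(LINT z:(\<Union>i. A i)|lebesgue. w z) = (\<Sum>i. (LINT z:A i|lebesgue. w z))"
        by (rule lebesgue_integral_countable_add)
          (use A' iw d in \<open>auto simp: disjoint_family_on_def intro!: iw\<close>)
      then show "(LINT z:(\<Union>i. A i)|lebesgue. w z) = 0" using 0 by simp
    qed (auto simp: set_lebesgue_integral_def)
  qed
  show ?thesis
  proof (rule sigma_finite_measure.density_zero[OF _ w])
    fix A :: "complex set" assume "A \<in> sets lebesgue"
    then obtain B N N' where A: "A = B \<union> N" "N \<subseteq> N'" "N' \<in> null_sets lborel" "B \<in> sets lborel"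
      by (rule sets_completionE) blast
    have N: "N \<in> null_sets lebesgue"
      using A by (metis null_sets_completion_subset null_sets_completionI)
    have "(LINT z:A|lebesgue. w z) = (LINT z:B|lebesgue. w z)"
    proof (rule set_integral_cong_set)
      have "B \<in> sets lebesgue" using A by simp
      then show "set_borel_measurable lebesgue A w" "set_borel_measurable lebesgue B w"
        using A(1) N w null_setsD2[OF N] unfolding set_borel_measurable_def
        by (auto intro!: borel_measurable_scaleR borel_measurable_indicator)
      show "AE x in lebesgue. (x \<in> B) = (x \<in> A)"
        by (rule AE_I'[OF N]) (use A(1) in auto)
    qed
    then show "(LINT z:A|lebesgue. w z) = 0" using borel0 A by simp
  qed (rule sigma_finite_lebesgue)
qed

text \<open>The partial derivatives appear as explicit coefficient functions, so that closure under
  products and composition reduces to formulas for them, and \<open>partial_x\<close>,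
  \<open>partial_y\<close> can be read off.\<close>

definition C1_real :: "(complex \<Rightarrow> real) \<Rightarrow> bool" where
  "C1_real \<phi> \<longleftrightarrow> (\<exists>a b. (\<forall>z. (\<phi> has_derivative (\<lambda>h. a z * Re h + b z * Im h)) (at z)) \<and>
     continuous_on UNIV a \<and> continuous_on UNIV b)"

lemma C1_real_continuous: "C1_real \<phi> \<Longrightarrow> continuous_on UNIV \<phi>"
  unfolding C1_real_def by (meson has_derivative_continuous continuous_at_imp_continuous_on)

lemma C1_real_measurable: "C1_real \<phi> \<Longrightarrow> \<phi> \<in> borel_measurable lebesgue"
  by (rule measurable_completion) (simp add: borel_measurable_continuous_onI C1_real_continuous)

lemma C1_real_mult:
  assumes "C1_real \<phi>" "C1_real \<psi>"
  shows "C1_real (\<lambda>z. \<phi> z * \<psi> z)"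
proof -
  from assms(1) obtain a b where
    1: "\<And>z. (\<phi> has_derivative (\<lambda>h. a z * Re h + b z * Im h)) (at z)" "continuous_on UNIV a" "continuous_on UNIV b"
    unfolding C1_real_def by blast
  from assms(2) obtain c d where
    2: "\<And>z. (\<psi> has_derivative (\<lambda>h. c z * Re h + d z * Im h)) (at z)" "continuous_on UNIV c" "continuous_on UNIV d"
    unfolding C1_real_def by blast
  have "((\<lambda>z. \<phi> z * \<psi> z) has_derivative (\<lambda>h. (a z * \<psi> z + \<phi> z * c z) * Re h + (b z * \<psi> z + \<phi> z * d z) * Im h)) (at z)" for z
    by (rule has_derivative_eq_rhs[OF has_derivative_mult[OF 1(1) 2(1)]]) (auto simp: algebra_simps)
  moreover have "continuous_on UNIV (\<lambda>z. a z * \<psi> z + \<phi> z * c z)" "continuous_on UNIV (\<lambda>z. b z * \<psi> z + \<phi> z * d z)"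
    using 1 2 C1_real_continuous assms by (auto intro!: continuous_intros)
  ultimately show ?thesis unfolding C1_real_def
    by (intro exI[of _ "\<lambda>z. a z * \<psi> z + \<phi> z * c z"] exI[of _ "\<lambda>z. b z * \<psi> z + \<phi> z * d z"]) simp
qed

lemma C1_real_compose:
  assumes "C1_real \<phi>" and g: "\<And>t. (g has_real_derivative g' t) (at t)" "continuous_on UNIV g'"
  shows "C1_real (\<lambda>z. g (\<phi> z))"
proof -
  from assms obtain a b where
    1: "\<And>z. (\<phi> has_derivative (\<lambda>h. a z * Re h + b z * Im h)) (at z)" "continuous_on UNIV a" "continuous_on UNIV b"
    unfolding C1_real_def by metis
  have "((\<lambda>z. g (\<phi> z)) has_derivative (\<lambda>h. (g' (\<phi> z) * a z) * Re h + (g' (\<phi> z) * b z) * Im h)) (at z)" for z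
    using has_derivative_compose[OF 1(1) g(1)[THEN has_field_derivative_imp_has_derivative]]
    by (rule has_derivative_eq_rhs) (auto simp: algebra_simps)
  moreover have "continuous_on UNIV (\<lambda>z. g' (\<phi> z))"
    using continuous_on_compose2[OF g(2) C1_real_continuous[OF assms(1)]] by simp
  ultimately show ?thesis unfolding C1_real_def using 1
    by (intro exI[of _ "\<lambda>z. g' (\<phi> z) * a z"] exI[of _ "\<lambda>z. g' (\<phi> z) * b z"]) (auto intro!: continuous_intros)
qed

lemma C1_real_affine: "C1_real (\<lambda>z. \<alpha> * Re z + \<beta> * Im z + c)"
  unfolding C1_real_def
  by (intro exI[of _ "\<lambda>_. \<alpha>"] exI[of _ "\<lambda>_. \<beta>"]) (auto intro!: derivative_eq_intros)

lemma C1_real_test_function: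
  assumes "C1_real \<phi>" "compact C" "C \<subseteq> U" "\<And>z. z \<notin> C \<Longrightarrow> \<phi> z = 0"
  shows "test_function U \<phi>"
proof -
  from assms obtain a b where
    1: "\<And>z. (\<phi> has_derivative (\<lambda>h. a z * Re h + b z * Im h)) (at z)" "continuous_on UNIV a" "continuous_on UNIV b"
    unfolding C1_real_def by metis
  have fd: "frechet_derivative \<phi> (at z) = (\<lambda>h. a z * Re h + b z * Im h)" for z
    using frechet_derivative_at[OF 1(1)] by metis
  have "partial_x \<phi> = a" "partial_y \<phi> = b"
    by (auto simp: partial_x_def partial_y_def fd)
  then show ?thesis
    unfolding test_function_def using 1 assms differentiableI by metis
qed

text \<open>The square makes the positive part continuously differentiable.\<close>

definition pos_sq :: "real \<Rightarrow> real" where "pos_sq t = (max 0 t)\<^sup>2"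

lemma pos_sq_nonneg: "pos_sq t \<ge> 0"
  by (simp add: pos_sq_def)

lemma pos_sq_pos_iff: "pos_sq t > 0 \<longleftrightarrow> t > 0"
  by (cases "t > 0") (simp_all add: pos_sq_def)

lemma pos_sq_has_derivative: "(pos_sq has_real_derivative 2 * max 0 t) (at t)"
proof (cases "t = 0")
  case True
  have "((\<lambda>h. pos_sq h / h) \<longlongrightarrow> 0) (at 0)"
  proof (rule Lim_null_comparison)
    have "norm (pos_sq h / h) \<le> \<bar>h\<bar>" for h
      by (cases "h > 0") (simp_all add: pos_sq_def power2_eq_square)
    then show "\<forall>\<^sub>F h in at 0. norm (pos_sq h / h) \<le> \<bar>h\<bar>"
      by (intro always_eventually allI)
    show "((\<lambda>h. \<bar>h\<bar>) \<longlongrightarrow> 0) (at (0::real))"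
      by (intro tendsto_rabs_zero tendsto_ident_at)
  qed
  moreover have "pos_sq 0 = 0" by (simp add: pos_sq_def)
  ultimately show ?thesis using True unfolding DERIV_def by simp
next
  case False
  then consider "t > 0" | "t < 0" by linarith
  then show ?thesis
  proof cases
    case 1
    have "((\<lambda>t. t\<^sup>2) has_real_derivative 2 * t) (at t)"
      using DERIV_pow[of 2 t] by simp
    then have "(pos_sq has_real_derivative 2 * t) (at t)"
      by (rule has_field_derivative_transform_within_open[of _ _ _ "{0<..}"]) (use 1 in \<open>simp_all add: pos_sq_def\<close>)
    then show ?thesis using 1 by simp
  next
    case 2
    have "((\<lambda>t. 0) has_real_derivative 0) (at t)" by (rule DERIV_const)
    then have "(pos_sq has_real_derivative 0) (at t)"
      by (rule has_field_derivative_transform_within_open[of _ _ _ "{..<0}"]) (use 2 in \<open>simp_all add: pos_sq_def\<close>)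
    then show ?thesis using 2 by simp
  qed
qed

lemma C1_real_pos_sq: "C1_real \<phi> \<Longrightarrow> C1_real (\<lambda>z. pos_sq (\<phi> z))"
  by (rule C1_real_compose[OF _ pos_sq_has_derivative]) (auto intro!: continuous_intros)

text \<open>Each factor is positive exactly on one side of an edge line. The box may leave the unit
  disc, so a separate cutoff has to provide the compact support there.\<close>

definition box_bump :: "complex \<Rightarrow> complex \<Rightarrow> complex \<Rightarrow> real" where
  "box_bump a b z = pos_sq (Re z - Re a) * pos_sq (Re b - Re z) * (pos_sq (Im z - Im a) * pos_sq (Im b - Im z))"

lemma C1_real_box_bump: "C1_real (box_bump a b)"
proof -
  have "C1_real (\<lambda>z. Re z - Re a)" "C1_real (\<lambda>z. Re b - Re z)" "C1_real (\<lambda>z. Im z - Im a)" "C1_real (\<lambda>z. Im b - Im z)"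
    using C1_real_affine[of 1 0 "- Re a"] C1_real_affine[of "-1" 0 "Re b"]
      C1_real_affine[of 0 1 "- Im a"] C1_real_affine[of 0 "-1" "Im b"] by simp_all
  then show ?thesis unfolding box_bump_def[abs_def]
    by (intro C1_real_mult C1_real_pos_sq)
qed

lemma box_bump_nonneg: "box_bump a b z \<ge> 0"
  by (simp add: box_bump_def pos_sq_nonneg)

lemma box_bump_pos_iff: "box_bump a b z > 0 \<longleftrightarrow> z \<in> box a b"
proof -
  have m: "0 < x * y \<longleftrightarrow> 0 < x \<and> 0 < y" if "0 \<le> x" "0 \<le> y" for x y :: real
    using that by (auto simp: zero_less_mult_iff)
  have "box_bump a b z > 0 \<longleftrightarrow> pos_sq (Re z - Re a) > 0 \<and> pos_sq (Re b - Re z) > 0 \<and> pos_sq (Im z - Im a) > 0 \<and> pos_sq (Im b - Im z) > 0"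
    unfolding box_bump_def by (simp add: m pos_sq_nonneg)
  then show ?thesis by (auto simp: pos_sq_pos_iff in_box_complex_iff)
qed

text \<open>This is the fundamental lemma of the calculus of variations. Since u is integrable only
  on the smaller disc, it is multiplied by a cutoff \<omega> that is positive on
  \<open>ball 0 R\<close> and vanishes outside; the product is integrable on the plane, and
  approximating indicators of boxes by smooth functions shows that all its box integrals
  vanish.\<close>

lemma AE_zero_if_test_integrals_zero:
  fixes u :: "complex \<Rightarrow> complex"
  assumes R: "0 < R" "R < 1"
    and int: "integrable (lebesgue_on (cball 0 R)) u"
    and test: "\<And>\<phi>. test_function (ball 0 1) \<phi> \<Longrightarrow> (LINT z|lebesgue_on (ball 0 1). \<phi> z *\<^sub>R u z) = 0"
  shows "AE z in lebesgue. z \<in> ball 0 R \<longrightarrow> u z = 0"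
proof -
  define \<omega> where "\<omega> z = pos_sq (R\<^sup>2 - (cmod z)\<^sup>2)" for z
  have \<omega>: "C1_real \<omega>"
  proof -
    have "C1_real (\<lambda>z. R\<^sup>2 - (cmod z)\<^sup>2)"
      unfolding C1_real_def cmod_power2
      by (intro exI[of _ "\<lambda>z. - 2 * Re z"] exI[of _ "\<lambda>z. - 2 * Im z"])
        (auto intro!: derivative_eq_intros continuous_intros)
    then show ?thesis unfolding \<omega>_def[abs_def] by (rule C1_real_pos_sq)
  qed
  have \<omega>0: "\<omega> z = 0" if "z \<notin> cball 0 R" for z
  proof -
    have "R\<^sup>2 \<le> (cmod z)\<^sup>2" using that R by (intro power_mono) auto
    then show ?thesis by (simp add: \<omega>_def pos_sq_def)
  qed
  have \<omega>_pos: "\<omega> z > 0" if "z \<in> ball 0 R" for z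
  proof -
    have "(cmod z)\<^sup>2 < R\<^sup>2" using that R by (intro power_strict_mono) auto
    then show ?thesis by (simp add: \<omega>_def pos_sq_pos_iff)
  qed
  have \<omega>_le: "\<bar>\<omega> z\<bar> \<le> 1" for z
  proof -
    have "max 0 (R\<^sup>2 - (cmod z)\<^sup>2) \<le> 1"
      using R power_le_one[of R 2] zero_le_power2[of "cmod z"] by linarith
    then show ?thesis by (simp add: \<omega>_def pos_sq_def power_le_one)
  qed
  have sets [measurable]: "cball (0::complex) R \<in> sets lebesgue" by simp
  define v where "v z = indicator (cball 0 R) z *\<^sub>R u z" for z
  have v: "integrable lebesgue v"
    using int unfolding v_def by (subst (asm) integrable_restrict_space) auto
  have [measurable]: "v \<in> borel_measurable lebesgue" using v by simp
  have [measurable]: "\<omega> \<in> borel_measurable lebesgue"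
    by (rule C1_real_measurable[OF \<omega>])
  define w where "w z = \<omega> z *\<^sub>R v z" for z
  have w: "integrable lebesgue w"
  proof (rule Bochner_Integration.integrable_bound[OF v])
    show "w \<in> borel_measurable lebesgue" unfolding w_def by measurable
    show "AE x in lebesgue. norm (w x) \<le> norm (v x)"
      using \<omega>_le by (auto simp: w_def intro!: mult_left_le_one_le)
  qed
  have "(LINT z|lebesgue. indicator (box a b) z *\<^sub>R w z) = 0" for a b
  proof -
    \<comment> \<open>As \<open>n\<close> grows these tend to the cutoff \<open>\<omega>\<close> times the indicator of the box.\<close>
    define \<phi> where "\<phi> n z = \<omega> z * (1 - exp (- (real n * box_bump a b z)))" for n :: nat and z
    have \<phi>: "C1_real (\<phi> n)" for n
    proof -
      have "C1_real (\<lambda>z. 1 - exp (- (real n * box_bump a b z)))"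
        by (rule C1_real_compose[OF C1_real_box_bump, where g = "\<lambda>t. 1 - exp (- (real n * t))" and g' = "\<lambda>t. real n * exp (- (real n * t))"])
          (auto intro!: derivative_eq_intros continuous_intros)
      then show ?thesis unfolding \<phi>_def[abs_def] by (rule C1_real_mult[OF \<omega>])
    qed
    have [measurable]: "\<phi> n \<in> borel_measurable lebesgue" for n
      by (rule C1_real_measurable[OF \<phi>])
    have \<phi>0: "\<phi> n z = 0" if "z \<notin> cball 0 R" for n z using \<omega>0[OF that] by (simp add: \<phi>_def)
    have tf: "test_function (ball 0 1) (\<phi> n)" for n
      by (rule C1_real_test_function[OF \<phi>, of "cball 0 R"]) (use R \<phi>0 in auto)
    have z: "(LINT z|lebesgue. \<phi> n z *\<^sub>R v z) = 0" for n
    proof -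
      have "0 = (LINT z|lebesgue_on (ball 0 1). \<phi> n z *\<^sub>R u z)" using test[OF tf] by simp
      also have "\<dots> = (LINT z|lebesgue. indicator (ball 0 1) z *\<^sub>R (\<phi> n z *\<^sub>R u z))"
        by (rule integral_restrict_space) auto
      also have "\<dots> = (LINT z|lebesgue. \<phi> n z *\<^sub>R v z)"
        by (rule Bochner_Integration.integral_cong) (use R \<phi>0 in \<open>auto simp: v_def indicator_def\<close>)
      finally show ?thesis by simp
    qed
    have "(\<lambda>n. LINT z|lebesgue. \<phi> n z *\<^sub>R v z) \<longlonglongrightarrow> (LINT z|lebesgue. indicator (box a b) z *\<^sub>R w z)"
    proof (rule integral_dominated_convergence[where w = "\<lambda>z. norm (v z)"])
      show "(\<lambda>z. indicat_real (box a b) z *\<^sub>R w z) \<in> borel_measurable lebesgue"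
        by (rule borel_measurable_integrable[OF integrable_mult_indicator[OF _ w]]) simp
      show "(\<lambda>z. \<phi> n z *\<^sub>R v z) \<in> borel_measurable lebesgue" for n by measurable
      show "integrable lebesgue (\<lambda>z. norm (v z))" using v by simp
      show "AE z in lebesgue. norm (\<phi> n z *\<^sub>R v z) \<le> norm (v z)" for n
      proof (rule AE_I2)
        fix z
        have "\<bar>1 - exp (- (real n * box_bump a b z))\<bar> \<le> 1" using box_bump_nonneg[of a b z] by auto
        then have "\<bar>\<phi> n z\<bar> \<le> 1" using \<omega>_le[of z] by (simp add: \<phi>_def abs_mult mult_le_one)
        then show "norm (\<phi> n z *\<^sub>R v z) \<le> norm (v z)" by (auto intro!: mult_left_le_one_le)
      qed
      show "AE z in lebesgue. (\<lambda>n. \<phi> n z *\<^sub>R v z) \<longlonglongrightarrow> indicator (box a b) z *\<^sub>R w z"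
      proof (rule AE_I2)
        fix z
        have "(\<lambda>n. \<phi> n z) \<longlonglongrightarrow> indicator (box a b) z * \<omega> z"
        proof (cases "z \<in> box a b")
          case True
          then have "box_bump a b z > 0" by (simp add: box_bump_pos_iff)
          then have "(\<lambda>n. \<omega> z * (1 - exp (- (real n * box_bump a b z)))) \<longlonglongrightarrow> \<omega> z * (1 - 0)"
            by (intro tendsto_intros) real_asymp
          then show ?thesis using True by (simp add: \<phi>_def)
        next
          case False
          then have "box_bump a b z = 0" using box_bump_pos_iff[of a b z] box_bump_nonneg[of a b z] by linarith
          then show ?thesis using False by (simp add: \<phi>_def)
        qed
        then have "(\<lambda>n. \<phi> n z *\<^sub>R v z) \<longlonglongrightarrow> (indicator (box a b) z * \<omega> z) *\<^sub>R v z"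
          by (intro tendsto_intros)
        then show "(\<lambda>n. \<phi> n z *\<^sub>R v z) \<longlonglongrightarrow> indicator (box a b) z *\<^sub>R w z" by (simp add: w_def)
      qed
    qed
    then show ?thesis using z by (simp add: LIMSEQ_const_iff)
  qed
  then have "AE z in lebesgue. w z = 0" using AE_zero_if_box_integrals_zero[OF w] by blast
  then show ?thesis
  proof (rule AE_mp, intro AE_I2 impI)
    fix z assume "w z = 0" "z \<in> ball 0 R"
    then show "u z = 0" using \<omega>_pos[of z] by (auto simp: w_def v_def)
  qed
qed

text \<open>On compact sets, which have finite measure, square integrability implies integrability.
  So the difference p - p' can be tested on each disc of an exhaustion, and countably many null sets
  are discarded.\<close>

lemma weak_partials_unique:
  assumes u: "L2_loc (ball 0 1) p" "L2_loc (ball 0 1) p'"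
    and eq: "\<And>\<phi>. test_function (ball 0 1) \<phi> \<Longrightarrow>
      (LINT z|lebesgue_on (ball 0 1). \<phi> z *\<^sub>R p z) = (LINT z|lebesgue_on (ball 0 1). \<phi> z *\<^sub>R p' z)"
  shows "AE z in lebesgue_on (ball 0 1). p z = p' z"
proof -
  have L1: "integrable (lebesgue_on C) q" if q: "L2_loc (ball 0 1) q" and C: "compact C" "C \<subseteq> ball 0 1" for q C
  proof -
    have "C \<in> lmeasurable" using C lmeasurable_compact by blast
    then have fin: "finite_measure (lebesgue_on C)" by (simp add: finite_measure_lebesgue_on)
    have q': "q \<in> borel_measurable (lebesgue_on (ball 0 1))" "integrable (lebesgue_on C) (\<lambda>z. (cmod (q z))\<^sup>2)"
      using q C unfolding L2_loc_def by auto
    have m: "q \<in> borel_measurable (lebesgue_on C)"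
      by (rule measurable_restrict_mono[OF q'(1) C(2)])
    then have "(\<lambda>z. cmod (q z)) \<in> borel_measurable (lebesgue_on C)" by simp
    then have "integrable (lebesgue_on C) (\<lambda>z. cmod (q z))"
      by (rule finite_measure.square_integrable_imp_integrable[OF fin _ q'(2)])
    then show ?thesis using integrable_norm_iff[OF m] by simp
  qed
  have L1': "integrable (lebesgue_on (ball 0 1)) (\<lambda>z. \<phi> z *\<^sub>R q z)"
    if q: "L2_loc (ball 0 1) q" and \<phi>: "test_function (ball 0 1) \<phi>" for q \<phi>
  proof -
    obtain C where C: "compact C" "C \<subseteq> ball 0 1" "\<And>z. z \<notin> C \<Longrightarrow> \<phi> z = 0"
      using \<phi> unfolding test_function_def by blast
    have \<phi>c: "continuous_on UNIV \<phi>"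
      using \<phi> unfolding test_function_def
      by (meson differentiable_imp_continuous_within continuous_at_imp_continuous_on)
    obtain B where B: "\<And>z. z \<in> C \<Longrightarrow> \<bar>\<phi> z\<bar> \<le> B"
      using compact_imp_bounded[OF compact_continuous_image[OF continuous_on_subset[OF \<phi>c subset_UNIV] C(1)]]
      unfolding bounded_iff by auto
    have Cm: "C \<in> sets lebesgue" using C lmeasurable_compact by blast
    have m: "\<phi> \<in> borel_measurable (lebesgue_on C)"
      using \<phi>c Cm by (intro continuous_imp_measurable_on_sets_lebesgue) (auto intro: continuous_on_subset)
    have "integrable (lebesgue_on C) (\<lambda>z. \<phi> z *\<^sub>R q z)"
    proof (rule Bochner_Integration.integrable_bound[of _ "\<lambda>z. B *\<^sub>R q z"])
      show "AE x in lebesgue_on C. norm (\<phi> x *\<^sub>R q x) \<le> norm (B *\<^sub>R q x)"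
      proof (rule AE_I2)
        fix x assume "x \<in> space (lebesgue_on C)"
        then have "\<bar>\<phi> x\<bar> \<le> \<bar>B\<bar>" using B[of x] by auto
        then show "norm (\<phi> x *\<^sub>R q x) \<le> norm (B *\<^sub>R q x)" by (simp add: mult_right_mono)
      qed
    qed (use L1[OF q C(1,2)] m in auto)
    then have "integrable lebesgue (\<lambda>z. indicator C z *\<^sub>R (\<phi> z *\<^sub>R q z))"
      using Cm by (subst (asm) integrable_restrict_space) auto
    moreover have "(\<lambda>z. indicator C z *\<^sub>R (\<phi> z *\<^sub>R q z)) = (\<lambda>z. indicator (ball 0 1) z *\<^sub>R (\<phi> z *\<^sub>R q z))"
      using C by (auto simp: indicator_def fun_eq_iff)
    ultimately show ?thesis by (subst integrable_restrict_space) auto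
  qed
  \<comment> \<open>The summand 2 keeps the radius strictly between 0 and 1 already for n =
    0.\<close>
  have "AE z in lebesgue. z \<in> ball 0 (1 - 1 / real (n + 2)) \<longrightarrow> p z - p' z = 0" for n
  proof (rule AE_zero_if_test_integrals_zero)
    have sub: "cball 0 (1 - 1 / real (n + 2)) \<subseteq> ball (0::complex) 1"
      by (rule order_trans[OF cball_subset_ball_iff[THEN iffD2] order_refl]) simp
    show "integrable (lebesgue_on (cball 0 (1 - 1 / real (n + 2)))) (\<lambda>z. p z - p' z)"
      by (rule Bochner_Integration.integrable_diff[OF L1[OF u(1) compact_cball sub] L1[OF u(2) compact_cball sub]])
    fix \<phi> assume \<phi>: "test_function (ball 0 1) \<phi>"
    show "(LINT z|lebesgue_on (ball 0 1). \<phi> z *\<^sub>R (p z - p' z)) = 0"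
      using eq[OF \<phi>] Bochner_Integration.integral_diff[OF L1'[OF u(1) \<phi>] L1'[OF u(2) \<phi>]]
      by (simp add: scaleR_diff_right)
  qed auto
  then have "AE z in lebesgue. \<forall>n. z \<in> ball 0 (1 - 1 / real (n + 2)) \<longrightarrow> p z - p' z = 0"
    unfolding AE_all_countable by blast
  then have "AE z in lebesgue. z \<in> ball 0 1 \<longrightarrow> p z = p' z"
  proof (rule AE_mp, intro AE_I2 impI)
    fix z :: complex assume a: "\<forall>n. z \<in> ball 0 (1 - 1 / real (n + 2)) \<longrightarrow> p z - p' z = 0" and z: "z \<in> ball 0 1"
    then obtain n where "inverse (real (Suc n)) < 1 - cmod z" using reals_Archimedean[of "1 - cmod z"] by auto
    moreover have "1 / real (n + 2) \<le> inverse (real (Suc n))" by (simp add: divide_simps)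
    ultimately have "z \<in> ball 0 (1 - 1 / real (n + 2))" by simp
    then show "p z = p' z" using a by auto
  qed
  then show ?thesis by (subst AE_restrict_space_iff) auto
qed

text \<open>The set where the inequality fails is open by continuity, and a nonempty open set is not
  negligible.\<close>

lemma AE_le_imp_le_on_open:
  fixes f g :: "complex \<Rightarrow> real"
  assumes S: "open S" and f: "continuous_on S f" and g: "continuous_on S g"
    and ae: "AE z in lebesgue_on S. f z \<le> g z" and z: "z \<in> S"
  shows "f z \<le> g z"
proof (rule ccontr)
  assume n: "\<not> f z \<le> g z"
  have "open {x \<in> S. g x < f x}"
  proof -
    have "open (S \<inter> (\<lambda>x. f x - g x) -` {0<..})"
      by (rule continuous_open_preimage) (use f g S in \<open>auto intro!: continuous_intros\<close>)
    moreover have "S \<inter> (\<lambda>x. f x - g x) -` {0<..} = {x \<in> S. g x < f x}" by auto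
    ultimately show ?thesis by simp
  qed
  then obtain e where e: "e > 0" "ball z e \<subseteq> {x \<in> S. g x < f x}"
    using n z open_contains_ball[of "{x \<in> S. g x < f x}"] by force
  have "AE x in lebesgue. x \<in> S \<longrightarrow> f x \<le> g x"
    using ae S by (subst (asm) AE_restrict_space_iff) auto
  then have "AE x in lebesgue. x \<notin> ball z e"
    by (rule AE_mp) (use e in \<open>auto intro!: AE_I2\<close>)
  then have "ball z e \<in> null_sets lebesgue"
    by (subst AE_iff_null_sets) auto
  then have "negligible (ball z e)" using negligible_iff_null_sets by blast
  then show False using e(1) open_not_negligible[of "ball z e"] by auto
qed

section \<open>Pointwise dilatation and radial length of harmonic maps\<close>

lemma harmonic_has_derivative:
  assumes "(h has_field_derivative a) (at z)" "(g has_field_derivative b) (at z)"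
  shows "((\<lambda>z. h z + cnj (g z)) has_derivative (\<lambda>k. a * k + cnj (b * k))) (at z)"
  using assms unfolding has_field_derivative_def
  by (auto intro!: derivative_eq_intros)

lemma harmonic_wirtinger:
  "wirtinger (a * 1 + cnj (b * 1)) (a * \<i> + cnj (b * \<i>)) = a"
  "wirtinger_bar (a * 1 + cnj (b * 1)) (a * \<i> + cnj (b * \<i>)) = cnj b"
  by (simp_all add: wirtinger_def wirtinger_bar_def algebra_simps)

lemma harmonic_partials:
  assumes h: "h holomorphic_on ball 0 1" and g: "g holomorphic_on ball 0 1"
    and f: "\<And>z. z \<in> ball 0 1 \<Longrightarrow> f z = h z + cnj (g z)" and z: "z \<in> ball 0 1"
  shows "(f has_derivative (\<lambda>k. deriv h z * k + cnj (deriv g z * k))) (at z)"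
    and "partial_x f z = deriv h z * 1 + cnj (deriv g z * 1)"
    and "partial_y f z = deriv h z * \<i> + cnj (deriv g z * \<i>)"
proof -
  have "((\<lambda>z. h z + cnj (g z)) has_derivative (\<lambda>k. deriv h z * k + cnj (deriv g z * k))) (at z)"
    using h g z by (intro harmonic_has_derivative holomorphic_derivI[of _ "ball 0 1"]) auto
  then show *: "(f has_derivative (\<lambda>k. deriv h z * k + cnj (deriv g z * k))) (at z)"
    by (rule has_derivative_transform_within_open[of _ _ _ _ "ball 0 1"]) (use f z in auto)
  show "partial_x f z = deriv h z * 1 + cnj (deriv g z * 1)"
    and "partial_y f z = deriv h z * \<i> + cnj (deriv g z * \<i>)"
    unfolding partial_x_def partial_y_def frechet_derivative_at[OF *, symmetric] by simp_all
qed

lemma harmonic_W12_loc: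
  assumes h: "h holomorphic_on ball 0 1" and g: "g holomorphic_on ball 0 1"
    and f: "\<And>z. z \<in> ball 0 1 \<Longrightarrow> f z = h z + cnj (g z)"
  shows "W12_loc (ball 0 1) f (\<lambda>z. deriv h z * 1 + cnj (deriv g z * 1)) (\<lambda>z. deriv h z * \<i> + cnj (deriv g z * \<i>))"
proof -
  note d = harmonic_partials(1)[OF h g f]
  have cf: "continuous_on (ball 0 1) f"
    by (rule has_derivative_continuous_on[OF has_derivative_at_withinI[OF d]]) auto
  have "continuous_on (ball 0 1) (deriv h)" "continuous_on (ball 0 1) (deriv g)"
    using h g by (auto intro!: holomorphic_on_imp_continuous_on holomorphic_deriv)
  then have c: "continuous_on (ball 0 1) (\<lambda>z. deriv h z * k + cnj (deriv g z * k))" for k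
    by (intro continuous_intros)
  show ?thesis
    unfolding W12_loc_def
    using L2_loc_continuous[OF open_ball cf] L2_loc_continuous[OF open_ball c]
      weak_partials_C1[OF open_ball d c c] by blast
qed

text \<open>The weak derivatives p, q supplied by \<open>quasiconformal_on\<close> agree almost
  everywhere with the classical ones, since a smooth function has its classical derivatives as weak
  ones. Both sides of the dilatation inequality are then continuous, so it holds everywhere;
  positivity of the Jacobian removes the absolute value.\<close>

lemma quasiconformal_harmonic_pointwise:
  assumes h: "h holomorphic_on ball 0 1" and g: "g holomorphic_on ball 0 1"
    and f: "\<And>z. z \<in> ball 0 1 \<Longrightarrow> f z = h z + cnj (g z)"
    and J: "\<And>z. z \<in> ball 0 1 \<Longrightarrow> (cmod (deriv h z))\<^sup>2 - (cmod (deriv g z))\<^sup>2 > 0"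
    and qc: "quasiconformal_on K (ball 0 1) f" and z: "z \<in> ball 0 1"
  shows "(cmod (deriv h z) + cmod (deriv g z))\<^sup>2 \<le> K * ((cmod (deriv h z))\<^sup>2 - (cmod (deriv g z))\<^sup>2)"
proof -
  let ?P = "\<lambda>k z. deriv h z * k + cnj (deriv g z * k)"
  obtain p q where pq: "W12_loc (ball 0 1) f p q"
    and ae: "AE z in lebesgue_on (ball 0 1). det_D (p z) (q z) > 0 \<and> (norm_D (p z) (q z))\<^sup>2 \<le> K * \<bar>det_D (p z) (q z)\<bar>"
    using qc unfolding quasiconformal_on_def by blast
  note W = harmonic_W12_loc[OF h g f]
  have "AE z in lebesgue_on (ball 0 1). p z = ?P 1 z"
  proof (rule weak_partials_unique)
    fix \<phi> assume "test_function (ball 0 1) \<phi>"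
    then show "(LINT z|lebesgue_on (ball 0 1). \<phi> z *\<^sub>R p z) = (LINT z|lebesgue_on (ball 0 1). \<phi> z *\<^sub>R ?P 1 z)"
      using pq W unfolding W12_loc_def weak_partials_def by (metis (no_types, lifting) neg_equal_iff_equal)
  qed (use pq W in \<open>auto simp: W12_loc_def\<close>)
  moreover have "AE z in lebesgue_on (ball 0 1). q z = ?P \<i> z"
  proof (rule weak_partials_unique)
    fix \<phi> assume "test_function (ball 0 1) \<phi>"
    then show "(LINT z|lebesgue_on (ball 0 1). \<phi> z *\<^sub>R q z) = (LINT z|lebesgue_on (ball 0 1). \<phi> z *\<^sub>R ?P \<i> z)"
      using pq W unfolding W12_loc_def weak_partials_def by (metis (no_types, lifting) neg_equal_iff_equal)
  qed (use pq W in \<open>auto simp: W12_loc_def\<close>)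
  ultimately have "AE z in lebesgue_on (ball 0 1). (norm_D (?P 1 z) (?P \<i> z))\<^sup>2 \<le> K * \<bar>det_D (?P 1 z) (?P \<i> z)\<bar>"
    using ae by (rule AE_mp[OF AE_conjI[OF _ AE_conjI]]) (auto intro!: AE_I2)
  then have "AE z in lebesgue_on (ball 0 1). (cmod (deriv h z) + cmod (deriv g z))\<^sup>2 \<le> K * \<bar>(cmod (deriv h z))\<^sup>2 - (cmod (deriv g z))\<^sup>2\<bar>"
    unfolding norm_D_def det_D_def harmonic_wirtinger complex_mod_cnj .
  then have "(cmod (deriv h z) + cmod (deriv g z))\<^sup>2 \<le> K * \<bar>(cmod (deriv h z))\<^sup>2 - (cmod (deriv g z))\<^sup>2\<bar>"
  proof (rule AE_le_imp_le_on_open[OF open_ball _ _ _ z, rotated 2])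
    have "continuous_on (ball 0 1) (deriv h)" "continuous_on (ball 0 1) (deriv g)"
      using h g by (auto intro!: holomorphic_on_imp_continuous_on holomorphic_deriv)
    then show "continuous_on (ball 0 1) (\<lambda>z. (cmod (deriv h z) + cmod (deriv g z))\<^sup>2)"
      and "continuous_on (ball 0 1) (\<lambda>z. K * \<bar>(cmod (deriv h z))\<^sup>2 - (cmod (deriv g z))\<^sup>2\<bar>)"
      by (auto intro!: continuous_intros)
  qed
  then show ?thesis using J[OF z] by simp
qed

text \<open>This needs no regularity of f: \<open>integral\<close> takes the value 0 on
  nonintegrable functions.\<close>

lemma radial_length_nonneg: "radial_length f \<theta> r \<ge> 0"
  unfolding radial_length_def Let_def
  by (cases "(\<lambda>\<rho>. cmod (wirtinger (partial_x f (of_real \<rho> * cis \<theta>)) (partial_y f (of_real \<rho> * cis \<theta>)) +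
      cis (- 2 * \<theta>) * wirtinger_bar (partial_x f (of_real \<rho> * cis \<theta>)) (partial_y f (of_real \<rho> * cis \<theta>)))) integrable_on {0..r}")
    (auto simp: not_integrable_integral intro!: integral_nonneg)

lemma radial_length_harmonic:
  assumes h: "h holomorphic_on ball 0 1" and g: "g holomorphic_on ball 0 1"
    and f: "\<And>z. z \<in> ball 0 1 \<Longrightarrow> f z = h z + cnj (g z)" and r: "r < 1"
  shows "radial_length f \<theta> r = integral {0..r} (\<lambda>\<rho>. cmod (deriv h (of_real \<rho> * cis \<theta>)
    + cis (- 2 * \<theta>) * cnj (deriv g (of_real \<rho> * cis \<theta>))))"
  unfolding radial_length_def Let_def
proof (rule Henstock_Kurzweil_Integration.integral_cong)
  fix \<rho> assume "\<rho> \<in> {0..r}"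
  then have z: "of_real \<rho> * cis \<theta> \<in> ball 0 1" using r by (simp add: norm_mult)
  show "cmod (wirtinger (partial_x f (of_real \<rho> * cis \<theta>)) (partial_y f (of_real \<rho> * cis \<theta>)) +
      cis (- 2 * \<theta>) * wirtinger_bar (partial_x f (of_real \<rho> * cis \<theta>)) (partial_y f (of_real \<rho> * cis \<theta>)))
    = cmod (deriv h (of_real \<rho> * cis \<theta>) + cis (- 2 * \<theta>) * cnj (deriv g (of_real \<rho> * cis \<theta>)))"
    by (simp only: harmonic_partials(2)[OF h g f z] harmonic_partials(3)[OF h g f z] harmonic_wirtinger)
qed

lemma conformal_in_S_H:
  assumes F: "F holomorphic_on ball 0 1" and inj: "inj_on F (ball 0 1)" and F0: "F 0 = 0" "deriv F 0 = 1"
  shows "F \<in> S_H"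
proof -
  have "deriv F z \<noteq> 0" if "z \<in> ball 0 1" for z
    by (rule holomorphic_injective_imp_regular[OF F open_ball inj that])
  then show ?thesis
    unfolding S_H_def using F inj F0
    by (intro CollectI conjI exI[of _ F] exI[of _ "\<lambda>_. 0"]) auto
qed

text \<open>With vanishing antianalytic part, the squared norm of the differential equals its
  determinant, so the dilatation is 1 and every K \<ge> 1 is admissible.\<close>

lemma conformal_quasiconformal_on:
  assumes F: "F holomorphic_on ball 0 1" and inj: "inj_on F (ball 0 1)" and K: "K \<ge> 1"
  shows "quasiconformal_on K (ball 0 1) F"
proof -
  have cont: "continuous_on (ball 0 1) F" by (rule holomorphic_on_imp_continuous_on[OF F])
  obtain F' where F': "homeomorphism (ball 0 1) (F ` ball 0 1) F F'"
    using invariance_of_domain_homeomorphism[OF open_ball cont _ inj] by auto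
  have nz: "deriv F z \<noteq> 0" if "z \<in> ball 0 1" for z
    by (rule holomorphic_injective_imp_regular[OF F open_ball inj that])
  let ?g = "\<lambda>_::complex. 0::complex"
  have W: "W12_loc (ball 0 1) F (\<lambda>z. deriv F z * 1 + cnj (deriv ?g z * 1)) (\<lambda>z. deriv F z * \<i> + cnj (deriv ?g z * \<i>))"
    by (rule harmonic_W12_loc[OF F]) auto
  have "(cmod (deriv F z))\<^sup>2 \<le> K * (cmod (deriv F z))\<^sup>2" for z
    using mult_right_mono[OF K, of "(cmod (deriv F z))\<^sup>2"] by simp
  then have ae: "AE z in lebesgue_on (ball 0 1). det_D (deriv F z * 1 + cnj (deriv ?g z * 1)) (deriv F z * \<i> + cnj (deriv ?g z * \<i>)) > 0 \<and>
     (norm_D (deriv F z * 1 + cnj (deriv ?g z * 1)) (deriv F z * \<i> + cnj (deriv ?g z * \<i>)))\<^sup>2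
      \<le> K * \<bar>det_D (deriv F z * 1 + cnj (deriv ?g z * 1)) (deriv F z * \<i> + cnj (deriv ?g z * \<i>))\<bar>"
    using nz unfolding det_D_def norm_D_def harmonic_wirtinger by (intro AE_I2) simp
  show ?thesis
    unfolding quasiconformal_on_def
    using invariance_of_domain[OF cont open_ball inj] F' W ae by (intro conjI) (simp, simp, simp, simp, blast, blast)
qed

subsection \<open>The area formula for harmonic maps\<close>

text \<open>The change of variables formula \<open>has_measure_differentiable_image\<close> is
  phrased with matrices on real^2; this isometry and its inverse carry it over to the complex
  plane.\<close>

definition vec_of_complex :: "complex \<Rightarrow> real^2" where
  "vec_of_complex z = vector [Re z, Im z]"

definition complex_of_vec :: "real^2 \<Rightarrow> complex" where
  "complex_of_vec v = Complex (v $ 1) (v $ 2)"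

lemma complex_of_vec_inverse [simp]: "complex_of_vec (vec_of_complex z) = z"
  by (simp add: complex_of_vec_def vec_of_complex_def)

lemma vec_of_complex_inverse [simp]: "vec_of_complex (complex_of_vec v) = v"
  by (simp add: complex_of_vec_def vec_of_complex_def vec_eq_iff forall_2)

lemma vec_of_complex_nth [simp]: "vec_of_complex z $ 1 = Re z" "vec_of_complex z $ 2 = Im z"
  by (simp_all add: vec_of_complex_def)

lemma linear_complex_of_vec: "linear complex_of_vec"
  by (rule linearI) (simp_all add: complex_of_vec_def complex_eq_iff)

lemma linear_vec_of_complex: "linear vec_of_complex"
  by (rule linearI) (simp_all add: vec_eq_iff forall_2)

lemma bounded_linear_complex_of_vec: "bounded_linear complex_of_vec"
  using linear_complex_of_vec linear_conv_bounded_linear by blast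

lemma bounded_linear_vec_of_complex: "bounded_linear vec_of_complex"
  using linear_vec_of_complex linear_conv_bounded_linear by blast

lemma lborel_complex_of_vec: "distr (lborel :: (real^2) measure) borel complex_of_vec = lborel"
proof (rule lborel_eqI[symmetric])
  have m: "complex_of_vec \<in> borel_measurable (lborel :: (real^2) measure)"
    using linear_continuous_on[OF bounded_linear_complex_of_vec] borel_measurable_continuous_onI by auto
  fix l u :: complex assume lu: "\<And>b. b \<in> Basis \<Longrightarrow> l \<bullet> b \<le> u \<bullet> b"
  have "complex_of_vec -` box l u = box (vec_of_complex l) (vec_of_complex u)"
    by (auto simp: complex_of_vec_def in_box_complex_iff mem_box_cart forall_2)
  then have "emeasure (distr lborel borel complex_of_vec) (box l u) = emeasure lborel (box (vec_of_complex l) (vec_of_complex u))"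
    using m by (subst emeasure_distr) auto
  also have "\<dots> = ennreal (\<Prod>b\<in>Basis. (vec_of_complex u - vec_of_complex l) \<bullet> b)"
  proof (rule emeasure_lborel_box)
    fix b :: "real^2" assume "b \<in> Basis"
    then obtain i where "b = axis i 1" by (auto simp: Basis_vec_def)
    then show "vec_of_complex l \<bullet> b \<le> vec_of_complex u \<bullet> b"
      using lu[of 1] lu[of \<i>] exhaust_2[of i] by (auto simp: inner_axis Basis_complex_def)
  qed
  also have "(\<Prod>b\<in>Basis. (vec_of_complex u - vec_of_complex l) \<bullet> b) = (\<Prod>i\<in>UNIV. (vec_of_complex u - vec_of_complex l) $ i)"
    by (simp add: Basis_vec_def UNION_singleton_eq_range prod.reindex inj_on_def axis_eq_axis inner_axis o_def)
  also have "\<dots> = (\<Prod>b\<in>Basis. (u - l) \<bullet> b)"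
    by (simp add: UNIV_2 Basis_complex_def)
  finally show "emeasure (distr lborel borel complex_of_vec) (box l u) = (\<Prod>b\<in>Basis. (u - l) \<bullet> b)" .
qed simp

lemma nn_integral_complex_of_vec:
  assumes "f \<in> borel_measurable borel"
  shows "(\<integral>\<^sup>+v. f (complex_of_vec v) \<partial>lborel) = (\<integral>\<^sup>+z. f z \<partial>lborel)"
proof -
  have m: "complex_of_vec \<in> borel_measurable (lborel :: (real^2) measure)"
    using linear_continuous_on[OF bounded_linear_complex_of_vec] borel_measurable_continuous_onI by auto
  have "(\<integral>\<^sup>+z. f z \<partial>lborel) = (\<integral>\<^sup>+z. f z \<partial>distr (lborel :: (real^2) measure) borel complex_of_vec)"
    by (simp add: lborel_complex_of_vec)
  also have "\<dots> = (\<integral>\<^sup>+v. f (complex_of_vec v) \<partial>lborel)"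
    using m assms by (subst nn_integral_distr) auto
  finally show ?thesis by simp
qed

lemma lborel_complex_pair: "distr (lborel \<Otimes>\<^sub>M lborel) borel (\<lambda>(x, y). Complex x y) = lborel"
proof (rule lborel_eqI[symmetric])
  have m: "(\<lambda>(x, y). Complex x y) \<in> borel_measurable (lborel \<Otimes>\<^sub>M lborel)"
    unfolding lborel_prod measurable_lborel2
    by (rule borel_measurable_continuous_onI) (auto simp: Complex_eq case_prod_unfold intro!: continuous_intros)
  fix l u :: complex assume lu: "\<And>b. b \<in> Basis \<Longrightarrow> l \<bullet> b \<le> u \<bullet> b"
  have "(\<lambda>(x, y). Complex x y) -` box l u = box (Re l) (Re u) \<times> box (Im l) (Im u)"
    by (auto simp: in_box_complex_iff)
  then have "emeasure (distr (lborel \<Otimes>\<^sub>M lborel) borel (\<lambda>(x, y). Complex x y)) (box l u)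
      = emeasure (lborel \<Otimes>\<^sub>M lborel) (box (Re l) (Re u) \<times> box (Im l) (Im u))"
    using m by (subst emeasure_distr) (auto simp: space_pair_measure)
  also have "\<dots> = emeasure lborel (box (Re l) (Re u)) * emeasure lborel (box (Im l) (Im u))"
    by (rule lborel.emeasure_pair_measure_Times) auto
  also have "\<dots> = (\<Prod>b\<in>Basis. (u - l) \<bullet> b)"
    using lu[of 1] lu[of \<i>] by (simp add: Basis_complex_def ennreal_mult)
  finally show "emeasure (distr (lborel \<Otimes>\<^sub>M lborel) borel (\<lambda>(x, y). Complex x y)) (box l u) = (\<Prod>b\<in>Basis. (u - l) \<bullet> b)" .
qed simp

text \<open>In logarithmic coordinates the inner integral runs over a circle and the outer one over
  the logarithm of its radius; this is how estimates on single circles become area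
  estimates.\<close>

lemma nn_integral_complex_iterated:
  assumes [measurable]: "f \<in> borel_measurable borel"
  shows "(\<integral>\<^sup>+z. f z \<partial>lborel) = (\<integral>\<^sup>+x. \<integral>\<^sup>+y. f (Complex x y) \<partial>lborel \<partial>lborel)"
proof -
  have m [measurable]: "(\<lambda>(x, y). Complex x y) \<in> borel_measurable (lborel \<Otimes>\<^sub>M lborel)"
    unfolding lborel_prod measurable_lborel2
    by (rule borel_measurable_continuous_onI) (auto simp: Complex_eq case_prod_unfold intro!: continuous_intros)
  have "(\<integral>\<^sup>+z. f z \<partial>lborel) = (\<integral>\<^sup>+p. f (case p of (x, y) \<Rightarrow> Complex x y) \<partial>(lborel \<Otimes>\<^sub>M lborel))"
    by (subst lborel_complex_pair[symmetric], subst nn_integral_distr) auto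
  also have "\<dots> = (\<integral>\<^sup>+x. \<integral>\<^sup>+y. f (case (x, y) of (x, y) \<Rightarrow> Complex x y) \<partial>lborel \<partial>lborel)"
    by (rule lborel.nn_integral_fst[symmetric]) measurable
  finally show ?thesis by simp
qed

text \<open>The real-linear map k \<mapsto> a k + cnj (b k) has determinant |a|^2 - |b|^2, which is
  nonnegative by hypothesis, so for an injective map the change of variables formula gives the area
  of the image. As an upper bound the statement is trivial when that area is infinite.\<close>

lemma emeasure_harmonic_image:
  fixes f :: "complex \<Rightarrow> complex"
  assumes S: "open S" and der: "\<And>z. z \<in> S \<Longrightarrow> (f has_derivative (\<lambda>k. a z * k + cnj (b z * k))) (at z)"
    and ab: "\<And>z. z \<in> S \<Longrightarrow> cmod (b z) \<le> cmod (a z)"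
    and inj: "inj_on f S"
    and cont: "continuous_on S a" "continuous_on S b"
  shows "(\<integral>\<^sup>+z\<in>S. ((cmod (a z))\<^sup>2 - (cmod (b z))\<^sup>2) \<partial>lborel) \<le> emeasure lborel (f ` S)"
proof (cases "emeasure lborel (f ` S) < \<infinity>")
  case True
  define J where "J z = indicator S z *\<^sub>R ((cmod (a z))\<^sup>2 - (cmod (b z))\<^sup>2)" for z
  have m: "J \<in> borel_measurable borel"
    unfolding J_def[abs_def]
    by (rule borel_measurable_continuous_on_indicator) (use S cont in \<open>auto intro!: continuous_intros\<close>)
  let ?S = "vec_of_complex ` S"
  define F where "F v = vec_of_complex (f (complex_of_vec v))" for v
  define F' where "F' v k = vec_of_complex (a (complex_of_vec v) * complex_of_vec k + cnj (b (complex_of_vec v) * complex_of_vec k))" for v k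
  have contf: "continuous_on S f"
    by (rule has_derivative_continuous_on[OF has_derivative_at_withinI[OF der]])
  have fS: "open (f ` S)" by (rule invariance_of_domain[OF contf S inj])
  have vimg: "vec_of_complex ` X = complex_of_vec -` X" for X
    by (auto simp: image_iff) (metis vec_of_complex_inverse)
  have openv: "open (vec_of_complex ` X)" if "open X" for X
    unfolding vimg using that linear_continuous_on[OF bounded_linear_complex_of_vec]
    by (intro open_vimage) auto
  have F_im: "F ` ?S = vec_of_complex ` (f ` S)"
    by (auto simp: F_def image_iff)
  have em: "emeasure lborel (vec_of_complex ` X) = emeasure lborel X" if "open X" for X
  proof -
    have "complex_of_vec \<in> borel_measurable (lborel :: (real^2) measure)"
      using linear_continuous_on[OF bounded_linear_complex_of_vec] borel_measurable_continuous_onI by auto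
    then have "emeasure (distr (lborel :: (real^2) measure) borel complex_of_vec) X = emeasure lborel (complex_of_vec -` X)"
      using that by (subst emeasure_distr) auto
    then show ?thesis by (simp add: lborel_complex_of_vec vimg)
  qed
  have lm: "F ` ?S \<in> lmeasurable"
    using True em[OF fS] openv[OF fS] unfolding F_im fmeasurable_def by (auto simp: emeasure_completion)
  have derF: "(F has_derivative F' v) (at v within ?S)" if "v \<in> ?S" for v
  proof -
    have "complex_of_vec v \<in> S" using that by auto
    note d = has_derivative_compose[OF bounded_linear.has_derivative[OF bounded_linear_complex_of_vec has_derivative_ident] der[OF this]]
    have "(F has_derivative F' v) (at v)"
      using bounded_linear.has_derivative[OF bounded_linear_vec_of_complex d]
      by (simp add: F_def[abs_def] F'_def[abs_def])
    then show ?thesis by (rule has_derivative_at_withinI)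
  qed
  have injF: "inj_on F ?S"
    using inj by (auto simp: inj_on_def F_def) (metis complex_of_vec_inverse)
  have det: "det (matrix (F' v)) = J (complex_of_vec v)" if "v \<in> ?S" for v
  proof -
    have "complex_of_vec v \<in> S" using that by auto
    then have "J (complex_of_vec v) = (cmod (a (complex_of_vec v)))\<^sup>2 - (cmod (b (complex_of_vec v)))\<^sup>2"
      by (simp add: J_def)
    then show ?thesis
    unfolding det_2 matrix_def F'_def cmod_power2
    by (simp add: complex_of_vec_def axis_def power2_eq_square algebra_simps)
  qed
  have Sl: "?S \<in> sets lebesgue" using openv[OF S] by simp
  have "((\<lambda>v. \<bar>det (matrix (F' v))\<bar>) has_integral measure lebesgue (F ` ?S)) ?S"
    using has_measure_differentiable_image[OF Sl derF injF] lm by blast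
  then have hi: "((\<lambda>v. J (complex_of_vec v)) has_integral measure lebesgue (F ` ?S)) ?S"
    by (rule has_integral_eq[rotated]) (use ab in \<open>auto simp: det J_def power_mono\<close>)
  have "(\<integral>\<^sup>+v\<in>?S. ennreal (J (complex_of_vec v)) \<partial>lborel) = ennreal (measure lebesgue (F ` ?S))"
  proof -
    have "((\<lambda>v. if v \<in> ?S then J (complex_of_vec v) else 0) has_integral measure lebesgue (F ` ?S)) UNIV"
      using hi by (simp only: has_integral_restrict_UNIV)
    moreover have "(\<lambda>v. if v \<in> ?S then J (complex_of_vec v) else 0) \<in> borel_measurable borel"
    proof (rule measurable_If_set)
      have "complex_of_vec \<in> borel_measurable borel"
        using linear_continuous_on[OF bounded_linear_complex_of_vec] borel_measurable_continuous_onI by auto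
      then show "(\<lambda>v. J (complex_of_vec v)) \<in> borel_measurable borel"
        by (rule measurable_compose) (rule m)
    qed (use openv[OF S] in auto)
    ultimately have "(\<integral>\<^sup>+v. ennreal (if v \<in> ?S then J (complex_of_vec v) else 0) \<partial>lborel) = ennreal (measure lebesgue (F ` ?S))"
      by (intro nn_integral_has_integral_lborel) (use ab in \<open>auto simp: J_def power_mono\<close>)
    moreover have "(\<lambda>v. ennreal (if v \<in> ?S then J (complex_of_vec v) else 0)) = (\<lambda>v. ennreal (J (complex_of_vec v)) * indicator ?S v)"
      by (auto simp: indicator_def)
    ultimately show ?thesis by simp
  qed
  moreover have "(\<integral>\<^sup>+v\<in>?S. ennreal (J (complex_of_vec v)) \<partial>lborel) = (\<integral>\<^sup>+z\<in>S. ennreal (J z) \<partial>lborel)"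
  proof -
    have [measurable]: "J \<in> borel_measurable borel" by (rule m)
    have [measurable]: "S \<in> sets borel" using S by simp
    have "(\<integral>\<^sup>+z\<in>S. ennreal (J z) \<partial>lborel) = (\<integral>\<^sup>+v. ennreal (J (complex_of_vec v)) * indicator S (complex_of_vec v) \<partial>lborel)"
      by (rule nn_integral_complex_of_vec[symmetric]) measurable
    also have "\<dots> = (\<integral>\<^sup>+v\<in>?S. ennreal (J (complex_of_vec v)) \<partial>lborel)"
      unfolding vimg by (rule nn_integral_cong) (auto simp: indicator_def)
    finally show ?thesis by simp
  qed
  moreover have "ennreal (measure lebesgue (F ` ?S)) = emeasure lborel (f ` S)"
  proof -
    have "ennreal (measure lebesgue (F ` ?S)) = emeasure lebesgue (F ` ?S)"
      using emeasure_eq_measure2[OF lm] by simp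
    also have "\<dots> = emeasure lborel (F ` ?S)"
      unfolding F_im using openv[OF fS] by simp
    finally show ?thesis unfolding F_im using em[OF fS] by simp
  qed
  moreover have "(\<integral>\<^sup>+z\<in>S. ennreal (J z) \<partial>lborel) = (\<integral>\<^sup>+z\<in>S. ((cmod (a z))\<^sup>2 - (cmod (b z))\<^sup>2) \<partial>lborel)"
    by (rule nn_integral_cong) (auto simp: J_def indicator_def)
  ultimately show ?thesis by simp
next
  case False
  then show ?thesis by (simp add: not_less top.extremum_unique)
qed

subsection \<open>Univalent quasiconformal harmonic maps of the disc\<close>

text \<open>These conditions survive restriction to a subdisc, affine rescaling of the variable and
  division by a positive constant (\<open>rescale\<close>). So an estimate at the centre of the unit
  disc yields one at the centre of every subdisc.\<close>

locale qc_harmonic_disc =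
  fixes K :: real and F H G :: "complex \<Rightarrow> complex"
  assumes K: "K \<ge> 1"
    and H: "H holomorphic_on ball 0 1" and G: "G holomorphic_on ball 0 1"
    and F: "\<And>z. z \<in> ball 0 1 \<Longrightarrow> F z = H z + cnj (G z)"
    and inj: "inj_on F (ball 0 1)"
    and qc: "\<And>z. z \<in> ball 0 1 \<Longrightarrow>
      (cmod (deriv H z) + cmod (deriv G z))\<^sup>2 \<le> K * ((cmod (deriv H z))\<^sup>2 - (cmod (deriv G z))\<^sup>2)"
begin

lemma deriv_le: "z \<in> ball 0 1 \<Longrightarrow> cmod (deriv G z) \<le> cmod (deriv H z)"
proof -
  assume z: "z \<in> ball 0 1"
  have "0 \<le> K * ((cmod (deriv H z))\<^sup>2 - (cmod (deriv G z))\<^sup>2)"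
    using qc[OF z] by (rule order_trans[rotated]) simp
  then have "(cmod (deriv G z))\<^sup>2 \<le> (cmod (deriv H z))\<^sup>2"
    using K by (simp add: zero_le_mult_iff)
  then show ?thesis by (rule power2_le_imp_le) simp
qed

lemma has_derivative_F:
  assumes "z \<in> ball 0 1"
  shows "(F has_derivative (\<lambda>k. deriv H z * k + cnj (deriv G z * k))) (at z)"
proof -
  have "((\<lambda>z. H z + cnj (G z)) has_derivative (\<lambda>k. deriv H z * k + cnj (deriv G z * k))) (at z)"
    using holomorphic_derivI[OF H open_ball assms] holomorphic_derivI[OF G open_ball assms]
    unfolding has_field_derivative_def by (auto intro!: derivative_eq_intros)
  then show ?thesis
    by (rule has_derivative_transform_within_open[of _ _ _ _ "ball 0 1"]) (use F assms in auto)
qed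

lemma continuous_on_F: "continuous_on (ball 0 1) F"
  by (rule has_derivative_continuous_on[OF has_derivative_at_withinI[OF has_derivative_F]])

lemma open_F_image: "open V \<Longrightarrow> V \<subseteq> ball 0 1 \<Longrightarrow> open (F ` V)"
  by (rule invariance_of_domain) (auto intro: continuous_on_subset[OF continuous_on_F] inj_on_subset[OF inj])

text \<open>By invariance of domain F is an open map, so a maximum of |F| over the closed disc at an
  interior point would be exceeded by a neighbouring value.\<close>

lemma max_modulus:
  assumes \<rho>: "0 < \<rho>" "\<rho> < 1" and M: "\<And>z. cmod z = \<rho> \<Longrightarrow> cmod (F z) \<le> M" and z: "cmod z \<le> \<rho>"
  shows "cmod (F z) \<le> M"
proof -
  have "continuous_on (cball 0 \<rho>) (\<lambda>z. cmod (F z))"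
    by (intro continuous_intros continuous_on_subset[OF continuous_on_F]) (use \<rho> in auto)
  moreover have "cball (0::complex) \<rho> \<noteq> {}" using \<rho> by simp
  ultimately obtain z0 where z0: "z0 \<in> cball 0 \<rho>" "\<And>y. y \<in> cball 0 \<rho> \<Longrightarrow> cmod (F y) \<le> cmod (F z0)"
    using continuous_attains_sup[OF compact_cball] by metis
  have "cmod (F z0) \<le> M"
  proof (cases "cmod z0 = \<rho>")
    case False
    then have "z0 \<in> ball 0 \<rho>" using z0 by auto
    then have in_img: "F z0 \<in> F ` ball 0 \<rho>" by blast
    have "open (F ` ball 0 \<rho>)" by (rule open_F_image) (use \<rho> in auto)
    then obtain e where e: "e > 0" "ball (F z0) e \<subseteq> F ` ball 0 \<rho>"
      using in_img openE by blast
    \<comment> \<open>A value slightly further from 0 than \<open>F z0\<close>; the radial direction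
      is undefined when \<open>F z0\<close> is 0, whence the case distinction.\<close>
    define w where "w = (if F z0 = 0 then of_real (e / 2) else (1 + e / (2 * cmod (F z0))) *\<^sub>R F z0)"
    have "dist (F z0) w < e"
      using e by (simp add: w_def dist_norm scaleR_left_distrib)
    have gt: "cmod w > cmod (F z0)"
      using e by (simp add: w_def field_simps)
    have "w \<in> F ` ball 0 \<rho>" using e \<open>dist (F z0) w < e\<close> by auto
    then have le: "cmod w \<le> cmod (F z0)" using z0(2) by fastforce
    then show ?thesis using gt by simp
  qed (use M in auto)
  then show ?thesis using z0(2)[of z] z by auto
qed

text \<open>Again openness decides: an interior minimum could be lowered by moving the nonzero value
  towards 0. The point found on each circle is the starting point from which the growth of |F| along
  that circle is measured.\<close>

lemma min_modulus:
  assumes \<rho>: "0 < \<rho>" "\<rho> < 1" and nz: "\<And>z. z \<in> ball 0 1 \<Longrightarrow> F z \<noteq> 0"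
  shows "\<exists>z. cmod z = \<rho> \<and> cmod (F z) \<le> cmod (F 0)"
proof (rule ccontr)
  assume "\<not> ?thesis"
  then have big: "cmod (F 0) < cmod (F z)" if "cmod z = \<rho>" for z
    using that by force
  have "continuous_on (cball 0 \<rho>) (\<lambda>z. cmod (F z))"
    by (intro continuous_intros continuous_on_subset[OF continuous_on_F]) (use \<rho> in auto)
  moreover have "cball (0::complex) \<rho> \<noteq> {}" using \<rho> by simp
  ultimately obtain z0 where z0: "z0 \<in> cball 0 \<rho>" "\<And>y. y \<in> cball 0 \<rho> \<Longrightarrow> cmod (F z0) \<le> cmod (F y)"
    using continuous_attains_inf[OF compact_cball] by metis
  have "cmod z0 \<noteq> \<rho>" using big[of z0] z0(2)[of 0] \<rho> by auto
  then have z0': "z0 \<in> ball 0 \<rho>" using z0 by auto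
  then have in_img: "F z0 \<in> F ` ball 0 \<rho>" by blast
  have nz0: "F z0 \<noteq> 0" using nz z0' \<rho> by auto
  have "open (F ` ball 0 \<rho>)" by (rule open_F_image) (use \<rho> in auto)
  then obtain e where e: "e > 0" "ball (F z0) e \<subseteq> F ` ball 0 \<rho>"
    using in_img openE by blast
  define t where "t = min (e / 2) (cmod (F z0) / 2)"
  have t: "0 < t" "t < e" "t < cmod (F z0)" using e nz0 by (auto simp: t_def min_def)
  define w where "w = (1 - t / cmod (F z0)) *\<^sub>R F z0"
  have "F z0 - w = (t / cmod (F z0)) *\<^sub>R F z0" by (simp add: w_def scaleR_left_diff_distrib)
  then have "dist (F z0) w < e" using t nz0 by (simp add: dist_norm)
  then have "w \<in> F ` ball 0 \<rho>" using e by auto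
  then have le: "cmod (F z0) \<le> cmod w" using z0(2) by fastforce
  have "cmod w = cmod (F z0) - t" using t nz0 by (simp add: w_def field_simps)
  then have "cmod w < cmod (F z0)" using t by simp
  then show False using le by simp
qed

text \<open>In the logarithmic coordinate circles about 0 become vertical segments; \<open>A\<close>, \<open>B\<close> and \<open>J\<close> are the
  Wirtinger derivatives and the Jacobian of \<open>P\<close>.\<close>

definition strip :: "real \<Rightarrow> complex set" where
  "strip a = {\<zeta>. a < Re \<zeta> \<and> Re \<zeta> < 0 \<and> 0 < Im \<zeta> \<and> Im \<zeta> < 2 * pi}"

definition P where "P \<zeta> = F (exp \<zeta>)"
definition A where "A \<zeta> = deriv H (exp \<zeta>) * exp \<zeta>"
definition B where "B \<zeta> = deriv G (exp \<zeta>) * exp \<zeta>"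
definition J where "J \<zeta> = (cmod (A \<zeta>))\<^sup>2 - (cmod (B \<zeta>))\<^sup>2"

lemma exp_in_ball: "Re \<zeta> < 0 \<Longrightarrow> exp \<zeta> \<in> ball 0 1"
  by simp

lemma open_strip: "open (strip a)"
proof -
  have "strip a = box (Complex a 0) (Complex 0 (2 * pi))"
    by (auto simp: strip_def in_box_complex_iff)
  then show ?thesis by (simp only: open_box)
qed

lemma has_derivative_P:
  assumes "Re \<zeta> < 0"
  shows "(P has_derivative (\<lambda>k. A \<zeta> * k + cnj (B \<zeta> * k))) (at \<zeta>)"
proof -
  have "(exp has_derivative (\<lambda>k. exp \<zeta> * k)) (at \<zeta>)"
    using DERIV_exp[of \<zeta>] by (simp add: has_field_derivative_def)
  from has_derivative_compose[OF this has_derivative_F[OF exp_in_ball[OF assms]]]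
  show ?thesis by (simp add: P_def[abs_def] A_def B_def mult.assoc)
qed

lemma continuous_on_P: "continuous_on {\<zeta>. Re \<zeta> < 0} P"
  by (rule has_derivative_continuous_on[OF has_derivative_at_withinI[OF has_derivative_P]]) auto

lemma continuous_on_AB: "continuous_on {\<zeta>. Re \<zeta> < 0} A" "continuous_on {\<zeta>. Re \<zeta> < 0} B"
proof -
  have "continuous_on (ball 0 1) (deriv H)" "continuous_on (ball 0 1) (deriv G)"
    using H G by (auto intro!: holomorphic_on_imp_continuous_on holomorphic_deriv)
  then show "continuous_on {\<zeta>. Re \<zeta> < 0} A" "continuous_on {\<zeta>. Re \<zeta> < 0} B"
    unfolding A_def[abs_def] B_def[abs_def]
    by (auto intro!: continuous_intros continuous_on_compose2[of "ball 0 1" _ _ exp])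
qed

lemma continuous_on_J: "continuous_on {\<zeta>. Re \<zeta> < 0} J"
  unfolding J_def[abs_def] by (intro continuous_intros continuous_on_AB)

lemma qc_P: "Re \<zeta> < 0 \<Longrightarrow> (cmod (A \<zeta>) + cmod (B \<zeta>))\<^sup>2 \<le> K * J \<zeta>"
proof -
  assume "Re \<zeta> < 0"
  then have "(cmod (deriv H (exp \<zeta>)) + cmod (deriv G (exp \<zeta>)))\<^sup>2 * (cmod (exp \<zeta>))\<^sup>2
      \<le> K * ((cmod (deriv H (exp \<zeta>)))\<^sup>2 - (cmod (deriv G (exp \<zeta>)))\<^sup>2) * (cmod (exp \<zeta>))\<^sup>2"
    by (intro mult_right_mono qc exp_in_ball) auto
  then show ?thesis
    by (simp only: A_def B_def J_def norm_mult flip: power_mult_distrib distrib_right)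
      (simp add: algebra_simps)
qed

lemma BA_le: "Re \<zeta> < 0 \<Longrightarrow> cmod (B \<zeta>) \<le> cmod (A \<zeta>)"
  unfolding A_def B_def norm_mult by (intro mult_right_mono deriv_le exp_in_ball) auto

lemma J_nonneg: "Re \<zeta> < 0 \<Longrightarrow> J \<zeta> \<ge> 0"
  using BA_le by (simp add: J_def power_mono)

lemma inj_P: "inj_on P (strip a)"
proof (rule inj_onI)
  fix z w assume zw: "z \<in> strip a" "w \<in> strip a" "P z = P w"
  then have "exp z = exp w"
    using inj exp_in_ball unfolding P_def inj_on_def strip_def by blast
  moreover have "\<bar>Im z - Im w\<bar> < 2 * pi" using zw by (auto simp: strip_def)
  ultimately show "z = w" using exp_complex_eqI by blast
qed

lemma area_P:
  assumes "open V" "V \<subseteq> strip a"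
  shows "(\<integral>\<^sup>+\<zeta>\<in>V. J \<zeta> \<partial>lborel) \<le> emeasure lborel (P ` V)"
proof -
  have "Re \<zeta> < 0" if "\<zeta> \<in> V" for \<zeta> using that assms by (auto simp: strip_def)
  then show ?thesis
    unfolding J_def using assms
    by (intro emeasure_harmonic_image has_derivative_P BA_le inj_on_subset[OF inj_P]
        continuous_on_subset[OF continuous_on_AB(1)] continuous_on_subset[OF continuous_on_AB(2)]) auto
qed

end

section \<open>The derivative at the centre and the area of the image\<close>

lemma nn_integral_continuous_interval:
  fixes \<kappa> :: "real \<Rightarrow> real"
  assumes c: "continuous_on {a..b} \<kappa>" and nn: "\<And>y. y \<in> {a..b} \<Longrightarrow> \<kappa> y \<ge> 0"
  shows "(\<integral>\<^sup>+y\<in>{a<..<b}. \<kappa> y \<partial>lborel) = ennreal (integral {a..b} \<kappa>)"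
proof -
  have si: "set_integrable lborel {a..b} \<kappa>"
    by (rule borel_integrable_atLeastAtMost'[OF c])
  have "(\<integral>\<^sup>+y\<in>{a<..<b}. \<kappa> y \<partial>lborel) = (\<integral>\<^sup>+y. ennreal (indicator {a..b} y *\<^sub>R \<kappa> y) \<partial>lborel)"
  proof (rule nn_integral_cong_AE)
    have "AE y in lborel. y \<noteq> a" "AE y in lborel. y \<noteq> b" by (rule AE_lborel_singleton)+
    then show "AE y in lborel. ennreal (\<kappa> y) * indicator {a<..<b} y = ennreal (indicator {a..b} y *\<^sub>R \<kappa> y)"
      by eventually_elim (auto simp: indicator_def)
  qed
  also have "\<dots> = ennreal (LINT y:{a..b}|lborel. \<kappa> y)"
    unfolding set_lebesgue_integral_def
    by (rule nn_integral_eq_integral) (use si nn in \<open>auto simp: set_integrable_def indicator_def\<close>)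
  also have "(LINT y:{a..b}|lborel. \<kappa> y) = integral {a..b} \<kappa>"
    by (rule set_borel_integral_eq_integral(2)[OF si])
  finally show ?thesis .
qed

lemma mean_value_circle_le:
  assumes \<phi>: "\<phi> holomorphic_on ball 0 1" and \<rho>: "0 < \<rho>" "\<rho> < 1"
  shows "2 * pi * cmod (\<phi> 0) \<le> integral {0..2*pi} (\<lambda>t. cmod (\<phi> (of_real \<rho> * cis t)))"
proof -
  have sub: "cball (0::complex) \<rho> \<subseteq> ball 0 1" using \<rho> by auto
  have "((\<lambda>u. \<phi> u / (u - 0)) has_contour_integral (2 * of_real pi * \<i> * \<phi> 0)) (circlepath 0 \<rho>)"
    by (rule Cauchy_integral_circlepath)
      (use \<phi> \<rho> sub in \<open>auto intro: holomorphic_on_imp_continuous_on holomorphic_on_subset\<close>)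
  then have "((\<lambda>t. \<phi> (of_real \<rho> * cis t) / (of_real \<rho> * cis t) * of_real \<rho> * \<i> * cis t) has_integral (2 * of_real pi * \<i> * \<phi> 0)) {0..2*pi}"
    unfolding circlepath_def by (subst (asm) has_contour_integral_part_circlepath_iff) auto
  then have hi: "((\<lambda>t. \<i> * \<phi> (of_real \<rho> * cis t)) has_integral (2 * of_real pi * \<i> * \<phi> 0)) {0..2*pi}"
    by (rule has_integral_eq[rotated]) (use \<rho> in auto)
  have c: "continuous_on {0..2*pi} (\<lambda>t. \<phi> (of_real \<rho> * cis t))"
    by (rule continuous_on_compose2[OF holomorphic_on_imp_continuous_on[OF \<phi>]])
      (use \<rho> in \<open>auto intro!: continuous_intros simp: norm_mult\<close>)
  have "cmod (2 * of_real pi * \<i> * \<phi> 0) = cmod (integral {0..2*pi} (\<lambda>t. \<i> * \<phi> (of_real \<rho> * cis t)))"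
    by (simp only: integral_unique[OF hi])
  also have "\<dots> \<le> integral {0..2*pi} (\<lambda>t. cmod (\<phi> (of_real \<rho> * cis t)))"
    by (rule integral_norm_bound_integral)
      (use c in \<open>auto simp: norm_mult intro!: integrable_continuous_interval continuous_intros\<close>)
  finally show ?thesis by (simp add: norm_mult)
qed

context qc_harmonic_disc begin

lemma strip_indicator: "indicator (strip a) (Complex x y) = (indicator {a<..<0} x * indicator {0<..<2*pi} y :: ennreal)"
  by (auto simp: strip_def indicator_def)

text \<open>Only the annulus 1/2 < |z| < 1 is used, that is a = - ln 2. There |A|^2 \<ge> |H'|^2 /
  4, so by the mean value inequality for the holomorphic function (H')^2 each circle contributes at
  least \<pi>/2 |H'(0)|^2. Integration over an interval of length ln 2 gives the factor ln 2 *
  \<pi>/2, which is at least 1/2.\<close>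

lemma deriv_0_le_area: "ennreal ((cmod (deriv H 0))\<^sup>2 / 2) \<le> ennreal K * emeasure lborel (F ` ball 0 1)"
proof -
  let ?a = "- ln 2 :: real" let ?S = "strip ?a"
  have S: "\<zeta> \<in> ?S \<Longrightarrow> Re \<zeta> < 0" for \<zeta> by (simp add: strip_def)
  define g where "g \<zeta> = indicator ?S \<zeta> *\<^sub>R (cmod (A \<zeta>))\<^sup>2" for \<zeta>
  have [measurable]: "g \<in> borel_measurable borel"
    unfolding g_def[abs_def]
    by (rule borel_measurable_continuous_on_indicator)
      (use S open_strip in \<open>auto intro!: continuous_intros continuous_on_subset[OF continuous_on_AB(1)]\<close>)
  have Jm: "(\<lambda>\<zeta>. indicator ?S \<zeta> *\<^sub>R J \<zeta>) \<in> borel_measurable borel"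
    by (rule borel_measurable_continuous_on_indicator)
      (use S open_strip in \<open>auto intro!: continuous_on_subset[OF continuous_on_J]\<close>)
  define c where "c = (cmod (deriv H 0))\<^sup>2"
  have circ: "ennreal (pi / 2 * c) \<le> (\<integral>\<^sup>+y\<in>{0<..<2*pi}. (cmod (A (Complex x y)))\<^sup>2 \<partial>lborel)" if x: "?a < x" "x < 0" for x
  proof -
    have e: "1 / 2 < exp x" "exp x < 1"
    proof -
      have "exp ?a < exp x" using x by simp
      then show "1 / 2 < exp x" by (simp add: exp_minus)
    qed (use x in simp)
    have ex: "exp (Complex x y) = of_real (exp x) * cis y" for y
      by (simp add: exp_eq_polar)
    have hol: "(\<lambda>z. (deriv H z)\<^sup>2) holomorphic_on ball 0 1"
      using H by (auto intro!: holomorphic_intros holomorphic_deriv)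
    have ci: "continuous_on {0..2*pi} (\<lambda>y. (cmod (A (Complex x y)))\<^sup>2)"
      by (intro continuous_intros continuous_on_compose2[OF continuous_on_AB(1)])
        (use x in \<open>auto simp: Complex_eq intro!: continuous_intros\<close>)
    have cH: "continuous_on {0..2*pi} (\<lambda>t. cmod ((deriv H (of_real (exp x) * cis t))\<^sup>2))"
      by (intro continuous_on_norm continuous_on_compose2[OF holomorphic_on_imp_continuous_on[OF hol]])
        (use e in \<open>auto intro!: continuous_intros simp: norm_mult\<close>)
    have "pi / 2 * c = 1 / 4 * (2 * pi * cmod ((deriv H 0)\<^sup>2))" by (simp add: c_def norm_power)
    also have "\<dots> \<le> 1 / 4 * integral {0..2*pi} (\<lambda>t. cmod ((deriv H (of_real (exp x) * cis t))\<^sup>2))"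
      using mean_value_circle_le[OF hol, of "exp x"] e by simp
    also have "\<dots> = integral {0..2*pi} (\<lambda>t. 1 / 4 * cmod ((deriv H (of_real (exp x) * cis t))\<^sup>2))"
      by simp
    also have "\<dots> \<le> integral {0..2*pi} (\<lambda>y. (cmod (A (Complex x y)))\<^sup>2)"
    proof (rule integral_le)
      fix y
      have "1 / 4 \<le> (exp x)\<^sup>2" using power_mono[of "1/2" "exp x" 2] e by (simp add: power2_eq_square)
      then have "1 / 4 * (cmod (deriv H (of_real (exp x) * cis y)))\<^sup>2 \<le> (exp x)\<^sup>2 * (cmod (deriv H (of_real (exp x) * cis y)))\<^sup>2"
        by (rule mult_right_mono) simp
      then show "1 / 4 * cmod ((deriv H (of_real (exp x) * cis y))\<^sup>2) \<le> (cmod (A (Complex x y)))\<^sup>2"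
        by (simp add: A_def ex norm_mult norm_power power_mult_distrib mult.commute)
    qed (use ci cH in \<open>auto intro!: integrable_continuous_interval continuous_intros\<close>)
    finally show ?thesis
      using nn_integral_continuous_interval[OF ci] by (simp add: ennreal_leI)
  qed
  have half: "1 / 2 \<le> ln 2 * (pi / 2)"
  proof -
    have "2 / 3 * 1 \<le> ln 2 * (pi / 2)"
      using ln2_ge_two_thirds pi_ge_two by (intro mult_mono) auto
    then show ?thesis by simp
  qed
  have "ennreal (c / 2) \<le> ennreal (ln 2 * (pi / 2) * c)"
    using mult_right_mono[OF half, of c] by (intro ennreal_leI) (simp add: c_def)
  also have "\<dots> = ennreal (pi / 2 * c) * emeasure lborel {?a<..<0}"
    by (simp add: c_def algebra_simps flip: ennreal_mult)
  also have "\<dots> = (\<integral>\<^sup>+x. ennreal (pi / 2 * c) * indicator {?a<..<0} x \<partial>lborel)"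
    by (subst nn_integral_cmult_indicator) auto
  also have "\<dots> \<le> (\<integral>\<^sup>+x. \<integral>\<^sup>+y. ennreal (g (Complex x y)) \<partial>lborel \<partial>lborel)"
  proof (rule nn_integral_mono)
    fix x
    show "ennreal (pi / 2 * c) * indicator {?a<..<0} x \<le> (\<integral>\<^sup>+y. ennreal (g (Complex x y)) \<partial>lborel)"
    proof (cases "x \<in> {?a<..<0}")
      case True
      have "(\<integral>\<^sup>+y. ennreal (g (Complex x y)) \<partial>lborel) = (\<integral>\<^sup>+y\<in>{0<..<2*pi}. (cmod (A (Complex x y)))\<^sup>2 \<partial>lborel)"
        by (rule nn_integral_cong) (use True in \<open>auto simp: g_def strip_def indicator_def\<close>)
      then show ?thesis using circ[of x] True by simp
    qed auto
  qed
  also have "\<dots> = (\<integral>\<^sup>+\<zeta>. ennreal (g \<zeta>) \<partial>lborel)"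
    by (rule nn_integral_complex_iterated[symmetric]) measurable
  also have "\<dots> \<le> (\<integral>\<^sup>+\<zeta>. ennreal K * ennreal (indicator ?S \<zeta> *\<^sub>R J \<zeta>) \<partial>lborel)"
  proof (rule nn_integral_mono)
    fix \<zeta>
    show "ennreal (g \<zeta>) \<le> ennreal K * ennreal (indicator ?S \<zeta> *\<^sub>R J \<zeta>)"
    proof (cases "\<zeta> \<in> ?S")
      case True
      have "(cmod (A \<zeta>))\<^sup>2 \<le> (cmod (A \<zeta>) + cmod (B \<zeta>))\<^sup>2" by (intro power_mono) auto
      also have "\<dots> \<le> K * J \<zeta>" by (rule qc_P[OF S[OF True]])
      finally show ?thesis using True K J_nonneg[OF S[OF True]] by (simp add: g_def ennreal_leI flip: ennreal_mult)
    qed (simp add: g_def)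
  qed
  also have "\<dots> = ennreal K * (\<integral>\<^sup>+\<zeta>. ennreal (indicator ?S \<zeta> *\<^sub>R J \<zeta>) \<partial>lborel)"
    by (rule nn_integral_cmult) (use Jm in measurable)
  also have "(\<integral>\<^sup>+\<zeta>. ennreal (indicator ?S \<zeta> *\<^sub>R J \<zeta>) \<partial>lborel) = (\<integral>\<^sup>+\<zeta>\<in>?S. J \<zeta> \<partial>lborel)"
    by (rule nn_integral_cong) (auto simp: indicator_def)
  also have "\<dots> \<le> emeasure lborel (P ` ?S)"
    by (rule area_P[OF open_strip order_refl])
  also have "\<dots> \<le> emeasure lborel (F ` ball 0 1)"
    by (rule emeasure_mono) (use S open_F_image[of "ball 0 1"] in \<open>auto simp: P_def\<close>)
  finally show ?thesis by (simp add: c_def mult_left_mono)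
qed

end

subsection \<open>A Harnack inequality\<close>

text \<open>The squared gradient of \<open>arsinh (ln (cmod w))\<close>.\<close>

definition log_weight :: "complex \<Rightarrow> real" where
  "log_weight w = 1 / ((cmod w)\<^sup>2 * (1 + (ln (cmod w))\<^sup>2))"

text \<open>Bounds 1 / (1 + u^2) from above for n \<le> |u|, where u is the logarithm of the
  modulus.\<close>

definition weight_coeff :: "nat \<Rightarrow> real" where
  "weight_coeff n = 1 / (1 + (real n)\<^sup>2)"

lemma log_weight_nonneg: "log_weight w \<ge> 0"
  by (simp add: log_weight_def)

lemma weight_coeff_nonneg: "weight_coeff n \<ge> 0"
  by (simp add: weight_coeff_def)

lemma summable_weight_coeff: "summable weight_coeff"
proof (rule summable_comparison_test')
  show "summable (\<lambda>n. inverse ((real (Suc n))\<^sup>2) * 4)"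
    using inverse_power_summable[of 2, where 'a = real] by (intro summable_mult2) (subst summable_Suc_iff, simp)
  fix n :: nat assume "n \<ge> 0"
  have "(real (Suc n))\<^sup>2 \<le> 4 * (1 + (real n)\<^sup>2)"
    by (simp add: power2_eq_square algebra_simps) (use zero_le_power2[of "3 * real n - 1"] in \<open>simp add: power2_eq_square algebra_simps\<close>)
  moreover have "0 < 1 + (real n)\<^sup>2" by (simp add: add_pos_nonneg)
  ultimately have "4 / (4 * (1 + (real n)\<^sup>2)) \<le> 4 / (real (Suc n))\<^sup>2" by (intro frac_le) auto
  moreover have "4 / (4 * (1 + (real n)\<^sup>2)) = weight_coeff n"
    unfolding weight_coeff_def by (subst mult_divide_mult_cancel_left[of 4 1, symmetric]) simp_all
  ultimately show "norm (weight_coeff n) \<le> inverse ((real (Suc n))\<^sup>2) * 4"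
    using weight_coeff_nonneg[of n] by (simp add: divide_inverse del: of_nat_Suc)
qed

text \<open>For each n the disc of radius exp (n + 1) and the disc of radius exp (- n), with their
  weights, have mass \<pi> * exp 2 * \<open>weight_coeff n\<close> each.\<close>

definition weight_bound :: real where
  "weight_bound = (\<Sum>n. weight_coeff n * (2 * pi * exp 2))"

text \<open>A point lies in one annulus on which the logarithm of the modulus varies by at most 1,
  and the summand of this annulus alone dominates. Full discs replace annuli because the area of the
  image inside a disc is what univalence bounds; the geometric factors make the overlap
  harmless.\<close>

lemma log_weight_le_suminf:
  assumes "w \<noteq> 0"
  shows "ennreal (log_weight w) \<le> (\<Sum>n. ennreal (weight_coeff n * exp (- 2 * real n)) * indicator (ball 0 (exp (real n + 1))) w
            + ennreal (weight_coeff n * exp (2 * real n + 2)) * indicator (ball 0 (exp (- real n))) w)"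
    (is "_ \<le> (\<Sum>n. ?t n)")
proof -
  define u where "u = ln (cmod w)"
  have w: "cmod w = exp u" using assms by (simp add: u_def)
  have lw: "log_weight w = exp (- 2 * u) / (1 + u\<^sup>2)"
    by (simp add: log_weight_def u_def[symmetric] w exp_minus divide_simps flip: exp_double)
  have "\<exists>n. ennreal (log_weight w) \<le> ?t n"
  proof (cases "u \<ge> 0")
    case True
    define n where "n = nat \<lfloor>u\<rfloor>"
    have n: "real n \<le> u" "u < real n + 1" using True unfolding n_def by linarith+
    have "(real n)\<^sup>2 \<le> u\<^sup>2" using n by (intro power_mono) auto
    then have "exp (- 2 * u) / (1 + u\<^sup>2) \<le> exp (- 2 * real n) / (1 + (real n)\<^sup>2)"
      using n by (intro frac_le) (auto simp: add_pos_nonneg)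
    then have "log_weight w \<le> weight_coeff n * exp (- 2 * real n)"
      by (simp add: lw weight_coeff_def)
    moreover have "w \<in> ball 0 (exp (real n + 1))" using n w by simp
    ultimately have "ennreal (log_weight w) \<le> ?t n"
      by (intro order_trans[OF ennreal_leI add_increasing2]) auto
    then show ?thesis ..
  next
    case False
    \<comment> \<open>Ceiling minus one instead of the floor gives the strict inequality n < - u,
      which places w in the open disc of radius exp (- n).\<close>
    define n where "n = nat (\<lceil>- u\<rceil> - 1)"
    have n: "real n < - u" "- u \<le> real n + 1" using False unfolding n_def by linarith+
    have "(real n)\<^sup>2 \<le> (- u)\<^sup>2" using n by (intro power_mono) auto
    then have "exp (- 2 * u) / (1 + u\<^sup>2) \<le> exp (2 * real n + 2) / (1 + (real n)\<^sup>2)"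
      using n by (intro frac_le) (auto simp: add_pos_nonneg)
    then have "log_weight w \<le> weight_coeff n * exp (2 * real n + 2)"
      by (simp add: lw weight_coeff_def)
    moreover have "w \<in> ball 0 (exp (- real n))" using n w by simp
    ultimately have "ennreal (log_weight w) \<le> ?t n"
      by (intro order_trans[OF ennreal_leI add_increasing]) auto
    then show ?thesis ..
  qed
  then obtain n where "ennreal (log_weight w) \<le> ?t n" ..
  also have "\<dots> \<le> (\<Sum>n. ?t n)"
    using sum_le_suminf[of ?t "{n}"] by simp
  finally show ?thesis .
qed

lemma emeasure_ball_complex: "r \<ge> 0 \<Longrightarrow> emeasure lborel (ball (c::complex) r) = ennreal (pi * r\<^sup>2)"
  by (simp add: emeasure_ball unit_ball_vol_2)

context qc_harmonic_disc begin

text \<open>The part of the strip that P sends into a disc of radius R carries J-mass at most \<pi>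
  R^2, by univalence. Summing over the discs that majorise the weight gives a bound independent of F
  and a.\<close>

lemma weighted_area_P:
  assumes nz: "\<And>z. z \<in> ball 0 1 \<Longrightarrow> F z \<noteq> 0"
  shows "(\<integral>\<^sup>+\<zeta>\<in>strip a. J \<zeta> * log_weight (P \<zeta>) \<partial>lborel) \<le> ennreal weight_bound"
proof -
  let ?S = "strip a"
  have S: "\<zeta> \<in> ?S \<Longrightarrow> Re \<zeta> < 0" for \<zeta> by (simp add: strip_def)
  define j where "j \<zeta> = ennreal (indicator ?S \<zeta> *\<^sub>R J \<zeta>)" for \<zeta>
  have Jm [measurable]: "j \<in> borel_measurable borel"
    unfolding j_def[abs_def]
    by (intro measurable_compose[OF _ measurable_ennreal] borel_measurable_continuous_on_indicator)
      (use S open_strip in \<open>auto intro!: continuous_on_subset[OF continuous_on_J]\<close>)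
  have oV: "open {\<zeta> \<in> ?S. P \<zeta> \<in> ball 0 R}" for R
  proof -
    have "open (?S \<inter> P -` ball 0 R)"
      by (rule continuous_open_preimage) (use S open_strip in \<open>auto intro!: continuous_on_subset[OF continuous_on_P]\<close>)
    then show ?thesis by (simp add: vimage_def Int_def)
  qed
  define V where "V R = {\<zeta> \<in> ?S. P \<zeta> \<in> ball 0 R}" for R
  have [measurable]: "V R \<in> sets borel" for R using oV by (simp add: V_def)
  have ball_int: "(\<integral>\<^sup>+\<zeta>. j \<zeta> * indicator (V R) \<zeta> \<partial>lborel) \<le> ennreal (pi * R\<^sup>2)" if "R \<ge> 0" for R
  proof -
    have "(\<integral>\<^sup>+\<zeta>. j \<zeta> * indicator (V R) \<zeta> \<partial>lborel) = (\<integral>\<^sup>+\<zeta>\<in>V R. J \<zeta> \<partial>lborel)"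
      by (rule nn_integral_cong) (auto simp: j_def V_def indicator_def)
    also have "\<dots> \<le> emeasure lborel (P ` V R)"
      by (rule area_P[of _ a]) (use oV in \<open>auto simp: V_def\<close>)
    also have "\<dots> \<le> emeasure lborel (ball (0::complex) R)"
      by (rule emeasure_mono) (auto simp: V_def)
    finally show ?thesis using that by (simp add: emeasure_ball_complex)
  qed
  define c1 where "c1 n = ennreal (weight_coeff n * exp (- 2 * real n))" for n
  define c2 where "c2 n = ennreal (weight_coeff n * exp (2 * real n + 2))" for n
  have "(\<integral>\<^sup>+\<zeta>\<in>?S. J \<zeta> * log_weight (P \<zeta>) \<partial>lborel)
      \<le> (\<integral>\<^sup>+\<zeta>. (\<Sum>n. c1 n * (j \<zeta> * indicator (V (exp (real n + 1))) \<zeta>) + c2 n * (j \<zeta> * indicator (V (exp (- real n))) \<zeta>)) \<partial>lborel)"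
  proof (rule nn_integral_mono)
    fix \<zeta>
    show "ennreal (J \<zeta> * log_weight (P \<zeta>)) * indicator ?S \<zeta>
      \<le> (\<Sum>n. c1 n * (j \<zeta> * indicator (V (exp (real n + 1))) \<zeta>) + c2 n * (j \<zeta> * indicator (V (exp (- real n))) \<zeta>))"
    proof (cases "\<zeta> \<in> ?S")
      case True
      have "P \<zeta> \<noteq> 0" using nz exp_in_ball[OF S[OF True]] by (simp add: P_def)
      have ind: "indicator (V R) \<zeta> = (indicator (ball 0 R) (P \<zeta>) :: ennreal)" for R
        using True by (simp add: V_def indicator_def)
      have "ennreal (J \<zeta> * log_weight (P \<zeta>)) = j \<zeta> * ennreal (log_weight (P \<zeta>))"
        using True J_nonneg[OF S[OF True]] by (simp add: j_def ennreal_mult log_weight_nonneg)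
      also have "\<dots> \<le> j \<zeta> * (\<Sum>n. c1 n * indicator (ball 0 (exp (real n + 1))) (P \<zeta>) + c2 n * indicator (ball 0 (exp (- real n))) (P \<zeta>))"
        unfolding c1_def c2_def by (rule mult_left_mono[OF log_weight_le_suminf[OF \<open>P \<zeta> \<noteq> 0\<close>]]) simp
      also have "\<dots> = (\<Sum>n. j \<zeta> * (c1 n * indicator (ball 0 (exp (real n + 1))) (P \<zeta>) + c2 n * indicator (ball 0 (exp (- real n))) (P \<zeta>)))"
        by (rule ennreal_suminf_cmult[symmetric])
      also have "\<dots> = (\<Sum>n. c1 n * (j \<zeta> * indicator (V (exp (real n + 1))) \<zeta>) + c2 n * (j \<zeta> * indicator (V (exp (- real n))) \<zeta>))"
        unfolding ind by (intro suminf_cong) (simp add: algebra_simps)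
      finally show ?thesis using True by simp
    qed simp
  qed
  also have "\<dots> = (\<Sum>n. \<integral>\<^sup>+\<zeta>. c1 n * (j \<zeta> * indicator (V (exp (real n + 1))) \<zeta>) + c2 n * (j \<zeta> * indicator (V (exp (- real n))) \<zeta>) \<partial>lborel)"
    by (rule nn_integral_suminf) measurable
  also have "\<dots> \<le> (\<Sum>n. ennreal (weight_coeff n * (2 * pi * exp 2)))"
  proof (rule suminf_le)
    fix n
    have "(\<integral>\<^sup>+\<zeta>. c1 n * (j \<zeta> * indicator (V (exp (real n + 1))) \<zeta>) + c2 n * (j \<zeta> * indicator (V (exp (- real n))) \<zeta>) \<partial>lborel)
       = c1 n * (\<integral>\<^sup>+\<zeta>. j \<zeta> * indicator (V (exp (real n + 1))) \<zeta> \<partial>lborel) + c2 n * (\<integral>\<^sup>+\<zeta>. j \<zeta> * indicator (V (exp (- real n))) \<zeta> \<partial>lborel)"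
      by (subst nn_integral_add) (auto simp: nn_integral_cmult)
    also have "\<dots> \<le> c1 n * ennreal (pi * (exp (real n + 1))\<^sup>2) + c2 n * ennreal (pi * (exp (- real n))\<^sup>2)"
      by (intro add_mono mult_left_mono ball_int) auto
    also have "\<dots> = ennreal (weight_coeff n * exp (- 2 * real n) * (pi * (exp (real n + 1))\<^sup>2) + weight_coeff n * exp (2 * real n + 2) * (pi * (exp (- real n))\<^sup>2))"
      unfolding c1_def c2_def by (simp add: weight_coeff_def flip: ennreal_mult ennreal_plus)
    also have "weight_coeff n * exp (- 2 * real n) * (pi * (exp (real n + 1))\<^sup>2) + weight_coeff n * exp (2 * real n + 2) * (pi * (exp (- real n))\<^sup>2)
       = weight_coeff n * (2 * pi * exp 2)"
    proof -
      have "exp (- 2 * real n) * (exp (real n + 1))\<^sup>2 = exp 2" "exp (2 * real n + 2) * (exp (- real n))\<^sup>2 = exp 2"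
        by (simp_all add: algebra_simps flip: exp_double exp_add)
      then show ?thesis by (simp add: algebra_simps)
    qed
    finally show "(\<integral>\<^sup>+\<zeta>. c1 n * (j \<zeta> * indicator (V (exp (real n + 1))) \<zeta>) + c2 n * (j \<zeta> * indicator (V (exp (- real n))) \<zeta>) \<partial>lborel)
      \<le> ennreal (weight_coeff n * (2 * pi * exp 2))" .
  qed auto
  also have "\<dots> = ennreal weight_bound"
    unfolding weight_bound_def
    by (rule suminf_ennreal2) (auto intro!: summable_mult2 summable_weight_coeff mult_nonneg_nonneg weight_coeff_nonneg)
  finally show ?thesis .
qed

text \<open>Along the circle v = arsinh (ln |P|) satisfies v'^2 \<le> |D|^2 W \<le> K J W, where W
  is the weight and D the tangential derivative of P. It is at most 0 at some point of the circle by
  the minimum principle, and the integral of |v'| bounds the increase from there to any other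
  point.\<close>

lemma log_growth_on_circle:
  assumes nz: "\<And>z. z \<in> ball 0 1 \<Longrightarrow> F z \<noteq> 0" and F0: "cmod (F 0) = 1" and x: "x < 0"
    and z: "cmod z = exp x"
  shows "arsinh (ln (cmod (F z))) \<le> integral {0..2*pi} (\<lambda>y. K * (J (Complex x y) * log_weight (P (Complex x y)) + 1))"
proof -
  define k where "k y = K * (J (Complex x y) * log_weight (P (Complex x y)) + 1)" for y
  define v where "v y = arsinh (ln (cmod (P (Complex x y))))" for y
  define D where "D y = A (Complex x y) * \<i> + cnj (B (Complex x y) * \<i>)" for y
  define v' where "v' y = (P (Complex x y) \<bullet> D y) / (cmod (P (Complex x y)))\<^sup>2 / sqrt (1 + (ln (cmod (P (Complex x y))))\<^sup>2)" for y
  have Pnz: "P (Complex x y) \<noteq> 0" for y using nz exp_in_ball[of "Complex x y"] x by (simp add: P_def)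
  have dv: "(v has_real_derivative v' y) (at y)" for y
  proof -
    have "((\<lambda>y. Complex x y) has_vector_derivative \<i>) (at y)"
      unfolding Complex_eq by (auto intro!: derivative_eq_intros simp: has_vector_derivative_def scaleR_conv_of_real)
    then have dC: "((\<lambda>y. Complex x y) has_derivative (\<lambda>t. t *\<^sub>R \<i>)) (at y)"
      by (simp add: has_vector_derivative_def)
    have "((\<lambda>y. P (Complex x y)) has_derivative (\<lambda>t. t *\<^sub>R D y)) (at y)"
      by (rule has_derivative_eq_rhs[OF has_derivative_compose[OF dC has_derivative_P]])
        (use x in \<open>auto simp: D_def fun_eq_iff scaleR_conv_of_real algebra_simps\<close>)
    then have "((\<lambda>y. cmod (P (Complex x y))) has_derivative (\<lambda>t. (t *\<^sub>R D y) \<bullet> sgn (P (Complex x y)))) (at y)"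
      by (rule has_derivative_compose[of "\<lambda>y. P (Complex x y)" "\<lambda>t. t *\<^sub>R D y" y UNIV cmod, OF _ has_derivative_norm[OF Pnz[of y]]])
    then have "((\<lambda>y. cmod (P (Complex x y))) has_real_derivative (D y \<bullet> sgn (P (Complex x y)))) (at y)"
      by (simp add: has_field_derivative_def mult.commute[of _ "D y \<bullet> _"])
    from DERIV_chain2[where f = ln and g = "\<lambda>y. cmod (P (Complex x y))", OF DERIV_ln_divide this]
    have "((\<lambda>y. ln (cmod (P (Complex x y)))) has_real_derivative (D y \<bullet> sgn (P (Complex x y))) / cmod (P (Complex x y))) (at y)"
      using Pnz[of y] by simp
    from DERIV_chain2[where f = arsinh and g = "\<lambda>y. ln (cmod (P (Complex x y)))", OF arsinh_real_has_field_derivative this]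
    have "((\<lambda>y. arsinh (ln (cmod (P (Complex x y))))) has_real_derivative
        ((D y \<bullet> sgn (P (Complex x y))) / cmod (P (Complex x y))) / sqrt ((ln (cmod (P (Complex x y))))\<^sup>2 + 1)) (at y)"
      by (simp add: mult.commute)
    then show ?thesis
      using Pnz[of y] by (simp add: v_def[abs_def] v'_def sgn_div_norm inner_commute power2_eq_square add.commute divide_simps)
  qed
  have v'_le: "\<bar>v' y\<bar> \<le> k y" for y
  proof -
    let ?W = "log_weight (P (Complex x y))" and ?J = "J (Complex x y)"
    have Wn: "?W \<ge> 0" by (simp add: log_weight_def)
    have Jn: "?J \<ge> 0" using J_nonneg x by simp
    have "cmod (D y) \<le> cmod (A (Complex x y)) + cmod (B (Complex x y))"
      unfolding D_def by (rule order_trans[OF norm_triangle_ineq]) (simp add: norm_mult)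
    then have D2: "(cmod (D y))\<^sup>2 \<le> K * ?J"
      by (rule order_trans[OF power_mono[OF _ norm_ge_zero] qc_P]) (use x in simp)
    have "(v' y)\<^sup>2 \<le> (cmod (D y))\<^sup>2 * ?W"
    proof -
      have "(P (Complex x y) \<bullet> D y)\<^sup>2 \<le> (cmod (P (Complex x y)) * cmod (D y))\<^sup>2"
        using Cauchy_Schwarz_ineq2[of "P (Complex x y)" "D y"] by (intro abs_le_square_iff[THEN iffD1]) simp
      then have "(P (Complex x y) \<bullet> D y)\<^sup>2 / ((cmod (P (Complex x y)))\<^sup>2)\<^sup>2 / (1 + (ln (cmod (P (Complex x y))))\<^sup>2)
          \<le> (cmod (P (Complex x y)) * cmod (D y))\<^sup>2 / ((cmod (P (Complex x y)))\<^sup>2)\<^sup>2 / (1 + (ln (cmod (P (Complex x y))))\<^sup>2)"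
        by (intro divide_right_mono) auto
      also have "\<dots> = (cmod (D y))\<^sup>2 * ?W"
        using Pnz[of y] by (simp add: log_weight_def power_mult_distrib power2_eq_square)
      finally show ?thesis
        by (simp only: v'_def power_divide real_sqrt_pow2[OF add_nonneg_nonneg[OF zero_le_one zero_le_power2]])
    qed
    also have "\<dots> \<le> K * ?J * ?W" using D2 Wn by (rule mult_right_mono)
    \<comment> \<open>The elementary inequality t \<le> (t + 1)^2 removes the square root and plays
      the part of Cauchy-Schwarz in the length-area method; its price is a summand proportional to
      the length of the circle.\<close>
    also have "\<dots> \<le> (K * (?J * ?W + 1))\<^sup>2"
    proof -
      have t: "?J * ?W \<ge> 0" using Jn Wn by simp
      have "K * (?J * ?W) \<le> K * K * (?J * ?W)" using K t by (intro mult_right_mono) auto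
      also have "\<dots> \<le> K * K * (?J * ?W + 1)\<^sup>2"
      proof (rule mult_left_mono)
        have "t \<le> (t + 1)\<^sup>2" if "t \<ge> 0" for t :: real
          using that zero_le_power2[of t] unfolding power2_sum by simp
        then show "?J * ?W \<le> (?J * ?W + 1)\<^sup>2" using t .
      qed (use K in simp)
      finally show ?thesis by (simp add: power2_eq_square algebra_simps)
    qed
    finally have "\<bar>v' y\<bar> \<le> \<bar>k y\<bar>" unfolding k_def by (simp only: abs_le_square_iff)
    moreover have "k y \<ge> 0" using K Jn Wn by (simp add: k_def)
    ultimately show ?thesis by simp
  qed
  have contP: "continuous_on T (\<lambda>y. P (Complex x y))" for T
    by (rule continuous_on_compose2[OF continuous_on_P]) (use x in \<open>auto simp: Complex_eq intro!: continuous_intros\<close>)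
  have contJ: "continuous_on T (\<lambda>y. J (Complex x y))" for T
    by (rule continuous_on_compose2[OF continuous_on_J]) (use x in \<open>auto simp: Complex_eq intro!: continuous_intros\<close>)
  have contk: "continuous_on T k" for T
    unfolding k_def[abs_def] log_weight_def
    using Pnz by (intro continuous_intros contP contJ) (auto simp: add_nonneg_eq_0_iff)
  have kint: "k integrable_on {a..b}" for a b by (intro integrable_continuous_interval contk)
  have knn: "k y \<ge> 0" for y using v'_le[of y] by linarith
  have diff: "\<bar>v q - v p\<bar> \<le> integral {0..2*pi} k" if "0 \<le> p" "p \<le> q" "q \<le> 2 * pi" for p q
  proof -
    have "(v' has_integral v q - v p) {p..q}"
      by (rule fundamental_theorem_of_calculus) (use that dv in \<open>auto simp: has_real_derivative_iff_has_vector_derivative intro: has_vector_derivative_at_within\<close>)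
    then have "norm (v q - v p) \<le> integral {p..q} k"
      using v'_le kint by (metis (no_types, lifting) has_integral_integrable_integral integral_norm_bound_integral real_norm_def)
    also have "\<dots> \<le> integral {0..2*pi} k"
      by (rule integral_subset_le) (use that kint knn in auto)
    finally show ?thesis by simp
  qed
  have arg: "\<exists>y. 0 \<le> y \<and> y \<le> 2 * pi \<and> F z = P (Complex x y)" if "cmod z = exp x" for z
  proof -
    have "z = of_real (exp x) * cis (Arg2pi z)" using Arg2pi_eq[of z] that by (simp add: cis_conv_exp mult.commute)
    then have "z = exp (Complex x (Arg2pi z))" by (simp add: exp_eq_polar)
    then show ?thesis using Arg2pi_ge_0[of z] Arg2pi_lt_2pi[of z] unfolding P_def by (intro exI[of _ "Arg2pi z"]) auto
  qed
  obtain z' where z': "cmod z' = exp x" "cmod (F z') \<le> 1"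
    using min_modulus[of "exp x", OF _ _ nz] x F0 by auto
  obtain p where p: "0 \<le> p" "p \<le> 2 * pi" "F z' = P (Complex x p)" using arg[OF z'(1)] by blast
  obtain q where q: "0 \<le> q" "q \<le> 2 * pi" "F z = P (Complex x q)" using arg[OF z] by blast
  have "v p \<le> 0"
  proof -
    have "ln (cmod (P (Complex x p))) \<le> 0" using z'(2) Pnz[of p] by (simp add: p(3))
    then show ?thesis unfolding v_def by (simp add: not_less[symmetric])
  qed
  moreover have "\<bar>v q - v p\<bar> \<le> integral {0..2*pi} k"
    using diff[of p q] diff[of q p] p q by (cases "p \<le> q") (auto simp: abs_minus_commute)
  ultimately have "v q \<le> integral {0..2*pi} k" by linarith
  then show ?thesis unfolding v_def q(3) k_def .
qed


text \<open>N bounds the mean, over a < x < 0, of the integrals from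
  \<open>log_growth_on_circle\<close>: the weighted area contributes \<open>weight_bound\<close>,
  the extra summand 1 contributes the area of the strip. So not every circle can have an integral of
  N + 1 or more.\<close>

lemma growth_bound_on_some_circle:
  assumes nz: "\<And>z. z \<in> ball 0 1 \<Longrightarrow> F z \<noteq> 0" and F0: "cmod (F 0) = 1" and a: "a < 0"
  defines "N \<equiv> K * (weight_bound + 2 * pi * (- a)) / (- a)"
  shows "\<exists>x. a < x \<and> x < 0 \<and> (\<forall>z. cmod z = exp x \<longrightarrow> cmod (F z) \<le> exp (sinh (N + 1)))"
proof (rule ccontr)
  let ?S = "strip a"
  define k where "k \<zeta> = K * (J \<zeta> * log_weight (P \<zeta>) + 1)" for \<zeta>
  have S: "\<zeta> \<in> ?S \<Longrightarrow> Re \<zeta> < 0" for \<zeta> by (simp add: strip_def)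
  have Pnz: "P \<zeta> \<noteq> 0" if "Re \<zeta> < 0" for \<zeta> using nz exp_in_ball[OF that] by (simp add: P_def)
  have contW: "continuous_on {\<zeta>. Re \<zeta> < 0} (\<lambda>\<zeta>. J \<zeta> * log_weight (P \<zeta>))"
    unfolding log_weight_def
    using Pnz by (intro continuous_intros continuous_on_P continuous_on_J) (auto simp: add_nonneg_eq_0_iff)
  assume "\<not> ?thesis"
  then have big: "\<exists>z. cmod z = exp x \<and> exp (sinh (N + 1)) < cmod (F z)" if "a < x" "x < 0" for x
    using that by (meson not_less)
  have N0: "N \<ge> 0"
    unfolding N_def weight_bound_def using a K
    by (intro divide_nonneg_nonneg mult_nonneg_nonneg add_nonneg_nonneg suminf_nonneg summable_mult2 summable_weight_coeff)
      (auto simp: weight_coeff_nonneg)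
  have slice: "ennreal (N + 1) \<le> (\<integral>\<^sup>+y\<in>{0<..<2*pi}. k (Complex x y) \<partial>lborel)" if x: "a < x" "x < 0" for x
  proof -
    obtain z where z: "cmod z = exp x" "exp (sinh (N + 1)) < cmod (F z)" using big[OF x] by blast
    then have "ln (exp (sinh (N + 1))) < ln (cmod (F z))"
      by (subst ln_less_cancel_iff) (auto intro: less_trans[OF exp_gt_zero])
    then have "arsinh (sinh (N + 1)) < arsinh (ln (cmod (F z)))" by (simp only: ln_exp arsinh_less_iff_real)
    also have "\<dots> \<le> integral {0..2*pi} (\<lambda>y. k (Complex x y))"
      unfolding k_def by (rule log_growth_on_circle[OF nz F0 x(2) z(1)])
    finally have "N + 1 \<le> integral {0..2*pi} (\<lambda>y. k (Complex x y))" by (simp add: arsinh_sinh_real)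
    moreover have "(\<integral>\<^sup>+y\<in>{0<..<2*pi}. k (Complex x y) \<partial>lborel) = ennreal (integral {0..2*pi} (\<lambda>y. k (Complex x y)))"
    proof (rule nn_integral_continuous_interval)
      show "continuous_on {0..2*pi} (\<lambda>y. k (Complex x y))"
        unfolding k_def
        by (intro continuous_intros continuous_on_compose2[OF contW])
          (use x in \<open>auto simp: Complex_eq intro!: continuous_intros\<close>)
      show "k (Complex x y) \<ge> 0" for y
        using K J_nonneg[of "Complex x y"] x log_weight_nonneg[of "P (Complex x y)"] by (simp add: k_def)
    qed
    ultimately show ?thesis by (simp add: ennreal_leI)
  qed
  define w where "w \<zeta> = indicator ?S \<zeta> *\<^sub>R (J \<zeta> * log_weight (P \<zeta>))" for \<zeta>
  have [measurable]: "w \<in> borel_measurable borel"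
    unfolding w_def[abs_def]
    by (rule borel_measurable_continuous_on_indicator)
      (use S open_strip in \<open>auto intro!: continuous_on_subset[OF contW]\<close>)
  have [measurable]: "?S \<in> sets borel" using open_strip by simp
  have Sm: "emeasure lborel ?S = ennreal (2 * pi * (- a))"
  proof -
    have "emeasure lborel ?S = (\<integral>\<^sup>+\<zeta>. indicator ?S \<zeta> \<partial>lborel)" by simp
    also have "\<dots> = (\<integral>\<^sup>+x. \<integral>\<^sup>+y. indicator ?S (Complex x y) \<partial>lborel \<partial>lborel)"
      by (rule nn_integral_complex_iterated) measurable
    also have "\<dots> = (\<integral>\<^sup>+x. ennreal (2 * pi) * indicator {a<..<0} x \<partial>lborel)"
      unfolding strip_indicator by (intro nn_integral_cong) (simp add: nn_integral_cmult mult.commute)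
    also have "\<dots> = ennreal (2 * pi * (- a))"
      using a by (simp add: nn_integral_cmult flip: ennreal_mult)
    finally show ?thesis .
  qed
  have "ennreal ((N + 1) * (- a)) = ennreal (N + 1) * emeasure lborel {a<..<0}"
    by (subst ennreal_mult) (use a N0 in simp_all)
  also have "\<dots> = (\<integral>\<^sup>+x. ennreal (N + 1) * indicator {a<..<0} x \<partial>lborel)"
    by (subst nn_integral_cmult_indicator) auto
  also have "\<dots> \<le> (\<integral>\<^sup>+x. \<integral>\<^sup>+y. ennreal K * (ennreal (w (Complex x y)) + indicator ?S (Complex x y)) \<partial>lborel \<partial>lborel)"
  proof (rule nn_integral_mono)
    fix x
    show "ennreal (N + 1) * indicator {a<..<0} x \<le> (\<integral>\<^sup>+y. ennreal K * (ennreal (w (Complex x y)) + indicator ?S (Complex x y)) \<partial>lborel)"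
    proof (cases "x \<in> {a<..<0}")
      case True
      have "ennreal (k (Complex x y)) * indicator {0<..<2*pi} y = ennreal K * (ennreal (w (Complex x y)) + indicator ?S (Complex x y))" for y
        using True K J_nonneg[of "Complex x y"] log_weight_nonneg[of "P (Complex x y)"]
        by (auto simp: k_def w_def indicator_def strip_def ennreal_mult ennreal_plus)
      then show ?thesis using slice[of x] True by simp
    qed auto
  qed
  also have "\<dots> = (\<integral>\<^sup>+\<zeta>. ennreal K * (ennreal (w \<zeta>) + indicator ?S \<zeta>) \<partial>lborel)"
    by (rule nn_integral_complex_iterated[symmetric]) measurable
  also have "\<dots> = ennreal K * ((\<integral>\<^sup>+\<zeta>. ennreal (w \<zeta>) \<partial>lborel) + emeasure lborel ?S)"
    by (simp add: nn_integral_cmult nn_integral_add)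
  also have "(\<integral>\<^sup>+\<zeta>. ennreal (w \<zeta>) \<partial>lborel) = (\<integral>\<^sup>+\<zeta>\<in>?S. J \<zeta> * log_weight (P \<zeta>) \<partial>lborel)"
    by (rule nn_integral_cong) (auto simp: w_def indicator_def)
  also have "ennreal K * (\<dots> + emeasure lborel ?S) \<le> ennreal K * (ennreal weight_bound + ennreal (2 * pi * (- a)))"
    unfolding Sm by (intro mult_left_mono add_right_mono weighted_area_P nz) auto
  also have "\<dots> = ennreal (K * (weight_bound + 2 * pi * (- a)))"
  proof -
    have "weight_bound \<ge> 0" unfolding weight_bound_def
      by (intro suminf_nonneg summable_mult2 summable_weight_coeff) (auto simp: weight_coeff_nonneg)
    moreover have "2 * pi * (- a) \<ge> 0" using a by (intro mult_nonneg_nonneg) auto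
    ultimately have "ennreal weight_bound + ennreal (2 * pi * (- a)) = ennreal (weight_bound + 2 * pi * (- a))"
      and "weight_bound + 2 * pi * (- a) \<ge> 0"
      by (rule ennreal_plus[symmetric], rule add_nonneg_nonneg)
    then show ?thesis using K by (simp only: ennreal_mult)
  qed
  also have "K * (weight_bound + 2 * pi * (- a)) = N * (- a)" using a by (simp add: N_def)
  finally have "(N + 1) * (- a) \<le> N * (- a)"
    using a N0 by (subst (asm) ennreal_le_iff) (auto intro!: mult_nonneg_nonpos)
  then show False using a by (simp add: algebra_simps)
qed

text \<open>With a = ln t the good circle has radius greater than t, and the maximum principle
  carries its bound to the smaller disc.\<close>

lemma harnack:
  assumes nz: "\<And>z. z \<in> ball 0 1 \<Longrightarrow> F z \<noteq> 0" and F0: "cmod (F 0) = 1" and t: "0 < t" "t < 1"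
    and z: "cmod z \<le> t"
  shows "cmod (F z) \<le> exp (sinh (K * (weight_bound + 2 * pi * (- ln t)) / (- ln t) + 1))"
proof -
  obtain x where x: "ln t < x" "x < 0"
    and le: "\<And>z. cmod z = exp x \<Longrightarrow> cmod (F z) \<le> exp (sinh (K * (weight_bound + 2 * pi * (- ln t)) / (- ln t) + 1))"
    using growth_bound_on_some_circle[OF nz F0, of "ln t"] t by auto
  have "t < exp x" using x(1) t exp_less_mono[of "ln t" x] by simp
  show ?thesis
  proof (rule max_modulus[of "exp x"])
    show "cmod z \<le> exp x" using z \<open>t < exp x\<close> by simp
  qed (use x le in simp_all)
qed

end

subsection \<open>Dyadic decomposition of a radius\<close>

definition harnack_const :: "real \<Rightarrow> real \<Rightarrow> real" where
  "harnack_const K t = exp (sinh (K * (weight_bound + 2 * pi * (- ln t)) / (- ln t) + 1))"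

text \<open>The centre is the midpoint of the segment from 1 - (1/2)^j to 1 - (1/2)^(j+1) in
  direction e. The radius is its half-length, 1/4 (1/2)^j, plus a margin of 1/8 (1/2)^j in which the
  derivative is estimated.\<close>

definition dyadic_disc :: "complex \<Rightarrow> nat \<Rightarrow> complex set" where
  "dyadic_disc e j = ball (of_real (1 - 3 / 4 * (1 / 2) ^ j) * e) (3 / 8 * (1 / 2) ^ j)"

lemma dyadic_disc_subset: 
  assumes "cmod e = 1"
  shows "dyadic_disc e j \<subseteq> ball 0 1"
proof
  fix z assume "z \<in> dyadic_disc e j"
  then have "cmod (of_real (1 - 3 / 4 * (1 / 2) ^ j) * e - z) < 3 / 8 * (1 / 2) ^ j" by (simp add: dyadic_disc_def dist_norm)
  moreover have "cmod z \<le> cmod (of_real (1 - 3 / 4 * (1 / 2) ^ j) * e - z) + cmod (of_real (1 - 3 / 4 * (1 / 2) ^ j) * e)"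
    by (metis norm_minus_commute norm_triangle_sub add.commute)
  moreover have "cmod (of_real (1 - 3 / 4 * (1 / 2) ^ j) * e) = 1 - 3 / 4 * (1 / 2) ^ j"
  proof -
    have "(1 / 2 :: real) ^ j \<le> 1" by (rule power_le_one) auto
    then have "1 - 3 / 4 * (1 / 2) ^ j \<ge> (0::real)" by linarith
    then show ?thesis using assms by (simp only: norm_mult norm_of_real) simp
  qed
  moreover have "(1 / 2 :: real) ^ j > 0" by simp
  ultimately have "cmod z < 1" by linarith
  then show "z \<in> ball 0 1" by simp
qed

text \<open>For j = i + 2 the centres are 9/16 (1/2)^i apart and the radii add up to 15/32 (1/2)^i.
  Discs with consecutive indices do overlap.\<close>

lemma dyadic_disc_disjoint:
  assumes e: "cmod e = 1" and ij: "i + 2 \<le> j"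
  shows "dyadic_disc e i \<inter> dyadic_disc e j = {}"
  unfolding dyadic_disc_def
proof (rule disjoint_ballI)
  have "(1 / 2 :: real) ^ j \<le> (1 / 2) ^ (i + 2)" using ij by (intro power_decreasing) auto
  then have le: "(1 / 2 :: real) ^ j \<le> (1 / 2) ^ i / 4" by (simp add: power_add power2_eq_square)
  have "dist (of_real (1 - 3 / 4 * (1 / 2) ^ i) * e) (of_real (1 - 3 / 4 * (1 / 2) ^ j) * e)
      = \<bar>3 / 4 * (1 / 2) ^ j - 3 / 4 * (1 / 2 :: real) ^ i\<bar>"
  proof -
    have "of_real (1 - 3 / 4 * (1 / 2) ^ i) * e - of_real (1 - 3 / 4 * (1 / 2) ^ j) * e
        = of_real (3 / 4 * (1 / 2) ^ j - 3 / 4 * (1 / 2) ^ i) * e"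
      by (simp add: algebra_simps)
    then show ?thesis using e by (simp only: dist_norm norm_mult norm_of_real) simp
  qed
  moreover have "(1 / 2 :: real) ^ j > 0" by simp
  ultimately show "3 / 8 * (1 / 2) ^ i + 3 / 8 * (1 / 2) ^ j
      \<le> dist (of_real (1 - 3 / 4 * (1 / 2) ^ i) * e) (of_real (1 - 3 / 4 * (1 / 2) ^ j) * e)"
    using le by linarith
qed

context qc_harmonic_disc begin

lemma rescale:
  assumes s: "s > 0" and sub: "ball c s \<subseteq> ball 0 1" and d: "d > 0"
  shows "qc_harmonic_disc K (\<lambda>z. F (c + of_real s * z) / of_real d)
    (\<lambda>z. H (c + of_real s * z) / of_real d) (\<lambda>z. G (c + of_real s * z) / of_real d)"
    and "deriv (\<lambda>z. H (c + of_real s * z) / of_real d) 0 = deriv H c * of_real s / of_real d"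
proof -
  have in_ball: "c + of_real s * z \<in> ball 0 1" if "z \<in> ball 0 1" for z
  proof -
    have "dist c (c + of_real s * z) < s" using that s by (simp add: dist_norm norm_mult)
    then show ?thesis using sub by (meson mem_ball subsetD)
  qed
  have der: "((\<lambda>z. u (c + of_real s * z) / of_real d) has_field_derivative deriv u (c + of_real s * z) * of_real s / of_real d) (at z)"
    if "u holomorphic_on ball 0 1" "z \<in> ball 0 1" for u z
  proof -
    have "((\<lambda>z. c + of_real s * z) has_field_derivative of_real s) (at z)"
      by (auto intro!: derivative_eq_intros)
    from DERIV_chain2[OF holomorphic_derivI[OF that(1) open_ball in_ball[OF that(2)]] this]
    show ?thesis by (rule DERIV_cdivide)
  qed
  have der_eq: "deriv (\<lambda>z. u (c + of_real s * z) / of_real d) z = deriv u (c + of_real s * z) * of_real s / of_real d"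
    if "u holomorphic_on ball 0 1" "z \<in> ball 0 1" for u z
    using DERIV_imp_deriv[OF der[OF that]] .
  have hol: "(\<lambda>z. u (c + of_real s * z) / of_real d) holomorphic_on ball 0 1" if "u holomorphic_on ball 0 1" for u
    using der[OF that] holomorphic_on_open[OF open_ball] by blast
  show "deriv (\<lambda>z. H (c + of_real s * z) / of_real d) 0 = deriv H c * of_real s / of_real d"
    using der_eq[OF H, of 0] by simp
  show "qc_harmonic_disc K (\<lambda>z. F (c + of_real s * z) / of_real d)
    (\<lambda>z. H (c + of_real s * z) / of_real d) (\<lambda>z. G (c + of_real s * z) / of_real d)"
  proof (unfold_locales)
    show "K \<ge> 1" by (rule K)
    show "(\<lambda>z. H (c + of_real s * z) / of_real d) holomorphic_on ball 0 1"
      "(\<lambda>z. G (c + of_real s * z) / of_real d) holomorphic_on ball 0 1"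
      using hol H G by blast+
    show "inj_on (\<lambda>z. F (c + of_real s * z) / of_real d) (ball 0 1)"
    proof (rule inj_onI)
      fix z w assume zw: "z \<in> ball 0 1" "w \<in> ball 0 1"
        "F (c + of_real s * z) / of_real d = F (c + of_real s * w) / of_real d"
      then have "F (c + of_real s * z) = F (c + of_real s * w)" using d by simp
      then have "c + of_real s * z = c + of_real s * w"
        using inj_onD[OF inj _ in_ball[OF zw(1)] in_ball[OF zw(2)]] by blast
      then show "z = w" using s by simp
    qed
  next
    fix z :: complex assume z: "z \<in> ball 0 1"
    show "F (c + of_real s * z) / of_real d = H (c + of_real s * z) / of_real d + cnj (G (c + of_real s * z) / of_real d)"
      using F[OF in_ball[OF z]] by (simp add: add_divide_distrib)
    have n: "cmod (w * of_real s / of_real d) = cmod w * (s / d)" for w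
      using s d by (simp add: norm_mult norm_divide)
    have "(cmod (deriv H (c + of_real s * z)) + cmod (deriv G (c + of_real s * z)))\<^sup>2 * (s / d)\<^sup>2
      \<le> K * ((cmod (deriv H (c + of_real s * z)))\<^sup>2 - (cmod (deriv G (c + of_real s * z)))\<^sup>2) * (s / d)\<^sup>2"
      by (intro mult_right_mono qc in_ball z) simp
    then show "(cmod (deriv (\<lambda>z. H (c + of_real s * z) / of_real d) z) + cmod (deriv (\<lambda>z. G (c + of_real s * z) / of_real d) z))\<^sup>2
      \<le> K * ((cmod (deriv (\<lambda>z. H (c + of_real s * z) / of_real d) z))\<^sup>2 - (cmod (deriv (\<lambda>z. G (c + of_real s * z) / of_real d) z))\<^sup>2)"
      unfolding der_eq[OF H z] der_eq[OF G z] n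
      by (simp only: power_mult_distrib distrib_right[symmetric] left_diff_distrib[symmetric] mult.assoc)
  qed
qed

lemma harnack_ball:
  assumes s: "s > 0" and sub: "ball c s \<subseteq> ball 0 1" and nz: "\<And>z. z \<in> ball c s \<Longrightarrow> F z \<noteq> 0"
    and t: "0 < t" "t < 1" and z: "dist c z \<le> t * s"
  shows "cmod (F z) \<le> harnack_const K t * cmod (F c)"
proof -
  have Fc: "cmod (F c) > 0" using nz s by simp
  define d where "d = cmod (F c)"
  interpret R: qc_harmonic_disc K "\<lambda>z. F (c + of_real s * z) / of_real d" "\<lambda>z. H (c + of_real s * z) / of_real d" "\<lambda>z. G (c + of_real s * z) / of_real d"
    by (rule rescale(1)) (use s sub Fc in \<open>auto simp: d_def\<close>)
  define w where "w = (z - c) / of_real s"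
  have w: "c + of_real s * w = z" using s by (simp add: w_def)
  have "cmod (F (c + of_real s * w) / of_real d) \<le> harnack_const K t"
    unfolding harnack_const_def
  proof (rule R.harnack[OF _ _ t])
    fix y :: complex assume "y \<in> ball 0 1"
    then have "c + of_real s * y \<in> ball c s" using s by (simp add: dist_norm norm_mult)
    then show "F (c + of_real s * y) / of_real d \<noteq> 0" using nz Fc by (simp add: d_def)
  next
    show "cmod (F (c + of_real s * 0) / of_real d) = 1" using Fc by (simp add: d_def norm_divide)
    show "cmod w \<le> t" using z s by (simp add: w_def norm_divide dist_norm norm_minus_commute divide_le_eq)
  qed
  then show ?thesis using Fc unfolding w by (simp add: d_def norm_divide divide_le_eq)
qed

lemma deriv_le_area_ball:
  assumes s: "s > 0" and sub: "ball c s \<subseteq> ball 0 1"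
    and fin: "F ` ball c s \<subseteq> cball 0 R"
  shows "(s * cmod (deriv H c))\<^sup>2 / 2 \<le> K * measure lborel (F ` ball c s)"
proof -
  interpret R: qc_harmonic_disc K "\<lambda>z. F (c + of_real s * z) / of_real 1" "\<lambda>z. H (c + of_real s * z) / of_real 1" "\<lambda>z. G (c + of_real s * z) / of_real 1"
    by (rule rescale(1)) (use s sub in auto)
  have img: "(\<lambda>z. F (c + of_real s * z) / of_real 1) ` ball 0 1 = F ` ball c s"
  proof -
    have "(\<lambda>z. c + of_real s * z) ` ball 0 1 = ball c s"
    proof (intro set_eqI iffI)
      fix y assume "y \<in> ball c s"
      then have "(y - c) / of_real s \<in> ball 0 1" using s by (simp add: norm_divide dist_norm norm_minus_commute)
      moreover have "y = c + of_real s * ((y - c) / of_real s)" using s by simp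
      ultimately show "y \<in> (\<lambda>z. c + of_real s * z) ` ball 0 1" by (rule rev_image_eqI)
    qed (use s in \<open>auto simp: dist_norm norm_mult\<close>)
    moreover have "(\<lambda>z. F (c + of_real s * z) / of_real 1) ` ball 0 1 = F ` ((\<lambda>z. c + of_real s * z) ` ball 0 1)"
      by (simp only: image_image of_real_1 div_by_1)
    ultimately show ?thesis by simp
  qed
  have "emeasure lborel (F ` ball c s) \<le> emeasure lborel (cball (0::complex) R)"
    by (rule emeasure_mono[OF fin]) simp
  also have "\<dots> < \<infinity>" by (rule emeasure_lborel_cball_finite)
  finally have "emeasure lborel (F ` ball c s) = ennreal (measure lborel (F ` ball c s))"
    by (intro emeasure_eq_ennreal_measure) auto
  then have "ennreal ((cmod (deriv H c * of_real s / of_real 1))\<^sup>2 / 2) \<le> ennreal (K * measure lborel (F ` ball c s))"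
    using R.deriv_0_le_area K unfolding img rescale(2)[OF s sub zero_less_one] by (simp add: ennreal_mult)
  then have "(cmod (deriv H c * of_real s / of_real 1))\<^sup>2 / 2 \<le> K * measure lborel (F ` ball c s)"
    using K by (subst (asm) ennreal_le_iff) auto
  then show ?thesis using s by (simp add: norm_mult mult.commute)
qed

text \<open>The base point is the inner end of the j-th segment, so that it lies on the part of the
  radius where |F| is controlled even when r falls early in that segment. The disc of radius (1/2)^j
  about it avoids 0, the only zero of F, because j \<ge> 1. The dyadic disc stays within 1/4 + 3/8
  \<le> 3/4 of that radius.\<close>

lemma dyadic_disc_harnack:
  assumes e: "cmod e = 1" and j: "j \<ge> 1" and F0: "F 0 = 0" and z: "z \<in> dyadic_disc e j"
  shows "cmod (F z) \<le> harnack_const K (3/4) * cmod (F (of_real (1 - (1 / 2) ^ j) * e))"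
proof (rule harnack_ball[where s = "(1 / 2) ^ j"])
  let ?c = "of_real (1 - (1 / 2) ^ j) * e"
  have p: "(1 / 2 :: real) ^ j > 0" "(1 / 2 :: real) ^ j \<le> 1 / 2"
    using power_decreasing[of 1 j "1 / 2 :: real"] j by auto
  have nc: "cmod ?c = 1 - (1 / 2) ^ j"
    using p e by (simp only: norm_mult norm_of_real) simp
  show "(1 / 2 :: real) ^ j > 0" by simp
  show sub: "ball ?c ((1 / 2) ^ j) \<subseteq> ball 0 1"
    by (subst ball_subset_ball_iff) (use nc in \<open>simp add: dist_norm\<close>)
  show "F w \<noteq> 0" if w: "w \<in> ball ?c ((1 / 2) ^ j)" for w
  proof
    assume "F w = 0"
    then have "w = 0" using inj_onD[OF inj, of w 0] F0 w sub by auto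
    then have "cmod ?c < (1 / 2) ^ j" using w by (simp add: dist_norm)
    then show False using nc p by linarith
  qed
  have "dist ?c (of_real (1 - 3 / 4 * (1 / 2) ^ j) * e) = 1 / 4 * (1 / 2) ^ j"
  proof -
    have "?c - of_real (1 - 3 / 4 * (1 / 2) ^ j) * e = of_real (- (1 / 4 * (1 / 2) ^ j)) * e"
      by (simp add: algebra_simps)
    then show ?thesis using e p by (simp only: dist_norm norm_mult norm_of_real)
  qed
  moreover have "dist (of_real (1 - 3 / 4 * (1 / 2) ^ j) * e) z < 3 / 8 * (1 / 2) ^ j"
    using z by (simp add: dyadic_disc_def)
  ultimately show "dist ?c z \<le> 3 / 4 * (1 / 2) ^ j"
    using dist_triangle[of ?c z "of_real (1 - 3 / 4 * (1 / 2) ^ j) * e"] p by linarith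
qed auto

lemma sum_area_dyadic_le:
  assumes e: "cmod e = 1" and I: "finite I" and sub: "\<And>j. j \<in> I \<Longrightarrow> F ` dyadic_disc e j \<subseteq> cball 0 R"
    and R: "R \<ge> 0" and sep: "\<And>i j. i \<in> I \<Longrightarrow> j \<in> I \<Longrightarrow> i < j \<Longrightarrow> i + 2 \<le> j"
  shows "(\<Sum>j\<in>I. measure lborel (F ` dyadic_disc e j)) \<le> pi * R\<^sup>2"
proof -
  have op: "open (F ` dyadic_disc e j)" for j
    by (rule open_F_image[OF _ dyadic_disc_subset[OF e]]) (simp add: dyadic_disc_def)
  have fin: "emeasure lborel (F ` dyadic_disc e j) \<noteq> \<infinity>" if "j \<in> I" for j
    using emeasure_mono[OF sub[OF that], of lborel] emeasure_lborel_cball_finite[of "0::complex" R] by auto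
  have "disjoint_family_on (\<lambda>j. F ` dyadic_disc e j) I"
    unfolding disjoint_family_on_def
  proof (intro ballI impI)
    fix i j assume ij: "i \<in> I" "j \<in> I" "i \<noteq> j"
    have "dyadic_disc e i \<inter> dyadic_disc e j = {}"
      using sep ij dyadic_disc_disjoint[OF e, of i j] dyadic_disc_disjoint[OF e, of j i]
      by (metis Int_commute linorder_neqE_nat)
    then show "F ` dyadic_disc e i \<inter> F ` dyadic_disc e j = {}"
      using inj_on_image_Int[OF inj dyadic_disc_subset[OF e] dyadic_disc_subset[OF e]] by (metis image_empty)
  qed
  then have "(\<Sum>j\<in>I. measure lborel (F ` dyadic_disc e j)) = measure lborel (\<Union>j\<in>I. F ` dyadic_disc e j)"
    using op fin I by (intro measure_finite_Union[symmetric]) auto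
  also have "\<dots> \<le> measure lborel (cball (0::complex) R)"
    using sub op emeasure_lborel_cball_finite[of "0::complex" R]
    by (intro measure_mono_fmeasurable) (auto simp: fmeasurable_def)
  also have "\<dots> = pi * R\<^sup>2"
    using R emeasure_cball[of R "0::complex"] by (simp add: measure_def unit_ball_vol_2)
  finally show ?thesis .
qed

end

context qc_harmonic_disc begin

text \<open>Indices of equal parity differ by at least 2, so their discs are disjoint; the two
  parities account for the factor 2.\<close>

lemma sum_area_dyadic_le':
  assumes e: "cmod e = 1" and sub: "\<And>j. j \<in> {1..n} \<Longrightarrow> F ` dyadic_disc e j \<subseteq> cball 0 R" and R: "R \<ge> 0"
  shows "(\<Sum>j=1..n. measure lborel (F ` dyadic_disc e j)) \<le> 2 * pi * R\<^sup>2"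
proof -
  let ?m = "\<lambda>j. measure lborel (F ` dyadic_disc e j)"
  have split: "{1..n} = {j\<in>{1..n}. even j} \<union> {j\<in>{1..n}. odd j}" by auto
  have "(\<Sum>j=1..n. ?m j) = (\<Sum>j\<in>{j\<in>{1..n}. even j}. ?m j) + (\<Sum>j\<in>{j\<in>{1..n}. odd j}. ?m j)"
    by (subst split, rule sum.union_disjoint) auto
  moreover have "(\<Sum>j\<in>{j\<in>{1..n}. even j}. ?m j) \<le> pi * R\<^sup>2"
    by (rule sum_area_dyadic_le[OF e _ _ R]) (use sub in \<open>auto elim!: evenE\<close>)
  moreover have "(\<Sum>j\<in>{j\<in>{1..n}. odd j}. ?m j) \<le> pi * R\<^sup>2"
    by (rule sum_area_dyadic_le[OF e _ _ R]) (use sub in \<open>auto elim!: oddE\<close>)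
  ultimately show ?thesis by linarith
qed

text \<open>The margin of the dyadic disc is the radius 1/8 (1/2)^j of a disc about any point of the
  segment, and the bound of the derivative by the area of its image applies there; 8 * 2^j is the
  reciprocal of this radius.\<close>

lemma deriv_le_on_dyadic_interval:
  assumes e: "cmod e = 1" and j: "j \<ge> 1" and sub: "F ` dyadic_disc e j \<subseteq> cball 0 R"
    and \<rho>: "1 - (1 / 2) ^ j \<le> \<rho>" "\<rho> \<le> 1 - (1 / 2) ^ Suc j"
  shows "cmod (deriv H (of_real \<rho> * e)) \<le> 8 * 2 ^ j * sqrt (2 * K * measure lborel (F ` dyadic_disc e j))"
proof -
  let ?m = "measure lborel (F ` dyadic_disc e j)" and ?s = "1 / 8 * (1 / 2 :: real) ^ j"
  have s: "?s > 0" by simp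
  have inc: "ball (of_real \<rho> * e) ?s \<subseteq> dyadic_disc e j"
    unfolding dyadic_disc_def
  proof (subst ball_subset_ball_iff, rule disjI1)
    have "of_real \<rho> * e - of_real (1 - 3 / 4 * (1 / 2) ^ j) * e = of_real (\<rho> - (1 - 3 / 4 * (1 / 2) ^ j)) * e"
      by (simp add: algebra_simps)
    then have "dist (of_real \<rho> * e) (of_real (1 - 3 / 4 * (1 / 2) ^ j) * e) = \<bar>\<rho> - (1 - 3 / 4 * (1 / 2) ^ j)\<bar>"
      using e by (simp only: dist_norm norm_mult norm_of_real) simp
    then show "dist (of_real \<rho> * e) (of_real (1 - 3 / 4 * (1 / 2) ^ j) * e) + ?s \<le> 3 / 8 * (1 / 2) ^ j"
      using \<rho> unfolding power_Suc by linarith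
  qed
  have "(?s * cmod (deriv H (of_real \<rho> * e)))\<^sup>2 / 2 \<le> K * measure lborel (F ` ball (of_real \<rho> * e) ?s)"
    by (rule deriv_le_area_ball[OF s _ order_trans[OF image_mono[OF inc] sub]])
      (use inc dyadic_disc_subset[OF e] in blast)
  also have "\<dots> \<le> K * ?m"
  proof (rule mult_left_mono)
    show "measure lborel (F ` ball (of_real \<rho> * e) ?s) \<le> ?m"
    proof (rule measure_mono_fmeasurable)
      show "F ` ball (of_real \<rho> * e) ?s \<subseteq> F ` dyadic_disc e j" by (rule image_mono[OF inc])
      have "open (F ` ball (of_real \<rho> * e) ?s)"
        by (rule open_F_image) (use inc dyadic_disc_subset[OF e] in blast)+
      then show "F ` ball (of_real \<rho> * e) ?s \<in> sets lborel" by simp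
      have "open (F ` dyadic_disc e j)"
        by (rule open_F_image[OF _ dyadic_disc_subset[OF e]]) (simp add: dyadic_disc_def)
      moreover have "emeasure lborel (F ` dyadic_disc e j) < \<infinity>"
        using emeasure_mono[OF sub, of lborel] emeasure_lborel_cball_finite[of "0::complex" R] by auto
      ultimately show "F ` dyadic_disc e j \<in> fmeasurable lborel" by (simp add: fmeasurable_def)
    qed
  qed (use K in simp)
  finally have "(?s * cmod (deriv H (of_real \<rho> * e)))\<^sup>2 \<le> 2 * K * ?m" by simp
  then have "?s * cmod (deriv H (of_real \<rho> * e)) \<le> sqrt (2 * K * ?m)"
    by (rule real_le_rsqrt)
  then have "8 * 2 ^ j * (?s * cmod (deriv H (of_real \<rho> * e))) \<le> 8 * 2 ^ j * sqrt (2 * K * ?m)"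
    by (rule mult_left_mono) simp
  then show ?thesis by (simp add: power_divide)
qed

text \<open>The integrand is at most 2 |H'| and the j-th segment has length (1/2)^(j+1), so it
  contributes at most 8 sqrt (2 K) times the root of the j-th area. Cauchy-Schwarz with total area
  at most 2 \<pi> R^2 turns the factor into 8 sqrt (2 K) sqrt (2 \<pi>) = 16 sqrt (\<pi> K).\<close>

lemma radial_integral_bound:
  assumes F0: "F 0 = 0" and r: "1 / 2 \<le> r" "r < 1"
    and M: "\<And>\<rho>. \<rho> \<in> {0..r} \<Longrightarrow> cmod (F (of_real \<rho> * cis \<theta>)) \<le> M"
  shows "integral {1/2..r} (\<lambda>\<rho>. cmod (deriv H (of_real \<rho> * cis \<theta>) + cis (- 2 * \<theta>) * cnj (deriv G (of_real \<rho> * cis \<theta>))))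
    \<le> 16 * sqrt (pi * K) * harnack_const K (3/4) * M * sqrt (ln (1 / (1 - r)) / ln 2)"
proof -
  let ?e = "cis \<theta>"
  define q where "q \<rho> = cmod (deriv H (of_real \<rho> * ?e) + cis (- 2 * \<theta>) * cnj (deriv G (of_real \<rho> * ?e)))" for \<rho>
  define m where "m j = measure lborel (F ` dyadic_disc ?e j)" for j
  have e: "cmod ?e = 1" by simp
  have contq: "continuous_on {a..b} q" if "0 \<le> a" "b < 1" for a b
  proof -
    have c: "continuous_on {a..b} (\<lambda>\<rho>. deriv u (of_real \<rho> * ?e))" if u: "u holomorphic_on ball 0 1" for u
    proof (rule continuous_on_compose2[OF holomorphic_on_imp_continuous_on[OF holomorphic_deriv[OF u open_ball]]])
      show "continuous_on {a..b} (\<lambda>\<rho>. of_real \<rho> * ?e)" by (intro continuous_intros)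
      show "(\<lambda>\<rho>. of_real \<rho> * ?e) ` {a..b} \<subseteq> ball 0 1"
        using \<open>0 \<le> a\<close> \<open>b < 1\<close> by (auto simp: norm_mult)
    qed
    show ?thesis unfolding q_def[abs_def] by (intro continuous_intros c H G)
  qed
  have q_le: "q \<rho> \<le> 2 * cmod (deriv H (of_real \<rho> * ?e))" if "0 \<le> \<rho>" "\<rho> < 1" for \<rho>
  proof -
    have "q \<rho> \<le> cmod (deriv H (of_real \<rho> * ?e)) + cmod (deriv G (of_real \<rho> * ?e))"
      unfolding q_def by (rule order_trans[OF norm_triangle_ineq]) (simp add: norm_mult)
    also have "cmod (deriv G (of_real \<rho> * ?e)) \<le> cmod (deriv H (of_real \<rho> * ?e))"
      by (rule deriv_le) (use that in \<open>simp add: norm_mult\<close>)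
    finally show ?thesis by simp
  qed
  \<comment> \<open>n is the index of the segment that contains r. Then 1 - (1/2)^j \<le> r for all
    j \<le> n, so M bounds |F| at every base point of the Harnack estimate; r \<ge> 1/2 ensures n
    \<ge> 1.\<close>
  obtain n where n: "1 - (1 / 2) ^ n \<le> r" "r < 1 - (1 / 2) ^ Suc n" "n \<ge> 1"
  proof -
    define N where "N = (LEAST n. r < 1 - (1 / 2 :: real) ^ n)"
    obtain k where "(1 / 2 :: real) ^ k < 1 - r"
      using real_arch_pow_inv[of "1 - r" "1 / 2"] r by auto
    then have "r < 1 - (1 / 2) ^ k" by simp
    then have N: "r < 1 - (1 / 2) ^ N" unfolding N_def by (rule LeastI)
    have min: "\<not> r < 1 - (1 / 2) ^ k" if "k < N" for k
      using that unfolding N_def by (rule not_less_Least)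
    have "N \<noteq> 0"
    proof
      assume "N = 0"
      with N r show False by simp
    qed
    moreover have "N \<noteq> 1"
    proof
      assume "N = 1"
      with N r show False by simp
    qed
    ultimately
    obtain n where "N = Suc n" "n \<ge> 1" by (cases N) auto
    then show thesis using that[of n] N min[of n] by simp
  qed
  have M0: "M \<ge> 0" using M[of 0] r by (intro order_trans[OF norm_ge_zero]) auto
  define R where "R = harnack_const K (3/4) * M"
  have R0: "R \<ge> 0" using M0 by (simp add: R_def harnack_const_def)
  have sub: "F ` dyadic_disc ?e j \<subseteq> cball 0 R" if "j \<in> {1..n}" for j
  proof -
    have "(1 / 2 :: real) ^ n \<le> (1 / 2) ^ j" using that by (intro power_decreasing) auto
    then have "1 - (1 / 2) ^ j \<le> r" using n by linarith
    moreover have "(1 / 2 :: real) ^ j \<le> 1" by (rule power_le_one) auto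
    ultimately have le: "cmod (F (of_real (1 - (1 / 2) ^ j) * ?e)) \<le> M" by (intro M) auto
    have "cmod (F z) \<le> R" if "z \<in> dyadic_disc ?e j" for z
    proof -
      have "cmod (F z) \<le> harnack_const K (3/4) * cmod (F (of_real (1 - (1 / 2) ^ j) * ?e))"
        by (rule dyadic_disc_harnack[OF e _ F0 that]) (use \<open>j \<in> {1..n}\<close> in simp)
      also have "\<dots> \<le> R"
        unfolding R_def by (rule mult_left_mono[OF le]) (simp add: harnack_const_def)
      finally show ?thesis .
    qed
    then show ?thesis by auto
  qed
  have piece: "integral {1 - (1 / 2) ^ j..1 - (1 / 2) ^ Suc j} q \<le> 8 * sqrt (2 * K) * sqrt (m j)" if j: "j \<in> {1..n}" for j
  proof -
    have p: "(1 / 2 :: real) ^ Suc j \<le> (1 / 2) ^ j" "(1 / 2 :: real) ^ j \<le> 1" "(1 / 2 :: real) ^ Suc j > 0"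
      by (auto intro!: power_decreasing power_le_one)
    have "integral {1 - (1 / 2) ^ j..1 - (1 / 2) ^ Suc j} q
      \<le> integral {1 - (1 / 2) ^ j..1 - (1 / 2) ^ Suc j} (\<lambda>_::real. 16 * 2 ^ j * sqrt (2 * K * m j))"
    proof (rule integral_le)
      show "q integrable_on {1 - (1 / 2) ^ j..1 - (1 / 2) ^ Suc j}"
        by (rule integrable_continuous_interval[OF contq]) (use p in auto)
      fix \<rho> :: real assume \<rho>: "\<rho> \<in> {1 - (1 / 2) ^ j..1 - (1 / 2) ^ Suc j}"
      have "q \<rho> \<le> 2 * cmod (deriv H (of_real \<rho> * ?e))"
        using \<rho> p unfolding atLeastAtMost_iff by (intro q_le; linarith)
      also have "cmod (deriv H (of_real \<rho> * ?e)) \<le> 8 * 2 ^ j * sqrt (2 * K * m j)"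
        unfolding m_def by (rule deriv_le_on_dyadic_interval[OF e _ sub[OF j]]) (use \<rho> j in auto)
      finally show "q \<rho> \<le> 16 * 2 ^ j * sqrt (2 * K * m j)" by simp
    qed auto
    also have "\<dots> = (1 / 2) ^ Suc j * (16 * 2 ^ j * sqrt (2 * K * m j))"
      using p by (simp add: algebra_simps)
    also have "\<dots> = 8 * sqrt (2 * K * m j)"
      by (simp add: power_divide)
    finally show ?thesis by (simp add: real_sqrt_mult)
  qed
  have sum_int: "k \<le> n \<Longrightarrow> integral {1/2..1 - (1 / 2) ^ Suc k} q \<le> (\<Sum>j=1..k. 8 * sqrt (2 * K) * sqrt (m j))" for k
  proof (induction k)
    case 0
    then show ?case by simp
  next
    case (Suc k)
    have p: "(1 / 2 :: real) ^ Suc (Suc k) \<le> (1 / 2) ^ Suc k" "(1 / 2 :: real) ^ Suc k \<le> (1 / 2) ^ 1" "(1 / 2 :: real) ^ Suc (Suc k) > 0"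
      by (intro power_decreasing; simp)+ simp
    have "integral {1/2..1 - (1 / 2) ^ Suc (Suc k)} q
        = integral {1/2..1 - (1 / 2) ^ Suc k} q + integral {1 - (1 / 2) ^ Suc k..1 - (1 / 2) ^ Suc (Suc k)} q"
      by (rule Henstock_Kurzweil_Integration.integral_combine[symmetric])
        (use p in \<open>auto intro!: integrable_continuous_interval contq simp del: power_Suc\<close>)
    also have "\<dots> \<le> (\<Sum>j=1..k. 8 * sqrt (2 * K) * sqrt (m j)) + 8 * sqrt (2 * K) * sqrt (m (Suc k))"
      by (intro add_mono piece Suc.IH) (use Suc.prems in auto)
    finally show ?case by simp
  qed
  \<comment> \<open>The integrand is nonnegative, so the last segment may be completed beyond
    r.\<close>
  have "integral {1/2..r} q \<le> integral {1/2..1 - (1 / 2) ^ Suc n} q"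
    by (rule integral_subset_le)
      (use n r in \<open>auto intro!: integrable_continuous_interval contq simp: q_def simp del: power_Suc\<close>)
  also have "\<dots> \<le> (\<Sum>j=1..n. 8 * sqrt (2 * K) * sqrt (m j))" by (rule sum_int) simp
  also have "\<dots> = 8 * sqrt (2 * K) * (\<Sum>j=1..n. 1 * sqrt (m j))"
    by (simp add: sum_distrib_left)
  also have "\<dots> \<le> 8 * sqrt (2 * K) * sqrt (real n * (2 * pi * R\<^sup>2))"
  proof (rule mult_left_mono)
    have "(\<Sum>j=1..n. 1 * sqrt (m j))\<^sup>2 \<le> (\<Sum>j=1..n. 1\<^sup>2) * (\<Sum>j=1..n. (sqrt (m j))\<^sup>2)"
      by (rule Cauchy_Schwarz_ineq_sum)
    also have "\<dots> = real n * (\<Sum>j=1..n. m j)" by (simp add: m_def)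
    also have "\<dots> \<le> real n * (2 * pi * R\<^sup>2)"
      unfolding m_def by (intro mult_left_mono sum_area_dyadic_le' e sub R0) auto
    finally show "(\<Sum>j=1..n. 1 * sqrt (m j)) \<le> sqrt (real n * (2 * pi * R\<^sup>2))" by (rule real_le_rsqrt)
  qed (use K in simp)
  also have "\<dots> \<le> 8 * sqrt (2 * K) * sqrt (ln (1 / (1 - r)) / ln 2 * (2 * pi * R\<^sup>2))"
  proof (intro mult_left_mono real_sqrt_le_mono mult_right_mono)
    have "2 ^ n \<le> 1 / (1 - r)" using n(1) r by (simp add: power_divide field_simps)
    then have "ln (2 ^ n) \<le> ln (1 / (1 - r))" using r by (subst ln_le_cancel_iff) auto
    then show "real n \<le> ln (1 / (1 - r)) / ln 2" by (simp add: ln_realpow le_divide_eq)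
  qed (use K in auto)
  also have "\<dots> = 16 * sqrt (pi * K) * R * sqrt (ln (1 / (1 - r)) / ln 2)"
    using R0 by (simp add: real_sqrt_mult real_sqrt_divide)
  finally show ?thesis unfolding q_def R_def by (simp only: mult.assoc)
qed

end

subsection \<open>A bounded univalent spiral\<close>

text \<open>The Noshiro-Warschawski criterion: along the segment from z to w the real part of f / (w
  - z) has derivative Re f' > 0 and so increases strictly.\<close>

lemma inj_on_convex_Re_deriv_pos:
  assumes S: "convex S" "open S" and f: "\<And>z. z \<in> S \<Longrightarrow> (f has_field_derivative f' z) (at z)"
    and pos: "\<And>z. z \<in> S \<Longrightarrow> Re (f' z) > 0"
  shows "inj_on f S"
proof (rule inj_onI, rule ccontr)
  fix z w assume zw: "z \<in> S" "w \<in> S" "f z = f w" "z \<noteq> w"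
  define \<gamma> where "\<gamma> t = z + of_real t * (w - z)" for t :: real
  have \<gamma>S: "\<gamma> t \<in> S" if "0 \<le> t" "t \<le> 1" for t
  proof -
    have "\<gamma> t = (1 - t) *\<^sub>R z + t *\<^sub>R w" by (simp add: \<gamma>_def scaleR_conv_of_real algebra_simps)
    then show ?thesis using convexD_alt[OF S(1) zw(1,2)] that by simp
  qed
  define g where "g t = Re (f (\<gamma> t) / (w - z))" for t
  have "\<exists>y. (g has_real_derivative y) (at t) \<and> y > 0" if "0 \<le> t" "t \<le> 1" for t
  proof -
    have "(\<gamma> has_vector_derivative (w - z)) (at t)"
      unfolding \<gamma>_def[abs_def] by (auto intro!: derivative_eq_intros simp: has_vector_derivative_def scaleR_conv_of_real)
    from field_vector_diff_chain_at[OF this f[OF \<gamma>S[OF that]]]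
    have "((\<lambda>t. f (\<gamma> t)) has_vector_derivative (w - z) * f' (\<gamma> t)) (at t)" by (simp add: o_def)
    then have "((\<lambda>t. f (\<gamma> t) / (w - z)) has_vector_derivative (w - z) * f' (\<gamma> t) / (w - z)) (at t)"
      by (rule has_vector_derivative_divide)
    then have "((\<lambda>t. f (\<gamma> t) / (w - z)) has_vector_derivative f' (\<gamma> t)) (at t)"
      using zw(4) by simp
    then have "(g has_real_derivative Re (f' (\<gamma> t))) (at t)"
      unfolding g_def[abs_def] has_real_derivative_iff_has_vector_derivative
      by (rule bounded_linear.has_vector_derivative[OF bounded_linear_Re])
    then show ?thesis using pos[OF \<gamma>S[OF that]] by blast
  qed
  then have "g 0 < g 1" by (rule DERIV_pos_imp_increasing[OF zero_less_one])
  then show False using zw(3) by (simp add: g_def \<gamma>_def)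
qed

text \<open>By the mean value theorem; the derivative of a negative power decreases in absolute
  value, so its value at the right endpoint is the lower bound.\<close>

lemma powr_diff_ge:
  fixes \<sigma> h \<gamma> :: real
  assumes "\<sigma> > 0" "h \<ge> 0" "\<gamma> > 0"
  shows "\<sigma> powr - \<gamma> - (\<sigma> + h) powr - \<gamma> \<ge> h * \<gamma> * (\<sigma> + h) powr (- \<gamma> - 1)"
proof (cases "h = 0")
  case False
  then have h: "h > 0" using assms by simp
  have "\<exists>z>\<sigma>. z < \<sigma> + h \<and> (\<sigma> + h) powr - \<gamma> - \<sigma> powr - \<gamma> = (\<sigma> + h - \<sigma>) * (- \<gamma> * z powr (- \<gamma> - 1))"
    by (rule MVT2) (use assms h in \<open>auto intro!: derivative_eq_intros simp: powr_diff field_simps\<close>)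
  then obtain z where z: "z > \<sigma>" "z < \<sigma> + h" "(\<sigma> + h) powr - \<gamma> - \<sigma> powr - \<gamma> = h * (- \<gamma> * z powr (- \<gamma> - 1))"
    by auto
  have "(\<sigma> + h) powr (- \<gamma> - 1) \<le> z powr (- \<gamma> - 1)"
    using z assms by (intro powr_mono2') auto
  then have "h * \<gamma> * (\<sigma> + h) powr (- \<gamma> - 1) \<le> h * \<gamma> * z powr (- \<gamma> - 1)"
    using assms by (intro mult_left_mono) auto
  then show ?thesis using z(3) by simp
qed simp

text \<open>The value of \<open>c\<close> makes the gap between consecutive turns larger than the width of the channel;
  \<open>X\<close> is large enough for the errors of the linear approximations to be absorbed.\<close>

locale spiral =
  fixes \<beta> c X :: real
  assumes \<beta>: "0 < \<beta>" "\<beta> < 1 / 2" and c: "c > 0" and X: "X \<ge> 8"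
    and cX: "c * (1 - 2 * \<beta>) * X powr (\<beta> - 1) \<le> \<beta> / 2"
    and X\<beta>: "X powr \<beta> \<ge> 4"
    and c\<beta>: "c * ((1 - 2 * \<beta>) / \<beta>) * 2 powr (- ((1 - 2 * \<beta>) / \<beta>) - 1) = 2 * \<beta>"
begin

definition "\<delta> = 1 - 2 * \<beta>"
text \<open>Written in terms of the angle \<sigma> = x powr \<beta>, the logarithm of the modulus is
  c \<sigma> powr (- \<gamma>).\<close>

definition "\<gamma> = \<delta> / \<beta>"

lemma \<delta>: "0 < \<delta>" "\<delta> < 1" using \<beta> by (auto simp: \<delta>_def)
lemma \<gamma>: "0 < \<gamma>" using \<beta> \<delta> by (auto simp: \<gamma>_def)
lemma c_\<delta>: "c * \<delta> * X powr (\<beta> - 1) \<le> \<beta> / 2" using cX by (simp add: \<delta>_def)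
lemma c_\<gamma>: "c * \<gamma> * 2 powr (- \<gamma> - 1) = 2 * \<beta>" using c\<beta> by (simp add: \<delta>_def \<gamma>_def)

definition Om :: "complex set" where "Om = {q. X < Re q \<and> \<bar>Im q\<bar> < pi / 2}"
text \<open>On the positive axis the imaginary part x powr \<beta> is the angle of the spiral, the
  real part c x powr (- \<delta>) the logarithm of its modulus, which decreases to 0.\<close>

definition Lam :: "complex \<Rightarrow> complex" where
  "Lam q = \<i> * q powr of_real \<beta> + of_real c * q powr of_real (- \<delta>)"
definition Lam' :: "complex \<Rightarrow> complex" where
  "Lam' q = \<i> * (of_real \<beta> * q powr of_real (\<beta> - 1)) - of_real (c * \<delta>) * q powr of_real (- \<delta> - 1)"

lemma Om_eq: "Om = {q. X < Re q} \<inter> {q. Im q < pi / 2} \<inter> {q. - (pi / 2) < Im q}"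
  by (auto simp: Om_def)

lemma open_Om: "open Om"
  unfolding Om_eq by (intro open_Int open_halfspace_Re_gt open_halfspace_Im_lt open_halfspace_Im_gt)

lemma convex_Om: "convex Om"
  unfolding Om_eq by (intro convex_Int convex_halfspace_Re_gt convex_halfspace_Im_lt convex_halfspace_Im_gt)

lemma Om_pos: "q \<in> Om \<Longrightarrow> Re q > 8"
  using X by (auto simp: Om_def)

lemma has_derivative_powr_right_half:
  assumes "Re q > 0"
  shows "((\<lambda>q. q powr of_real a) has_field_derivative of_real a * q powr of_real (a - 1)) (at q)"
  using has_field_derivative_powr[of q "of_real a"] assms by (auto simp: complex_nonpos_Reals_iff)

lemma has_derivative_Lam:
  assumes "q \<in> Om"
  shows "(Lam has_field_derivative Lam' q) (at q)"
proof -
  have d: "((\<lambda>q. q powr of_real a) has_field_derivative of_real a * q powr of_real (a - 1)) (at q)" for a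
    by (rule has_derivative_powr_right_half) (use Om_pos[OF assms] in simp)
  show ?thesis
    unfolding Lam_def[abs_def] Lam'_def
    by (rule DERIV_cong[OF DERIV_add[OF DERIV_cmult[OF d[of \<beta>]] DERIV_cmult[OF d[of "- \<delta>"]]]])
      (simp add: algebra_simps)
qed

text \<open>The vertical segment from the real axis to q has length at most \<pi>/2 and constant
  real part, and a \<le> 1 makes the derivative of the power largest where the modulus is smallest,
  on the axis.\<close>

lemma powr_near_real:
  assumes q: "q \<in> Om" and a: "a \<le> 1"
  shows "cmod (q powr of_real a - of_real (Re q powr a)) \<le> \<bar>a\<bar> * Re q powr (a - 1) * (pi / 2)"
proof -
  let ?x = "Re q"
  have x: "?x > 8" by (rule Om_pos[OF q])
  let ?S = "closed_segment (of_real ?x) q"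
  have S: "Re w = ?x" if "w \<in> ?S" for w
  proof -
    obtain u where "w = (1 - u) *\<^sub>R of_real ?x + u *\<^sub>R q" using \<open>w \<in> ?S\<close> by (auto simp: in_segment)
    then have "Re w = (1 - u) * ?x + u * ?x" by simp
    then show ?thesis by (simp add: left_diff_distrib)
  qed
  have "cmod (q powr of_real a - of_real ?x powr of_real a) \<le> (\<bar>a\<bar> * ?x powr (a - 1)) * cmod (q - of_real ?x)"
  proof (rule field_differentiable_bound[of ?S])
    fix w assume w: "w \<in> ?S"
    show "((\<lambda>q. q powr of_real a) has_field_derivative of_real a * w powr of_real (a - 1)) (at w within ?S)"
      by (rule has_field_derivative_at_within[OF has_derivative_powr_right_half]) (use S[OF w] x in simp)
    have "?x \<le> cmod w" using complex_Re_le_cmod[of w] S[OF w] by simp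
    then have "cmod w powr (a - 1) \<le> ?x powr (a - 1)"
      using x a by (intro powr_mono2') auto
    then show "cmod (of_real a * w powr of_real (a - 1)) \<le> \<bar>a\<bar> * ?x powr (a - 1)"
      by (simp add: norm_mult norm_powr_real_powr' mult_left_mono)
  qed auto
  moreover have "of_real ?x powr (of_real a :: complex) = of_real (?x powr a)"
    using x by (simp add: powr_of_real)
  moreover have "cmod (q - of_real ?x) \<le> pi / 2"
  proof -
    have "q - of_real ?x = \<i> * of_real (Im q)" by (simp add: complex_eq_iff)
    then have "cmod (q - of_real ?x) = \<bar>Im q\<bar>" by (simp add: norm_mult)
    then show ?thesis using q by (simp add: Om_def)
  qed
  ultimately have main: "cmod (q powr of_real a - of_real (?x powr a)) \<le> (\<bar>a\<bar> * ?x powr (a - 1)) * cmod (q - of_real ?x)"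
    and le: "cmod (q - of_real ?x) \<le> pi / 2" by simp_all
  show ?thesis by (rule order_trans[OF main mult_left_mono[OF le]]) simp
qed

text \<open>Since - \<delta> - 1 = 2 (\<beta> - 1), the derivative of the radial term is of the
  order of the square of x powr (\<beta> - 1), the size of the angular one. One factor is made small
  by the choice of X.\<close>

lemma c_\<delta>_powr: "x \<ge> X \<Longrightarrow> c * \<delta> * x powr (- \<delta> - 1) \<le> \<beta> / 2 * x powr (\<beta> - 1)"
proof -
  assume x: "x \<ge> X"
  have "x powr (- \<delta> - 1) = x powr (\<beta> - 1) * x powr (\<beta> - 1)"
    by (simp add: \<delta>_def flip: powr_add)
  moreover have "c * \<delta> * x powr (\<beta> - 1) \<le> \<beta> / 2"
  proof -
    have "x powr (\<beta> - 1) \<le> X powr (\<beta> - 1)" using x X \<beta> by (intro powr_mono2') auto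
    then have "c * \<delta> * x powr (\<beta> - 1) \<le> c * \<delta> * X powr (\<beta> - 1)" using c \<delta> by (intro mult_left_mono) auto
    then show ?thesis using c_\<delta> by linarith
  qed
  then have "c * \<delta> * x powr (\<beta> - 1) * x powr (\<beta> - 1) \<le> \<beta> / 2 * x powr (\<beta> - 1)" by (rule mult_right_mono) simp
  ultimately show ?thesis by (simp add: mult.assoc)
qed

text \<open>In units of \<beta> x powr (\<beta> - 1) the main term is 1. Leaving the real axis costs
  at most 1/4 because x > 8, and the radial term costs at most 1/2.\<close>

lemma Lam'_pos:
  assumes q: "q \<in> Om"
  shows "Re (Lam' q / \<i>) > 0"
proof -
  let ?x = "Re q" let ?p = "?x powr (\<beta> - 1)"
  have x: "?x > X" "?x > 8" using q Om_pos by (auto simp: Om_def)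
  have p: "?p > 0" using x by simp
  have "cmod (q powr of_real (\<beta> - 1) - of_real ?p) \<le> \<bar>\<beta> - 1\<bar> * ?x powr (\<beta> - 1 - 1) * (pi / 2)"
    by (rule powr_near_real[OF q]) (use \<beta> in simp)
  also have "\<dots> = (1 - \<beta>) * (pi / 2) / ?x * ?p"
  proof -
    have "?x powr (\<beta> - 1 - 1) = ?p / ?x" using x powr_diff[of ?x "\<beta> - 1" 1] by simp
    then show ?thesis using \<beta> by (simp add: mult_ac)
  qed
  also have "\<dots> \<le> 1 / 4 * ?p"
  proof (rule mult_right_mono)
    have "(1 - \<beta>) * (pi / 2) \<le> 1 * 2" using \<beta> pi_less_4 by (intro mult_mono) auto
    then show "(1 - \<beta>) * (pi / 2) / ?x \<le> 1 / 4" using x by (subst pos_divide_le_eq) linarith+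
  qed (use p in simp)
  finally have d: "cmod (q powr of_real (\<beta> - 1) - of_real ?p) \<le> 1 / 4 * ?p" .
  have "?p - Re (q powr of_real (\<beta> - 1)) \<le> cmod (q powr of_real (\<beta> - 1) - of_real ?p)"
    using complex_Re_le_cmod[of "of_real ?p - q powr of_real (\<beta> - 1)"] by (simp add: norm_minus_commute)
  then have r1: "Re (q powr of_real (\<beta> - 1)) \<ge> 3 / 4 * ?p" using d by linarith
  have r2: "c * \<delta> * cmod (q powr of_real (- \<delta> - 1)) \<le> \<beta> / 2 * ?p"
  proof -
    have "cmod (q powr of_real (- \<delta> - 1)) = cmod q powr (- \<delta> - 1)" by (simp add: norm_powr_real_powr')
    also have "\<dots> \<le> ?x powr (- \<delta> - 1)"
      using x complex_Re_le_cmod[of q] \<delta> by (intro powr_mono2') auto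
    finally have "c * \<delta> * cmod (q powr of_real (- \<delta> - 1)) \<le> c * \<delta> * ?x powr (- \<delta> - 1)"
      using c \<delta> by (intro mult_left_mono) auto
    then show ?thesis using c_\<delta>_powr[of ?x] x by simp
  qed
  have "Lam' q / \<i> = of_real \<beta> * q powr of_real (\<beta> - 1) + of_real (c * \<delta>) * (\<i> * q powr of_real (- \<delta> - 1))"
    by (simp add: Lam'_def field_simps)
  then have "Re (Lam' q / \<i>) = \<beta> * Re (q powr of_real (\<beta> - 1)) - c * \<delta> * Im (q powr of_real (- \<delta> - 1))"
    by simp
  moreover have "c * \<delta> * Im (q powr of_real (- \<delta> - 1)) \<le> c * \<delta> * cmod (q powr of_real (- \<delta> - 1))"
    using c \<delta> by (intro mult_left_mono order_trans[OF abs_ge_self abs_Im_le_cmod]) auto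
  moreover have "\<beta> * (3 / 4 * ?p) \<le> \<beta> * Re (q powr of_real (\<beta> - 1))"
    using r1 \<beta> by (intro mult_left_mono) auto
  moreover have "\<beta> * ?p > 0" using \<beta> p by simp
  ultimately show ?thesis using r2 by linarith
qed

lemma inj_Lam: "inj_on Lam Om"
proof -
  have "inj_on (\<lambda>q. Lam q / \<i>) Om"
    by (rule inj_on_convex_Re_deriv_pos[OF convex_Om open_Om DERIV_cdivide[OF has_derivative_Lam] Lam'_pos])
  then show ?thesis by (simp add: inj_on_def)
qed

lemma Lam_approx:
  assumes q: "q \<in> Om"
  shows "cmod (Lam q - (\<i> * of_real (Re q powr \<beta>) + of_real (c * Re q powr - \<delta>))) \<le> 3 / 2 * \<beta> * (pi / 2) * Re q powr (\<beta> - 1)"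
proof -
  let ?x = "Re q"
  have x: "?x > X" "?x > 8" using q Om_pos by (auto simp: Om_def)
  have "Lam q - (\<i> * of_real (?x powr \<beta>) + of_real (c * ?x powr - \<delta>))
      = \<i> * (q powr of_real \<beta> - of_real (?x powr \<beta>)) + of_real c * (q powr of_real (- \<delta>) - of_real (?x powr - \<delta>))"
    by (simp add: Lam_def algebra_simps)
  then have "cmod (Lam q - (\<i> * of_real (?x powr \<beta>) + of_real (c * ?x powr - \<delta>)))
      \<le> cmod (q powr of_real \<beta> - of_real (?x powr \<beta>)) + c * cmod (q powr of_real (- \<delta>) - of_real (?x powr - \<delta>))"
    using c by (simp only:) (rule order_trans[OF norm_triangle_ineq], simp add: norm_mult)
  also have "\<dots> \<le> \<bar>\<beta>\<bar> * ?x powr (\<beta> - 1) * (pi / 2) + c * (\<bar>- \<delta>\<bar> * ?x powr (- \<delta> - 1) * (pi / 2))"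
    using c \<beta> \<delta> by (intro add_mono mult_left_mono powr_near_real q) auto
  also have "\<dots> = \<beta> * ?x powr (\<beta> - 1) * (pi / 2) + (c * \<delta> * ?x powr (- \<delta> - 1)) * (pi / 2)"
    using \<beta> \<delta> by simp
  also have "\<dots> \<le> \<beta> * ?x powr (\<beta> - 1) * (pi / 2) + (\<beta> / 2 * ?x powr (\<beta> - 1)) * (pi / 2)"
    using x by (intro add_left_mono mult_right_mono c_\<delta>_powr) auto
  finally show ?thesis by (simp add: algebra_simps)
qed

text \<open>Neighbouring turns do not meet. Each error of \<open>Lam_approx\<close> is at most 3/8
  \<pi>, so comparing imaginary parts shows that the angles x powr \<beta> differ by at least \<pi>.
  Then the real parts of the main terms differ by at least 2 \<beta> \<pi> x2 powr (\<beta> - 1),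
  where x2 is the smaller real part; this is what the equation for c achieves. The errors, half the
  channel width from each side, amount to at most 3/2 \<beta> \<pi> x2 powr (\<beta> - 1).\<close>

lemma Lam_no_period:
  assumes q: "q1 \<in> Om" "q2 \<in> Om" and m: "m \<ge> 1" and eq: "Lam q1 - Lam q2 = of_real (2 * pi * m) * \<i>"
  shows False
proof -
  let ?x1 = "Re q1" and ?x2 = "Re q2"
  have x: "?x1 > X" "?x2 > X" using q by (auto simp: Om_def)
  have pos: "?x1 > 0" "?x2 > 0" using x X by auto
  let ?E1 = "3 / 2 * \<beta> * (pi / 2) * ?x1 powr (\<beta> - 1)" and ?E2 = "3 / 2 * \<beta> * (pi / 2) * ?x2 powr (\<beta> - 1)"
  define e1 where "e1 = Lam q1 - (\<i> * of_real (?x1 powr \<beta>) + of_real (c * ?x1 powr - \<delta>))"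
  define e2 where "e2 = Lam q2 - (\<i> * of_real (?x2 powr \<beta>) + of_real (c * ?x2 powr - \<delta>))"
  have e: "cmod e1 \<le> ?E1" "cmod e2 \<le> ?E2"
    unfolding e1_def e2_def by (rule Lam_approx[OF q(1)], rule Lam_approx[OF q(2)])
  have R: "\<bar>Re e1\<bar> \<le> ?E1" "\<bar>Re e2\<bar> \<le> ?E2" "\<bar>Im e1\<bar> \<le> ?E1" "\<bar>Im e2\<bar> \<le> ?E2"
    using e abs_Re_le_cmod[of e1] abs_Re_le_cmod[of e2] abs_Im_le_cmod[of e1] abs_Im_le_cmod[of e2] by linarith+
  have Es: "3 / 2 * \<beta> * (pi / 2) * x powr (\<beta> - 1) \<le> 3 / 8 * pi" if "x > X" for x
  proof -
    have "x powr (\<beta> - 1) \<le> 1 powr (\<beta> - 1)" using that X \<beta> by (intro powr_mono2') auto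
    then have "3 / 2 * \<beta> * (pi / 2) * x powr (\<beta> - 1) \<le> 3 / 2 * (1 / 2) * (pi / 2) * 1"
      using \<beta> by (intro mult_mono) auto
    then show ?thesis by simp
  qed
  have im: "Im (Lam q1 - Lam q2) = (?x1 powr \<beta> + Im e1) - (?x2 powr \<beta> + Im e2)"
    by (simp add: e1_def e2_def)
  have "2 * pi * 1 \<le> 2 * pi * m" using m by (intro mult_left_mono) auto
  then have ge: "?x1 powr \<beta> \<ge> ?x2 powr \<beta> + pi"
  proof -
    have "2 * pi * m = (?x1 powr \<beta> + Im e1) - (?x2 powr \<beta> + Im e2)" using im unfolding eq by simp
    then show ?thesis using \<open>2 * pi * 1 \<le> 2 * pi * m\<close> R(3,4) Es[OF x(1)] Es[OF x(2)] by linarith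
  qed
  have x12: "?x2 \<le> ?x1"
  proof (rule ccontr)
    assume "\<not> ?x2 \<le> ?x1"
    then have "?x1 powr \<beta> \<le> ?x2 powr \<beta>" using pos \<beta> by (intro powr_mono2) auto
    then show False using ge pi_gt_zero by linarith
  qed
  then have "?x1 powr (\<beta> - 1) \<le> ?x2 powr (\<beta> - 1)" using pos \<beta> by (intro powr_mono2') auto
  then have E12: "?E1 \<le> ?E2" using \<beta> by (intro mult_left_mono) auto
  have re: "Re (Lam q1 - Lam q2) = (c * ?x1 powr - \<delta> + Re e1) - (c * ?x2 powr - \<delta> + Re e2)"
    by (simp add: e1_def e2_def)
  then have up: "c * (?x2 powr - \<delta> - ?x1 powr - \<delta>) \<le> 3 / 2 * \<beta> * pi * ?x2 powr (\<beta> - 1)"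
  proof -
    have "c * (?x2 powr - \<delta> - ?x1 powr - \<delta>) = Re e1 - Re e2"
      using re unfolding eq by (simp add: algebra_simps)
    then show ?thesis using R(1,2) E12 by linarith
  qed
  define \<sigma> where "\<sigma> = ?x2 powr \<beta>"
  \<comment> \<open>This allows \<sigma> + \<pi> \<le> 2 \<sigma>, so that the lower bound becomes a
    pure power of x2, of the same order as the errors.\<close>
  have \<sigma>: "\<sigma> \<ge> pi" 
  proof -
    have "X powr \<beta> \<le> \<sigma>" unfolding \<sigma>_def using x X \<beta> by (intro powr_mono2) auto
    then show ?thesis using X\<beta> pi_less_4 by linarith
  qed
  have \<beta>\<gamma>: "\<beta> * \<gamma> = \<delta>" using \<beta> by (simp add: \<gamma>_def)
  have p2: "?x2 powr - \<delta> = \<sigma> powr - \<gamma>" and p1: "?x1 powr - \<delta> = (?x1 powr \<beta>) powr - \<gamma>"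
    using \<beta>\<gamma> by (simp_all add: \<sigma>_def powr_powr)
  have "(?x1 powr \<beta>) powr - \<gamma> \<le> (\<sigma> + pi) powr - \<gamma>"
    using ge \<gamma> \<sigma> pi_gt_zero unfolding \<sigma>_def by (intro powr_mono2'; linarith)
  then have "?x2 powr - \<delta> - ?x1 powr - \<delta> \<ge> \<sigma> powr - \<gamma> - (\<sigma> + pi) powr - \<gamma>"
    unfolding p1 p2 by simp
  also have "\<sigma> powr - \<gamma> - (\<sigma> + pi) powr - \<gamma> \<ge> pi * \<gamma> * (\<sigma> + pi) powr (- \<gamma> - 1)"
    using \<sigma> pi_gt_zero \<gamma> by (intro powr_diff_ge) linarith+
  also have "pi * \<gamma> * (\<sigma> + pi) powr (- \<gamma> - 1) \<ge> pi * \<gamma> * (2 * \<sigma>) powr (- \<gamma> - 1)"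
  proof -
    have "0 < \<sigma> + pi" using \<sigma> pi_gt_zero by linarith
    then show ?thesis using \<sigma> \<gamma> by (intro mult_left_mono powr_mono2') auto
  qed
  finally have f1: "c * (pi * \<gamma> * (2 * \<sigma>) powr (- \<gamma> - 1)) \<le> c * (?x2 powr - \<delta> - ?x1 powr - \<delta>)"
    using c by (intro mult_left_mono) auto
  have f2: "(2 * \<sigma>) powr (- \<gamma> - 1) = 2 powr (- \<gamma> - 1) * ?x2 powr (\<beta> - 1)"
  proof -
    have "\<beta> * (- \<gamma> - 1) = \<beta> - 1" using \<beta>\<gamma> by (simp add: algebra_simps \<delta>_def)
    then show ?thesis using \<sigma> pi_gt_zero by (simp add: powr_mult \<sigma>_def powr_powr)
  qed
  have f3: "c * (pi * \<gamma> * (2 powr (- \<gamma> - 1) * ?x2 powr (\<beta> - 1))) = 2 * \<beta> * pi * ?x2 powr (\<beta> - 1)"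
    using c_\<gamma> by (simp add: algebra_simps)
  have "2 * \<beta> * pi * ?x2 powr (\<beta> - 1) \<le> 3 / 2 * \<beta> * pi * ?x2 powr (\<beta> - 1)"
    using order_trans[OF f1 up] unfolding f2 f3 .
  moreover have "\<beta> * pi * ?x2 powr (\<beta> - 1) > 0" using \<beta> pos by simp
  ultimately show False by linarith
qed

lemma inj_exp_Lam: "inj_on (\<lambda>q. exp (Lam q)) Om"
proof (rule inj_onI)
  fix q1 q2 assume q: "q1 \<in> Om" "q2 \<in> Om" "exp (Lam q1) = exp (Lam q2)"
  then obtain n :: int where n: "Lam q1 = Lam q2 + (of_int (2 * n) * pi) * \<i>"
    unfolding exp_eq by blast
  consider "n = 0" | "n \<ge> 1" | "n \<le> -1" by linarith
  then show "q1 = q2"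
  proof cases
    case 1
    then show ?thesis using n inj_Lam q by (simp add: inj_on_def)
  next
    case 2
    then show ?thesis using Lam_no_period[OF q(1,2), of "of_int n"] n by (simp add: algebra_simps)
  next
    case 3
    then show ?thesis using Lam_no_period[OF q(2,1), of "- of_int n"] n by (simp add: algebra_simps)
  qed
qed

end

section \<open>The spiral as a map of the unit disc\<close>

context spiral begin

text \<open>In the unit disc 1 - z has positive real part and modulus below 2. The first puts
  \<open>Q z\<close> into the strip of width \<pi>, and the summand ln 2 makes its real part exceed
  X. The boundary point 1 corresponds to the infinite end of the strip.\<close>

definition "L = X + ln 2"
definition "Q z = of_real L - Ln (1 - z)"
definition "spiral_map z = exp (Lam (Q z))"

lemma Q_in_Om:
  assumes "z \<in> ball 0 1"
  shows "Q z \<in> Om"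
proof -
  have z: "cmod z < 1" using assms by simp
  have nz: "1 - z \<noteq> 0" using z by auto
  have re: "Re (1 - z) > 0" using z complex_Re_le_cmod[of z] by simp
  have "cmod (1 - z) < 2" using norm_triangle_ineq4[of 1 z] z by simp
  then have "ln (cmod (1 - z)) < ln 2" using nz by (subst ln_less_cancel_iff) auto
  then have "Re (Q z) > X" using nz by (simp add: Q_def L_def)
  moreover have "\<bar>Im (Ln (1 - z))\<bar> < pi / 2" using Re_Ln_pos_lt[OF nz] re by blast
  ultimately show ?thesis by (simp add: Om_def Q_def)
qed

lemma has_derivative_spiral_map:
  assumes "z \<in> ball 0 1"
  shows "(spiral_map has_field_derivative spiral_map z * (Lam' (Q z) / (1 - z))) (at z)"
proof -
  have re: "Re (1 - z) > 0" using assms complex_Re_le_cmod[of z] by simp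
  have nR: "1 - z \<notin> \<real>\<^sub>\<le>\<^sub>0" using re complex_nonpos_Reals_iff by force
  have "(Q has_field_derivative 1 / (1 - z)) (at z)"
    unfolding Q_def[abs_def] using nR by (auto intro!: derivative_eq_intros simp: field_simps)
  from DERIV_chain2[OF has_derivative_Lam[OF Q_in_Om[OF assms]] this]
  have "((\<lambda>z. Lam (Q z)) has_field_derivative Lam' (Q z) * (1 / (1 - z))) (at z)" .
  from DERIV_chain2[OF DERIV_exp this]
  show ?thesis by (simp add: spiral_map_def[abs_def])
qed

lemma inj_spiral_map: "inj_on spiral_map (ball 0 1)"
proof (rule inj_onI)
  fix z w assume zw: "z \<in> ball 0 1" "w \<in> ball 0 1" "spiral_map z = spiral_map w"
  then have "Q z = Q w"
    using inj_onD[OF inj_exp_Lam _ Q_in_Om[OF zw(1)] Q_in_Om[OF zw(2)]] by (simp add: spiral_map_def)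
  then have "exp (Ln (1 - z)) = exp (Ln (1 - w))" by (simp add: Q_def)
  moreover have "1 - z \<noteq> 0" "1 - w \<noteq> 0" using zw by auto
  ultimately show "z = w" by simp
qed

lemma Q_real:
  assumes "0 \<le> \<rho>" "\<rho> < 1"
  shows "Q (of_real \<rho>) = of_real (L - ln (1 - \<rho>))"
proof -
  have "1 - of_real \<rho> = (of_real (1 - \<rho>) :: complex)" by simp
  then have "Ln (1 - of_real \<rho>) = of_real (ln (1 - \<rho>))" using assms Ln_of_real[of "1 - \<rho>"] by simp
  then show ?thesis by (simp add: Q_def)
qed

lemma Lam_real: "x > 0 \<Longrightarrow> Lam (of_real x) = \<i> * of_real (x powr \<beta>) + of_real (c * x powr - \<delta>)"
  by (simp add: Lam_def powr_of_real flip: of_real_minus)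

lemma Lam'_real: "x > 0 \<Longrightarrow> Lam' (of_real x) = \<i> * of_real (\<beta> * x powr (\<beta> - 1)) - of_real (c * \<delta> * x powr (- \<delta> - 1))"
  unfolding Lam'_def by (simp only: powr_of_real less_imp_le of_real_mult)

lemma L_pos: "L > 8"
proof -
  have "ln (2 :: real) > 0" by simp
  then show ?thesis using X unfolding L_def by linarith
qed

lemma L_ln_pos: "0 \<le> \<rho> \<Longrightarrow> \<rho> < 1 \<Longrightarrow> L - ln (1 - \<rho>) > 8"
  using L_pos ln_le_minus_one[of "1 - \<rho>"] by linarith

definition "D0 = spiral_map 0 * Lam' (of_real L)"
definition "spiral_fun z = (spiral_map z - spiral_map 0) / D0"

lemma Q_0: "Q 0 = of_real L"
  by (simp add: Q_def)

lemma Lam'_lower: "x > 0 \<Longrightarrow> cmod (Lam' (of_real x)) \<ge> \<beta> * x powr (\<beta> - 1)"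
  using abs_Im_le_cmod[of "Lam' (of_real x)"] \<beta> by (simp add: Lam'_real)

lemma D0_nz: "D0 \<noteq> 0"
proof -
  have "\<beta> * L powr (\<beta> - 1) > 0" using \<beta> L_pos by simp
  then have "Lam' (of_real L) \<noteq> 0" using Lam'_lower[of L] L_pos by auto
  then show ?thesis by (simp add: D0_def spiral_map_def)
qed

lemma has_derivative_spiral_fun:
  assumes "z \<in> ball 0 1"
  shows "(spiral_fun has_field_derivative spiral_map z * (Lam' (Q z) / (1 - z)) / D0) (at z)"
  unfolding spiral_fun_def[abs_def]
  using D0_nz has_derivative_spiral_map[OF assms] by (auto intro!: derivative_eq_intros)

lemma spiral_fun_holomorphic: "spiral_fun holomorphic_on ball 0 1"
  using has_derivative_spiral_fun holomorphic_on_open[OF open_ball] by blast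

lemma inj_spiral_fun: "inj_on spiral_fun (ball 0 1)"
  using inj_spiral_map D0_nz by (auto simp: inj_on_def spiral_fun_def)

lemma spiral_fun_0: "spiral_fun 0 = 0" "deriv spiral_fun 0 = 1"
proof -
  show "spiral_fun 0 = 0" by (simp add: spiral_fun_def)
  have "deriv spiral_fun 0 = spiral_map 0 * (Lam' (Q 0) / (1 - 0)) / D0"
    by (rule DERIV_imp_deriv[OF has_derivative_spiral_fun]) simp
  then show "deriv spiral_fun 0 = 1" using D0_nz by (simp add: Q_0 D0_def)
qed

lemma cmod_spiral_map_real:
  assumes "0 \<le> \<rho>" "\<rho> < 1"
  shows "1 \<le> cmod (spiral_map (of_real \<rho>))" "cmod (spiral_map (of_real \<rho>)) \<le> exp c"
proof -
  have x: "L - ln (1 - \<rho>) > 8" by (rule L_ln_pos[OF assms])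
  then have eq: "cmod (spiral_map (of_real \<rho>)) = exp (c * (L - ln (1 - \<rho>)) powr - \<delta>)"
    using assms by (simp add: spiral_map_def Q_real Lam_real del: of_real_diff)
  show "1 \<le> cmod (spiral_map (of_real \<rho>))" unfolding eq using c by simp
  have "(L - ln (1 - \<rho>)) powr - \<delta> \<le> 1 powr - \<delta>" using x \<delta> by (intro powr_mono2') auto
  then show "cmod (spiral_map (of_real \<rho>)) \<le> exp c" unfolding eq using c by simp
qed

lemma spiral_fun_bounded:
  assumes "0 \<le> \<rho>" "\<rho> < 1"
  shows "cmod (spiral_fun (of_real \<rho>)) \<le> 2 * exp c / cmod D0"
proof -
  have "cmod (spiral_map (of_real \<rho>) - spiral_map 0) \<le> exp c + exp c"
    by (rule order_trans[OF norm_triangle_ineq4 add_mono])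
      (use cmod_spiral_map_real(2)[OF assms] cmod_spiral_map_real(2)[of 0] in auto)
  then show ?thesis unfolding spiral_fun_def norm_divide by (intro divide_right_mono) auto
qed

text \<open>The modulus of \<open>spiral_map\<close> is at least 1 on the radius, so the length is
  at least the total angle, the increase of x powr \<beta> with x = L - ln (1 - \<rho>), up to the
  normalising factor D0.\<close>

lemma radial_length_spiral:
  assumes r: "0 \<le> r" "r < 1"
  shows "((L + ln (1 / (1 - r))) powr \<beta> - L powr \<beta>) / cmod D0 \<le> radial_length spiral_fun 0 r"
proof -
  have rl: "radial_length spiral_fun 0 r = integral {0..r} (\<lambda>\<rho>. cmod (deriv spiral_fun (of_real \<rho>)))"
    using radial_length_harmonic[of spiral_fun "\<lambda>_. 0" spiral_fun r 0] spiral_fun_holomorphic r by simp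
  let ?u = "\<lambda>\<rho>. (L - ln (1 - \<rho>)) powr \<beta> / cmod D0"
  let ?u' = "\<lambda>\<rho>. \<beta> * (L - ln (1 - \<rho>)) powr (\<beta> - 1) / (1 - \<rho>) / cmod D0"
  have x: "L - ln (1 - \<rho>) > 0" if "0 \<le> \<rho>" "\<rho> < 1" for \<rho>
    using L_ln_pos[OF that] by simp
  have "(?u' has_integral ?u r - ?u 0) {0..r}"
  proof (rule fundamental_theorem_of_calculus)
    fix \<rho> assume \<rho>: "\<rho> \<in> {0..r}"
    have "((\<lambda>\<rho>. L - ln (1 - \<rho>)) has_real_derivative 1 / (1 - \<rho>)) (at \<rho>)"
      using \<rho> r by (auto intro!: derivative_eq_intros simp: field_simps)
    from DERIV_chain2[OF has_real_derivative_powr[OF x] this, of \<beta>]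
    have "((\<lambda>\<rho>. (L - ln (1 - \<rho>)) powr \<beta>) has_real_derivative \<beta> * (L - ln (1 - \<rho>)) powr (\<beta> - 1) * (1 / (1 - \<rho>))) (at \<rho>)"
      using \<rho> r by simp
    from DERIV_cdivide[OF this, of "cmod D0"]
    show "(?u has_vector_derivative ?u' \<rho>) (at \<rho> within {0..r})"
      by (simp add: has_real_derivative_iff_has_vector_derivative has_vector_derivative_at_within)
  qed (use r in simp)
  then have int: "integral {0..r} ?u' = ?u r - ?u 0" and io: "?u' integrable_on {0..r}" by auto
  have "integral {0..r} ?u' \<le> integral {0..r} (\<lambda>\<rho>. cmod (deriv spiral_fun (of_real \<rho>)))"
  proof (rule integral_le[OF io])
    have "continuous_on {0..r} (\<lambda>\<rho>. deriv spiral_fun (of_real \<rho>))"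
      by (rule continuous_on_compose2[OF holomorphic_on_imp_continuous_on[OF holomorphic_deriv[OF spiral_fun_holomorphic open_ball]]])
        (use r in \<open>auto intro!: continuous_intros\<close>)
    then show "(\<lambda>\<rho>. cmod (deriv spiral_fun (of_real \<rho>))) integrable_on {0..r}"
      by (intro integrable_continuous_interval continuous_intros)
    fix \<rho> assume \<rho>: "\<rho> \<in> {0..r}"
    then have \<rho>1: "0 \<le> \<rho>" "\<rho> < 1" using r by auto
    have "deriv spiral_fun (of_real \<rho>) = spiral_map (of_real \<rho>) * (Lam' (Q (of_real \<rho>)) / (1 - of_real \<rho>)) / D0"
      by (rule DERIV_imp_deriv[OF has_derivative_spiral_fun]) (use \<rho>1 in simp)
    moreover have "cmod (1 - of_real \<rho>) = 1 - \<rho>"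
      using \<rho>1 by (metis abs_of_nonneg diff_ge_0_iff_ge less_imp_le norm_of_real of_real_1 of_real_diff)
    ultimately have "cmod (deriv spiral_fun (of_real \<rho>))
        = cmod (spiral_map (of_real \<rho>)) * (cmod (Lam' (of_real (L - ln (1 - \<rho>)))) / (1 - \<rho>)) / cmod D0"
      by (simp only: norm_mult norm_divide Q_real[OF \<rho>1])
    moreover have "\<dots> \<ge> 1 * (\<beta> * (L - ln (1 - \<rho>)) powr (\<beta> - 1) / (1 - \<rho>)) / cmod D0"
      using \<rho>1 \<beta> by (intro divide_right_mono mult_mono cmod_spiral_map_real Lam'_lower x) auto
    ultimately show "?u' \<rho> \<le> cmod (deriv spiral_fun (of_real \<rho>))" by simp
  qed
  then show ?thesis unfolding rl int using r by (simp add: ln_div diff_divide_distrib)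
qed

end

text \<open>The equation fixes c in terms of \<beta> alone; as \<beta> - 1 < 0 < \<beta>, the
  conditions on X then hold for all large X.\<close>

lemma spiral_exists:
  assumes "0 < \<beta>" "\<beta> < 1 / 2"
  shows "\<exists>c X. spiral \<beta> c X"
proof -
  define \<delta> where "\<delta> = 1 - 2 * \<beta>"
  define c where "c = 2 * \<beta> / (\<delta> / \<beta> * 2 powr (- (\<delta> / \<beta>) - 1))"
  have \<delta>: "\<delta> > 0" using assms by (simp add: \<delta>_def)
  have c: "c > 0" using assms \<delta> by (simp add: c_def)
  have "((\<lambda>x. c * \<delta> * x powr (\<beta> - 1)) \<longlongrightarrow> c * \<delta> * 0) at_top"
    by (intro tendsto_mult_left tendsto_neg_powr filterlim_ident) (use assms in simp)
  then have "eventually (\<lambda>x. c * \<delta> * x powr (\<beta> - 1) < \<beta> / 2) at_top"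
    by (rule order_tendstoD(2)) (use assms in simp)
  moreover have "eventually (\<lambda>x. x powr \<beta> \<ge> 4) at_top"
  proof (rule eventually_mono[OF eventually_ge_at_top])
    fix x :: real assume "4 powr (1 / \<beta>) \<le> x"
    then have "(4 powr (1 / \<beta>)) powr \<beta> \<le> x powr \<beta>" using assms by (intro powr_mono2) auto
    then show "x powr \<beta> \<ge> 4" using assms by (simp add: powr_powr)
  qed
  moreover have "eventually (\<lambda>x. x \<ge> (8::real)) at_top" by (rule eventually_ge_at_top)
  ultimately have "eventually (\<lambda>x. c * \<delta> * x powr (\<beta> - 1) < \<beta> / 2 \<and> x powr \<beta> \<ge> 4 \<and> x \<ge> 8) at_top"
    by (intro eventually_conj)
  then obtain X where "c * \<delta> * X powr (\<beta> - 1) < \<beta> / 2" "X powr \<beta> \<ge> 4" "X \<ge> 8"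
    using eventually_happens[of _ "at_top :: real filter"] by auto
  moreover have "c * (\<delta> / \<beta>) * 2 powr (- (\<delta> / \<beta>) - 1) = 2 * \<beta>"
    using assms \<delta> by (simp add: c_def)
  ultimately have "spiral \<beta> c X"
    using assms c unfolding spiral_def \<delta>_def by auto
  then show ?thesis by blast
qed

subsection \<open>The theorem\<close>

lemma S_H_quasiconformal_disc:
  assumes f: "f \<in> S_H" "quasiconformal_on K (ball 0 1) f" and K: "K \<ge> 1"
  obtains h g where "qc_harmonic_disc K f h g" "f 0 = 0"
proof -
  obtain h g where hg: "h holomorphic_on ball 0 1" "g holomorphic_on ball 0 1" "h 0 = 0" "g 0 = 0"
    "\<And>z. z \<in> ball 0 1 \<Longrightarrow> f z = h z + cnj (g z)"
    "\<And>z. z \<in> ball 0 1 \<Longrightarrow> (cmod (deriv h z))\<^sup>2 - (cmod (deriv g z))\<^sup>2 > 0" and inj: "inj_on f (ball 0 1)"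
    using f(1) unfolding S_H_def by blast
  have "qc_harmonic_disc K f h g"
    by unfold_locales (use K hg inj quasiconformal_harmonic_pointwise[OF hg(1,2,5,6) f(2)] in auto)
  moreover have "f 0 = 0" using hg(3,4) hg(5)[of 0] by simp
  ultimately show thesis using that by blast
qed

context qc_harmonic_disc begin

text \<open>The dyadic estimate starts at 1/2. The length I over [0, 1/2] is absorbed because for r
  > 1/2 the maximum is at least m, which is positive by univalence, and \<open>psi r\<close> is at
  least sqrt (ln 2). This is how C comes to depend on F and \<theta>.\<close>

lemma radial_length_le:
  assumes F0: "F 0 = 0"
  shows "\<exists>C>0. \<forall>r\<in>{1/2<..<1}. radial_length F \<theta> r \<le> C * (SUP \<rho>\<in>{0..r}. cmod (F (of_real \<rho> * cis \<theta>))) * psi r"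
proof -
  define q where "q \<rho> = cmod (deriv H (of_real \<rho> * cis \<theta>) + cis (- 2 * \<theta>) * cnj (deriv G (of_real \<rho> * cis \<theta>)))" for \<rho>
  have in_disc: "of_real \<rho> * cis \<theta> \<in> ball 0 1" if "0 \<le> \<rho>" "\<rho> < 1" for \<rho> using that by (simp add: norm_mult)
  have contq: "continuous_on {0..b} q" if "b < 1" for b
  proof -
    have c: "continuous_on {0..b} (\<lambda>\<rho>. deriv u (of_real \<rho> * cis \<theta>))" if u: "u holomorphic_on ball 0 1" for u
    proof (rule continuous_on_compose2[OF holomorphic_on_imp_continuous_on[OF holomorphic_deriv[OF u open_ball]]])
      show "continuous_on {0..b} (\<lambda>\<rho>. of_real \<rho> * cis \<theta>)" by (intro continuous_intros)
      show "(\<lambda>\<rho>. of_real \<rho> * cis \<theta>) ` {0..b} \<subseteq> ball 0 1"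
        using \<open>b < 1\<close> in_disc by auto
    qed
    show ?thesis unfolding q_def[abs_def] by (intro continuous_intros c H G)
  qed
  have contF: "continuous_on {0..r} (\<lambda>\<rho>. cmod (F (of_real \<rho> * cis \<theta>)))" if "r < 1" for r
    by (intro continuous_on_norm continuous_on_compose2[OF continuous_on_F])
      (use that in_disc in \<open>auto intro!: continuous_intros\<close>)
  define M where "M r = (SUP \<rho>\<in>{0..r}. cmod (F (of_real \<rho> * cis \<theta>)))" for r
  have M: "cmod (F (of_real \<rho> * cis \<theta>)) \<le> M r" if "\<rho> \<in> {0..r}" "r < 1" for \<rho> r
    unfolding M_def
    by (rule cSUP_upper[OF that(1)])
      (rule bounded_imp_bdd_above[OF compact_imp_bounded[OF compact_continuous_image[OF contF[OF that(2)] compact_Icc]]])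
  define m where "m = cmod (F (of_real (1 / 2) * cis \<theta>))"
  have m: "m > 0"
  proof -
    have "F (of_real (1 / 2) * cis \<theta>) \<noteq> F 0"
      using inj_onD[OF inj, of "of_real (1 / 2) * cis \<theta>" 0] in_disc[of "1 / 2"] by auto
    then show ?thesis using F0 by (simp add: m_def)
  qed
  define I where "I = integral {0..1/2} q"
  have I: "I \<ge> 0" unfolding I_def
    by (intro integral_nonneg integrable_continuous_interval contq) (auto simp: q_def)
  define C1 where "C1 = 16 * sqrt (pi * K) * harnack_const K (3/4) / sqrt (ln 2)"
  have C1: "C1 \<ge> 0" using K by (simp add: C1_def harnack_const_def)
  \<comment> \<open>The final summand 1 ensures that C is positive.\<close>
  define C where "C = I / (m * sqrt (ln 2)) + C1 + 1"
  have "radial_length F \<theta> r \<le> C * M r * psi r" if r: "r \<in> {1/2<..<1}" for r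
  proof -
    have r': "1 / 2 \<le> r" "r < 1" using r by auto
    have l: "ln 2 \<le> ln (1 / (1 - r))"
      using r by (subst ln_le_cancel_iff) (auto simp: field_simps)
    have psi: "psi r = sqrt (ln (1 / (1 - r)))"
      unfolding psi_def using l by (intro powr_half_sqrt) (use ln_gt_zero[of "2::real"] in linarith)
    have psi_ge: "sqrt (ln 2) \<le> psi r" unfolding psi using l by simp
    have Mm: "m \<le> M r" unfolding m_def by (rule M) (use r in auto)
    have "radial_length F \<theta> r = integral {0..r} q"
      unfolding q_def by (rule radial_length_harmonic[OF H G F r'(2)])
    also have "\<dots> = I + integral {1/2..r} q"
      unfolding I_def by (rule Henstock_Kurzweil_Integration.integral_combine[symmetric])
        (use r' in \<open>auto intro!: integrable_continuous_interval contq\<close>)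
    also have "integral {1/2..r} q \<le> 16 * sqrt (pi * K) * harnack_const K (3/4) * M r * sqrt (ln (1 / (1 - r)) / ln 2)"
      unfolding q_def by (rule radial_integral_bound[OF F0 r']) (use M r' in auto)
    also have "\<dots> = C1 * (M r * psi r)" by (simp add: C1_def psi real_sqrt_divide)
    also have "I = I / (m * sqrt (ln 2)) * (m * sqrt (ln 2))" using m by simp
    also have "\<dots> \<le> I / (m * sqrt (ln 2)) * (M r * psi r)"
      using Mm psi_ge m I by (intro mult_left_mono mult_mono) auto
    finally have "radial_length F \<theta> r \<le> (I / (m * sqrt (ln 2)) + C1) * (M r * psi r)"
      by (simp add: distrib_right)
    also have "\<dots> \<le> C * (M r * psi r)"
      unfolding C_def using Mm m psi_ge by (intro mult_right_mono mult_nonneg_nonneg) (auto intro: order_trans[of _ "sqrt (ln 2)"])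
    finally show ?thesis by (simp add: mult.assoc)
  qed
  moreover have "C > 0" unfolding C_def using I C1 m by (intro add_nonneg_pos add_nonneg_nonneg) auto
  ultimately show ?thesis unfolding M_def by blast
qed

text \<open>The hypothesis controls F only near the end of the radius; the remaining compact part is
  bounded by continuity, so all the suprema are bounded by one M.\<close>

lemma radial_length_bigo:
  assumes F0: "F 0 = 0" and bdd: "(\<lambda>r. F (of_real r * cis \<theta>)) \<in> O[at_left 1](\<lambda>_. 1)"
  shows "radial_length F \<theta> \<in> O[at_left 1](psi)"
proof -
  obtain C where C: "C > 0" "\<And>r. r \<in> {1/2<..<1} \<Longrightarrow> radial_length F \<theta> r \<le> C * (SUP \<rho>\<in>{0..r}. cmod (F (of_real \<rho> * cis \<theta>))) * psi r"
    using radial_length_le[OF F0] by blast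
  obtain B where "eventually (\<lambda>r. cmod (F (of_real r * cis \<theta>)) \<le> B) (at_left 1)"
    using bdd by (elim landau_o.bigE) auto
  then obtain b where b: "b < 1" "\<And>r. b < r \<Longrightarrow> r < 1 \<Longrightarrow> cmod (F (of_real r * cis \<theta>)) \<le> B"
    unfolding eventually_at_left_field by blast
  have cont: "continuous_on {0..b} (\<lambda>\<rho>. cmod (F (of_real \<rho> * cis \<theta>)))"
    by (intro continuous_on_norm continuous_on_compose2[OF continuous_on_F])
      (use b in \<open>auto intro!: continuous_intros simp: norm_mult\<close>)
  obtain B' where B': "\<forall>r\<in>{0..b}. cmod (F (of_real r * cis \<theta>)) \<le> B'"
    using compact_imp_bounded[OF compact_continuous_image[OF cont compact_Icc]] unfolding bounded_iff by auto
  define M where "M = max B B'"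
  have M: "cmod (F (of_real \<rho> * cis \<theta>)) \<le> M" if "0 \<le> \<rho>" "\<rho> < 1" for \<rho>
    using that b(2)[of \<rho>] B'[rule_format, of \<rho>] by (cases "\<rho> \<le> b") (auto simp: M_def)
  show ?thesis
  proof (rule bigoI[where c = "C * M"])
    have "eventually (\<lambda>r. r \<in> {1/2<..<1}) (at_left (1::real))"
      by (rule eventually_at_left_field[THEN iffD2]) (auto intro!: exI[of _ "1/2"])
    then show "eventually (\<lambda>r. norm (radial_length F \<theta> r) \<le> C * M * norm (psi r)) (at_left 1)"
    proof (rule eventually_mono)
      fix r :: real assume r: "r \<in> {1/2<..<1}"
      have "(SUP \<rho>\<in>{0..r}. cmod (F (of_real \<rho> * cis \<theta>))) \<le> M"
        by (rule cSUP_least) (use r M in auto)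
      then have "C * (SUP \<rho>\<in>{0..r}. cmod (F (of_real \<rho> * cis \<theta>))) * psi r \<le> C * M * psi r"
        using C(1) by (intro mult_right_mono mult_left_mono) (auto simp: psi_def)
      then show "norm (radial_length F \<theta> r) \<le> C * M * norm (psi r)"
        using C(2)[OF r] radial_length_nonneg[of F \<theta> r] r by (simp add: psi_def)
    qed
  qed
qed

end

lemma (in spiral) radial_length_spiral_not_bigo:
  assumes \<tau>: "\<tau> < \<beta>"
  shows "radial_length spiral_fun 0 \<notin> O[at_left 1](\<lambda>r. ln (1 / (1 - r)) powr \<tau>)"
proof
  assume "radial_length spiral_fun 0 \<in> O[at_left 1](\<lambda>r. ln (1 / (1 - r)) powr \<tau>)"
  then obtain C where C: "C > 0" "eventually (\<lambda>r. \<bar>radial_length spiral_fun 0 r\<bar> \<le> C * (ln (1 / (1 - r)) powr \<tau>)) (at_left 1)"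
    by (elim landau_o.bigE) auto
  \<comment> \<open>A nonnegative exponent makes t powr \<tau>' at least 1 for t \<ge> 1, so that
    the constant L powr \<beta> can be absorbed.\<close>
  define \<tau>' where "\<tau>' = max \<tau> 0"
  have \<tau>': "\<tau>' < \<beta>" "0 \<le> \<tau>'" "\<tau> \<le> \<tau>'" using \<tau> \<beta> by (auto simp: \<tau>'_def)
  define A where "A = C * cmod D0 + L powr \<beta>"
  \<comment> \<open>The substitution r = 1 - exp (- t) turns ln (1 / (1 - r)) into t and the
    contradiction into a comparison of powers at infinity.\<close>
  have sub: "filterlim (\<lambda>t. 1 - exp (- t)) (at_left 1) (at_top :: real filter)"
    unfolding filterlim_at
  proof (intro conjI)
    have "((\<lambda>t::real. 1 - exp (- t)) \<longlongrightarrow> 1 - 0) at_top"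
      by (intro tendsto_diff tendsto_const filterlim_compose[OF exp_at_bot filterlim_uminus_at_bot_at_top])
    then show "((\<lambda>t::real. 1 - exp (- t)) \<longlongrightarrow> 1) at_top" by simp
  qed (auto intro!: always_eventually)
  have "eventually (\<lambda>t. t powr (\<beta> - \<tau>') \<le> A) at_top"
    using filterlim_iff[THEN iffD1, OF sub, rule_format, OF C(2)] eventually_ge_at_top[of 1]
  proof eventually_elim
    fix t :: real
    assume le: "\<bar>radial_length spiral_fun 0 (1 - exp (- t))\<bar> \<le> C * (ln (1 / (1 - (1 - exp (- t)))) powr \<tau>)" and t: "1 \<le> t"
    have lt: "ln (1 / (1 - (1 - exp (- t)))) = t" by (simp add: ln_div)
    have "((L + t) powr \<beta> - L powr \<beta>) / cmod D0 \<le> radial_length spiral_fun 0 (1 - exp (- t))"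
      using radial_length_spiral[of "1 - exp (- t)"] t unfolding lt by simp
    also have "\<dots> \<le> C * t powr \<tau>" using le unfolding lt by simp
    also have "\<dots> \<le> C * t powr \<tau>'" using C(1) t \<tau>' by (intro mult_left_mono powr_mono) auto
    finally have "(L + t) powr \<beta> - L powr \<beta> \<le> C * t powr \<tau>' * cmod D0" using D0_nz by (simp add: pos_divide_le_eq)
    moreover have "t powr \<beta> \<le> (L + t) powr \<beta>" using t L_pos \<beta> by (intro powr_mono2) auto
    moreover have "L powr \<beta> * 1 \<le> L powr \<beta> * t powr \<tau>'"
      using t \<tau>' by (intro mult_left_mono ge_one_powr_ge_zero) auto
    ultimately have "t powr \<beta> \<le> A * t powr \<tau>'" by (simp add: A_def algebra_simps)
    then show "t powr (\<beta> - \<tau>') \<le> A" using t by (simp add: powr_diff pos_divide_le_eq)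
  qed
  moreover have "eventually (\<lambda>t. t powr (\<beta> - \<tau>') > A) at_top"
  proof (rule eventually_mono[OF eventually_gt_at_top])
    have A0: "A > 0" unfolding A_def using C D0_nz by (intro add_pos_nonneg) auto
    fix t :: real assume t: "A powr (1 / (\<beta> - \<tau>')) < t"
    then have "(A powr (1 / (\<beta> - \<tau>'))) powr (\<beta> - \<tau>') < t powr (\<beta> - \<tau>')"
      using \<tau>' by (intro powr_less_mono2) auto
    then show "t powr (\<beta> - \<tau>') > A" using A0 \<tau>' by (simp add: powr_powr)
  qed
  ultimately have "eventually (\<lambda>t::real. False) at_top" by eventually_elim simp
  then show False by simp
qed

theorem theorem1:
  fixes K :: real
  assumes "K \<ge> 1"
  shows
    "(\<forall>f \<theta>. f \<in> S_H \<and> quasiconformal_on K (ball 0 1) f \<and> \<theta> \<in> {0..2*pi} \<longrightarrow>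
        (\<exists>C\<^sub>2>0. \<forall>r\<in>{1/2<..<1}.
           radial_length f \<theta> r
             \<le> C\<^sub>2 * (SUP \<rho>\<in>{0..r}. cmod (f (of_real \<rho> * cis \<theta>))) * psi r) \<and>
        ((\<lambda>r. f (of_real r * cis \<theta>)) \<in> O[at_left 1](\<lambda>_. 1) \<longrightarrow>
           radial_length f \<theta> \<in> O[at_left 1](psi)))
     \<and> (\<forall>\<tau><1/2.
          \<not> (\<forall>f \<theta>. f \<in> S_H \<and> quasiconformal_on K (ball 0 1) f \<and> \<theta> \<in> {0..2*pi} \<and>
                (\<lambda>r. f (of_real r * cis \<theta>)) \<in> O[at_left 1](\<lambda>_. 1) \<longrightarrow>
                radial_length f \<theta> \<in> O[at_left 1](\<lambda>r. ln (1 / (1 - r)) powr \<tau>)))"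
proof (intro conjI allI impI)
  fix f \<theta> assume f: "f \<in> S_H \<and> quasiconformal_on K (ball 0 1) f \<and> \<theta> \<in> {0..2*pi}"
  obtain h g where hg: "qc_harmonic_disc K f h g" "f 0 = 0"
    using S_H_quasiconformal_disc[OF _ _ assms] f by blast
  show "\<exists>C\<^sub>2>0. \<forall>r\<in>{1/2<..<1}. radial_length f \<theta> r
             \<le> C\<^sub>2 * (SUP \<rho>\<in>{0..r}. cmod (f (of_real \<rho> * cis \<theta>))) * psi r"
    by (rule qc_harmonic_disc.radial_length_le[OF hg])
  assume "(\<lambda>r. f (of_real r * cis \<theta>)) \<in> O[at_left 1](\<lambda>_. 1)"
  then show "radial_length f \<theta> \<in> O[at_left 1](psi)"
    by (rule qc_harmonic_disc.radial_length_bigo[OF hg])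
next
  fix \<tau> :: real assume \<tau>: "\<tau> < 1 / 2"
  \<comment> \<open>The midpoint between max \<tau> 0 and 1/2: a spiral requires 0 < \<beta> < 1/2,
    and its length outgrows the power \<tau> because \<tau> < \<beta>.\<close>
  define \<beta> where "\<beta> = (max \<tau> 0 + 1 / 2) / 2"
  have \<beta>_bounds: "0 < \<beta>" "\<beta> < 1 / 2" "\<tau> < \<beta>" using \<tau> by (auto simp: \<beta>_def max_def)
  obtain c X where "spiral \<beta> c X" using spiral_exists[OF \<beta>_bounds(1,2)] by blast
  then interpret spiral \<beta> c X .
  have "spiral_fun \<in> S_H"
    by (rule conformal_in_S_H[OF spiral_fun_holomorphic inj_spiral_fun spiral_fun_0])
  moreover have "quasiconformal_on K (ball 0 1) spiral_fun"
    by (rule conformal_quasiconformal_on[OF spiral_fun_holomorphic inj_spiral_fun assms])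
  moreover have "(\<lambda>r. spiral_fun (of_real r * cis 0)) \<in> O[at_left 1](\<lambda>_. 1)"
  proof (rule bigoI[where c = "2 * exp c / cmod D0"])
    have "eventually (\<lambda>r. r \<in> {0<..<1}) (at_left (1::real))"
      by (rule eventually_at_left_field[THEN iffD2]) (auto intro!: exI[of _ 0])
    then show "eventually (\<lambda>r. norm (spiral_fun (of_real r * cis 0)) \<le> 2 * exp c / cmod D0 * norm (1::complex)) (at_left 1)"
      by eventually_elim (use spiral_fun_bounded in simp)
  qed
  moreover have "(0::real) \<in> {0..2 * pi}" by simp
  ultimately show "\<not> (\<forall>f \<theta>. f \<in> S_H \<and> quasiconformal_on K (ball 0 1) f \<and> \<theta> \<in> {0..2*pi} \<and>
                (\<lambda>r. f (of_real r * cis \<theta>)) \<in> O[at_left 1](\<lambda>_. 1) \<longrightarrow>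
                radial_length f \<theta> \<in> O[at_left 1](\<lambda>r. ln (1 / (1 - r)) powr \<tau>))"
    using radial_length_spiral_not_bigo[OF \<beta>_bounds(3)] by blast
qed

end
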